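(* Let $V\in L^2([0,\pi];dx)$ be complex-valued, and let $H^P$ and $H^{AP}$ be the realizations of $-\frac{d^2}{dx^2}+V(x)$ in $L^2([0,\pi];dx)$ with periodic and antiperiodic boundary conditions, respectively. Then the system of root vectors of $H^P$ contains a Riesz basis in $L^2([0,\pi];dx)$ if and only if the system of root vectors of $H^P$ contains a Schauder basis in $L^2([0,\pi];dx)$. Likewise, the system of root vectors of $H^{AP}$ contains a Riesz basis in $L^2([0,\pi];dx)$ if and only if the system of root vectors of $H^{AP}$ contains a Schauder basis in $L^2([0,\pi];dx)$.
   Context: Operators. Let $L=-\frac{d^2}{dx^2}+V(x)$ on $[0,\pi]$. Each of $H^P,H^{AP}$ acts as $f\mapsto Lf$ on the domain of all $g\in L^2([0,\pi];dx)$ with $g,g'$ absolutely continuous on $[0,\pi]$, $Lg\in L^2([0,\pi];dx)$, and the boundary conditions: $g(\pi)=g(0),\ g'(\pi)=g'(0)$ for $H^P$; $g(\pi)=-g(0),\ g'(\pi)=-g'(0)$ for $H^{AP}$. These operators are closed, densely defined, with compact resolvent. Root vectors. For such an operator $A$ and an eigenvalue $\lambda$, the root vectors of $A$ for $\lambda$ are the nonzero $f$ with $(A-\lambda I)^m f=0$ for some $m\in\mathbb N$. The system of root vectors of $A$ is the collection of all root vectors for all eigenvalues; it "contains" a basis if some sequence of root vectors is such a basis. Riesz basis. A system $\{f_k\}_{k\in\mathbb N}$ in a complex separable Hilbert space $\mathcal H$ is a Riesz basis if there exist a bounded operator $A$ on $\mathcal H$ with bounded everywhere defined inverse and an orthonormal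 basis $\{e_k\}_{k\in\mathbb N}$ of $\mathcal H$ with $f_k=Ae_k$ for all $k$. Schauder basis. A sequence $\{f_k\}_{k\in\mathbb N}\subset\mathcal H$ is a Schauder basis in $\mathcal H$ if for each $f\in\mathcal H$ there exist unique $c_k=c_k(f)\in\mathbb C$, $k\in\mathbb N$, such that $f=\sum_{k\in\mathbb N}c_k(f)f_k$ converges in the norm of $\mathcal H$. *)

theory Defs
  imports "HOL-Analysis.Analysis"
begin

section \<open>Complex inner product spaces and bases\<close>

text \<open>The inner product is antilinear in the first argument. The underlying real structure
  (norm, metric, topology) is that of the real inner product \<open>Re (cinner x y)\<close>, so that
  the norm is \<open>sqrt (Re (cinner x x))\<close>.\<close>

class complex_inner = real_inner +
  fixes scaleC :: "complex \<Rightarrow> 'a \<Rightarrow> 'a"  (infixr \<open>*\<^sub>C\<close> 75)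
    and cinner :: "'a \<Rightarrow> 'a \<Rightarrow> complex"
  assumes scaleC_add_right: "c *\<^sub>C (x + y) = c *\<^sub>C x + c *\<^sub>C y"
    and scaleC_add_left: "(c + d) *\<^sub>C x = c *\<^sub>C x + d *\<^sub>C x"
    and scaleC_scaleC: "c *\<^sub>C (d *\<^sub>C x) = (c * d) *\<^sub>C x"
    and scaleR_scaleC: "r *\<^sub>R x = complex_of_real r *\<^sub>C x"
    and cinner_commute: "cinner x y = cnj (cinner y x)"
    and cinner_add_right: "cinner x (y + z) = cinner x y + cinner x z"
    and cinner_scaleC_right: "cinner x (c *\<^sub>C y) = c * cinner x y"
    and inner_cinner: "inner x y = Re (cinner x y)"

lemma vector_space_scaleC: "vector_space ((*\<^sub>C) :: complex \<Rightarrow> 'a::complex_inner \<Rightarrow> 'a)"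
proof
  show "1 *\<^sub>C x = x" for x :: 'a
    using scaleR_scaleC[of 1 x] by simp
qed (auto simp: scaleC_add_right scaleC_add_left scaleC_scaleC)

definition bounded_clinear :: "('a::complex_inner \<Rightarrow> 'b::complex_inner) \<Rightarrow> bool" where
  "bounded_clinear A \<longleftrightarrow> bounded_linear A \<and> (\<forall>c x. A (c *\<^sub>C x) = c *\<^sub>C A x)"

definition orthonormal_basis :: "(nat \<Rightarrow> 'a::complex_inner) \<Rightarrow> bool" where
  "orthonormal_basis e \<longleftrightarrow>
     (\<forall>j k. cinner (e j) (e k) = (if j = k then 1 else 0)) \<and>
     closure (module.span (*\<^sub>C) (range e)) = UNIV"

definition schauder_basis :: "(nat \<Rightarrow> 'a::complex_inner) \<Rightarrow> bool" where
  "schauder_basis f \<longleftrightarrow> (\<forall>h. \<exists>!c::nat \<Rightarrow> complex. (\<lambda>k. c k *\<^sub>C f k) sums h)"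

definition riesz_basis :: "(nat \<Rightarrow> 'a::complex_inner) \<Rightarrow> bool" where
  "riesz_basis f \<longleftrightarrow>
     (\<exists>A e. bounded_clinear (A :: 'a \<Rightarrow> 'a) \<and> bij A \<and> bounded_clinear (inv A) \<and>
            orthonormal_basis e \<and> (\<forall>k. f k = A (e k)))"


section \<open>Root vectors of unbounded operators\<close>

text \<open>An unbounded operator is represented by its graph, so composition (and hence the domain of
  a power) is relational composition: \<open>(f, g) \<in> A ^^ m\<close> says that \<open>f\<close> lies in the domain of the
  \<open>m\<close>-th power of \<open>A\<close> and is mapped to \<open>g\<close>.\<close>

definition eigenvalue :: "('a::complex_inner \<times> 'a) set \<Rightarrow> complex \<Rightarrow> bool" where
  "eigenvalue A \<mu> \<longleftrightarrow> (\<exists>f. f \<noteq> 0 \<and> (f, \<mu> *\<^sub>C f) \<in> A)"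

definition shift_op :: "('a::complex_inner \<times> 'a) set \<Rightarrow> complex \<Rightarrow> ('a \<times> 'a) set" where
  "shift_op A \<mu> = {(f, g - \<mu> *\<^sub>C f) | f g. (f, g) \<in> A}"

definition root_vectors :: "('a::complex_inner \<times> 'a) set \<Rightarrow> 'a set" where
  "root_vectors A =
     {f. f \<noteq> 0 \<and> (\<exists>\<mu> m. eigenvalue A \<mu> \<and> (f, 0) \<in> shift_op A \<mu> ^^ m)}"


section \<open>The Hilbert space of square integrable functions on the interval from 0 to pi\<close>

abbreviation I_pi :: "real measure" where
  "I_pi \<equiv> lebesgue_on {0..pi}"

definition square_integrable :: "(real \<Rightarrow> complex) \<Rightarrow> bool" where
  "square_integrable f \<longleftrightarrow>
     f \<in> borel_measurable I_pi \<and> integrable I_pi (\<lambda>x. (cmod (f x))\<^sup>2)"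

lemma square_integrable_zero: "square_integrable (\<lambda>_. 0)"
  by (simp add: square_integrable_def)

lemma square_integrable_mult:
  assumes "square_integrable f" "square_integrable g"
  shows "integrable I_pi (\<lambda>x. cnj (f x) * g x)"
proof (rule Bochner_Integration.integrable_bound)
  show "integrable I_pi (\<lambda>x. (cmod (f x))\<^sup>2 + (cmod (g x))\<^sup>2)"
    using assms by (simp add: square_integrable_def)
  have [measurable]: "f \<in> borel_measurable I_pi" "g \<in> borel_measurable I_pi"
    using assms by (auto simp: square_integrable_def)
  show "(\<lambda>x. cnj (f x) * g x) \<in> borel_measurable I_pi"
    by (intro borel_measurable_times borel_measurable_continuous_on[of cnj] continuous_intros) auto
  have "cmod (f x) * cmod (g x) \<le> (cmod (f x))\<^sup>2 + (cmod (g x))\<^sup>2" for x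
  proof -
    have "0 \<le> (cmod (f x) - cmod (g x))\<^sup>2" "0 \<le> cmod (f x) * cmod (g x)"
      by auto
    then show ?thesis unfolding power2_diff by linarith
  qed
  then show "AE x in I_pi. norm (cnj (f x) * g x) \<le> norm ((cmod (f x))\<^sup>2 + (cmod (g x))\<^sup>2)"
    by (simp add: norm_mult)
qed

lemma square_integrable_add:
  assumes "square_integrable f" "square_integrable g"
  shows "square_integrable (\<lambda>x. f x + g x)"
  unfolding square_integrable_def
proof
  have [measurable]: "f \<in> borel_measurable I_pi" "g \<in> borel_measurable I_pi"
    using assms by (auto simp: square_integrable_def)
  show m: "(\<lambda>x. f x + g x) \<in> borel_measurable I_pi"
    by measurable
  show "integrable I_pi (\<lambda>x. (cmod (f x + g x))\<^sup>2)"
  proof (rule Bochner_Integration.integrable_bound)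
    show "integrable I_pi (\<lambda>x. 2 * (cmod (f x))\<^sup>2 + 2 * (cmod (g x))\<^sup>2)"
      using assms by (simp add: square_integrable_def)
    show "(\<lambda>x. (cmod (f x + g x))\<^sup>2) \<in> borel_measurable I_pi"
      by measurable
    have "(cmod (f x + g x))\<^sup>2 \<le> 2 * (cmod (f x))\<^sup>2 + 2 * (cmod (g x))\<^sup>2" for x
    proof -
      have "(cmod (f x + g x))\<^sup>2 \<le> (cmod (f x) + cmod (g x))\<^sup>2"
        by (intro power_mono norm_triangle_ineq) auto
      moreover have "0 \<le> (cmod (f x) - cmod (g x))\<^sup>2"
        by auto
      ultimately show ?thesis
        by (simp add: power2_diff power2_sum)
    qed
    then show "AE x in I_pi. norm ((cmod (f x + g x))\<^sup>2)
                 \<le> norm (2 * (cmod (f x))\<^sup>2 + 2 * (cmod (g x))\<^sup>2)"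
      by simp
  qed
qed

lemma square_integrable_scale:
  assumes "square_integrable f"
  shows "square_integrable (\<lambda>x. c * f x)"
  using assms by (auto simp: square_integrable_def norm_mult power_mult_distrib)

definition L2_rel :: "(real \<Rightarrow> complex) \<Rightarrow> (real \<Rightarrow> complex) \<Rightarrow> bool" where
  "L2_rel f g \<longleftrightarrow>
     square_integrable f \<and> square_integrable g \<and> (AE x in I_pi. f x = g x)"

text \<open>The values of \<open>abs_L2\<close> are meaningful only on square integrable functions.\<close>

quotient_type L2 = "real \<Rightarrow> complex" / partial: L2_rel
proof (rule part_equivpI)
  show "\<exists>f. L2_rel f f"
    by (auto simp: L2_rel_def intro!: exI[of _ "\<lambda>_. 0"] square_integrable_zero)
  show "symp L2_rel"
    by (auto simp: symp_def L2_rel_def elim: eventually_mono)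
  show "transp L2_rel"
    by (auto simp: transp_def L2_rel_def elim: eventually_elim2)
qed

lemma L2_rel_add:
  assumes "L2_rel f f'" "L2_rel g g'"
  shows "L2_rel (\<lambda>x. f x + g x) (\<lambda>x. f' x + g' x)"
  using assms by (auto simp: L2_rel_def square_integrable_add elim: eventually_elim2)

lemma L2_rel_scale:
  assumes "L2_rel f f'"
  shows "L2_rel (\<lambda>x. c * f x) (\<lambda>x. c * f' x)"
  using assms by (auto simp: L2_rel_def square_integrable_scale elim: eventually_mono)

lemma L2_rel_integral:
  assumes "L2_rel f f'" "L2_rel g g'"
  shows "(LINT x|I_pi. cnj (f x) * g x) = (LINT x|I_pi. cnj (f' x) * g' x)"
proof (rule integral_cong_AE)
  show "(\<lambda>x. cnj (f x) * g x) \<in> borel_measurable I_pi"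
       "(\<lambda>x. cnj (f' x) * g' x) \<in> borel_measurable I_pi"
    using assms by (auto simp: L2_rel_def intro!: borel_measurable_integrable square_integrable_mult)
  show "AE x in I_pi. cnj (f x) * g x = cnj (f' x) * g' x"
    using assms by (auto simp: L2_rel_def elim: eventually_elim2)
qed

instantiation L2 :: complex_inner
begin

lift_definition zero_L2 :: L2 is "\<lambda>_. 0"
  by (simp add: L2_rel_def square_integrable_zero)

lift_definition plus_L2 :: "L2 \<Rightarrow> L2 \<Rightarrow> L2" is "\<lambda>f g x. f x + g x"
  by (rule L2_rel_add)

lift_definition scaleC_L2 :: "complex \<Rightarrow> L2 \<Rightarrow> L2" is "\<lambda>c f x. c * f x"
  by (rule L2_rel_scale)

lift_definition cinner_L2 :: "L2 \<Rightarrow> L2 \<Rightarrow> complex" is "\<lambda>f g. LINT x|I_pi. cnj (f x) * g x"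
  by (rule L2_rel_integral)

definition uminus_L2 :: "L2 \<Rightarrow> L2" where "- (f::L2) = (-1) *\<^sub>C f"
definition minus_L2 :: "L2 \<Rightarrow> L2 \<Rightarrow> L2" where "f - g = f + - (g :: L2)"
definition scaleR_L2 :: "real \<Rightarrow> L2 \<Rightarrow> L2" where "r *\<^sub>R (f::L2) = complex_of_real r *\<^sub>C f"
definition inner_L2 :: "L2 \<Rightarrow> L2 \<Rightarrow> real" where "inner f g = Re (cinner f (g::L2))"
definition norm_L2 :: "L2 \<Rightarrow> real" where "norm f = sqrt (inner f (f::L2))"
definition sgn_L2 :: "L2 \<Rightarrow> L2" where "sgn (f::L2) = inverse (norm f) *\<^sub>R f"
definition dist_L2 :: "L2 \<Rightarrow> L2 \<Rightarrow> real" where "dist f g = norm (f - g :: L2)"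
definition uniformity_L2 :: "(L2 \<times> L2) filter" where
  "uniformity_L2 = (INF e\<in>{0 <..}. principal {(f, g). dist f g < e})"
definition open_L2 :: "L2 set \<Rightarrow> bool" where
  "open_L2 U \<longleftrightarrow> (\<forall>f\<in>U. eventually (\<lambda>(f', g). f' = f \<longrightarrow> g \<in> U) uniformity)"

instance
proof
  fix f g h :: L2 and c d :: complex and r s :: real
  show assoc: "f + g + h = f + (g + h)" for f g h :: L2
    by transfer (auto simp: L2_rel_def add.assoc intro!: square_integrable_add)
  show comm: "f + g = g + f" for f g :: L2
    by transfer (auto simp: L2_rel_def add.commute intro!: square_integrable_add)
  show "0 + f = f"
    by transfer (auto simp: L2_rel_def)
  show uminus: "- f + f = 0"
    unfolding uminus_L2_def by transfer (auto simp: L2_rel_def intro: square_integrable_zero)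
  show "f - g = f + - g"
    by (rule minus_L2_def)
  show add_right: "c *\<^sub>C (f + g) = c *\<^sub>C f + c *\<^sub>C g" for c and f g :: L2
    by transfer
      (auto simp: L2_rel_def distrib_left intro!: square_integrable_add square_integrable_scale)
  show add_left: "(c + d) *\<^sub>C f = c *\<^sub>C f + d *\<^sub>C f" for c d and f :: L2
    by transfer
      (auto simp: L2_rel_def distrib_right intro!: square_integrable_add square_integrable_scale)
  show scale: "c *\<^sub>C (d *\<^sub>C f) = (c * d) *\<^sub>C f" for c d and f :: L2
    by transfer (auto simp: L2_rel_def mult.assoc intro!: square_integrable_scale)
  have one: "1 *\<^sub>C f = f" for f :: L2
    by transfer (auto simp: L2_rel_def)
  show "r *\<^sub>R f = complex_of_real r *\<^sub>C f"
    by (rule scaleR_L2_def)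
  show "r *\<^sub>R (f + g) = r *\<^sub>R f + r *\<^sub>R g" "(r + s) *\<^sub>R f = r *\<^sub>R f + s *\<^sub>R f"
       "r *\<^sub>R s *\<^sub>R f = (r * s) *\<^sub>R f" "1 *\<^sub>R f = f"
    by (simp_all add: scaleR_L2_def add_right add_left scale one)
  show "sgn f = inverse (norm f) *\<^sub>R f" "dist f g = norm (f - g)"
    by (simp_all add: sgn_L2_def dist_L2_def)
  show "uniformity = (INF e\<in>{0 <..}. principal {(f, g :: L2). dist f g < e})"
    by (rule uniformity_L2_def)
  show "open U \<longleftrightarrow> (\<forall>f\<in>U. eventually (\<lambda>(f', g). f' = f \<longrightarrow> g \<in> U) uniformity)" for U :: "L2 set"
    by (rule open_L2_def)
  show cinner_commute: "cinner f g = cnj (cinner g f)" for f g :: L2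
    by transfer (subst Bochner_Integration.integral_cnj[symmetric], simp add: mult.commute)
  show cinner_add: "cinner f (g + h) = cinner f g + cinner f h" for f g h :: L2
    by transfer (auto simp: L2_rel_def distrib_left square_integrable_mult)
  show cinner_scale: "cinner f (c *\<^sub>C g) = c * cinner f g" for c and f g :: L2
    by transfer (simp add: mult.left_commute)
  show "inner f g = Re (cinner f g)"
    by (rule inner_L2_def)
  show inner_commute: "inner f g = inner g f" for f g :: L2
    by (subst (1) inner_L2_def, subst cinner_commute) (simp add: inner_L2_def)
  show "inner (f + g) h = inner f h + inner g h"
    by (simp add: inner_commute[of _ h]) (simp add: inner_L2_def cinner_add)
  show "inner (r *\<^sub>R f) g = r * inner f g"
    by (simp add: inner_commute[of _ g]) (simp add: inner_L2_def cinner_scale scaleR_L2_def)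
  have self: "cnj z * z = complex_of_real ((cmod z)\<^sup>2)" for z
    by (metis complex_norm_square mult.commute)
  show "0 \<le> inner f f"
    unfolding inner_L2_def by transfer (simp add: self del: of_real_power)
  show "inner f f = 0 \<longleftrightarrow> f = 0"
    unfolding inner_L2_def
  proof transfer
    fix f assume "L2_rel f f"
    then have sq: "square_integrable f" by (simp add: L2_rel_def)
    have "Re (LINT x|I_pi. cnj (f x) * f x) = (LINT x|I_pi. (cmod (f x))\<^sup>2)"
      by (simp add: self del: of_real_power)
    also have "\<dots> = 0 \<longleftrightarrow> (AE x in I_pi. (cmod (f x))\<^sup>2 = 0)"
      using sq by (intro integral_nonneg_eq_0_iff_AE) (auto simp: square_integrable_def)
    finally show "Re (LINT x|I_pi. cnj (f x) * f x) = 0 \<longleftrightarrow> L2_rel f (\<lambda>_. 0)"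
      using sq by (simp add: L2_rel_def square_integrable_zero)
  qed
  show "norm f = sqrt (inner f f)"
    by (rule norm_L2_def)
qed

end


section \<open>The periodic and antiperiodic Schroedinger operators\<close>

definition absolutely_continuous_on_Icc :: "real \<Rightarrow> real \<Rightarrow> (real \<Rightarrow> complex) \<Rightarrow> bool" where
  "absolutely_continuous_on_Icc a b f \<longleftrightarrow>
     (\<forall>\<epsilon>>0. \<exists>\<delta>>0. \<forall>D. finite D \<longrightarrow> (\<forall>(s, t)\<in>D. a \<le> s \<and> s \<le> t \<and> t \<le> b) \<longrightarrow>
        pairwise (\<lambda>(s, t) (u, v). {s<..<t} \<inter> {u<..<v} = {}) D \<longrightarrow>
        (\<Sum>(s, t)\<in>D. t - s) < \<delta> \<longrightarrow> (\<Sum>(s, t)\<in>D. cmod (f t - f s)) < \<epsilon>)"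

text \<open>The derivative relative to the interval, one-sided at the end points.\<close>

definition D_pi :: "(real \<Rightarrow> complex) \<Rightarrow> real \<Rightarrow> complex" where
  "D_pi g x = vector_derivative g (at x within {0..pi})"

definition schroedinger_expr :: "(real \<Rightarrow> complex) \<Rightarrow> (real \<Rightarrow> complex) \<Rightarrow> real \<Rightarrow> complex" where
  "schroedinger_expr V g x = - D_pi (D_pi g) x + V x * g x"

text \<open>Absolute continuity of the derivative means that it exists everywhere and is absolutely
  continuous. The second derivative then exists almost everywhere, which determines the class of
  \<open>schroedinger_expr V g\<close>.\<close>

definition maximal_domain :: "(real \<Rightarrow> complex) \<Rightarrow> (real \<Rightarrow> complex) set" where
  "maximal_domain V =
     {g. absolutely_continuous_on_Icc 0 pi g \<and>
         (\<forall>x\<in>{0..pi}. g differentiable (at x within {0..pi})) \<and>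
         absolutely_continuous_on_Icc 0 pi (D_pi g) \<and>
         square_integrable g \<and> square_integrable (schroedinger_expr V g)}"

definition H_P :: "(real \<Rightarrow> complex) \<Rightarrow> (L2 \<times> L2) set" where
  "H_P V = {(abs_L2 g, abs_L2 (schroedinger_expr V g)) | g.
     g \<in> maximal_domain V \<and> g pi = g 0 \<and> D_pi g pi = D_pi g 0}"

definition H_AP :: "(real \<Rightarrow> complex) \<Rightarrow> (L2 \<times> L2) set" where
  "H_AP V = {(abs_L2 g, abs_L2 (schroedinger_expr V g)) | g.
     g \<in> maximal_domain V \<and> g pi = - g 0 \<and> D_pi g pi = - D_pi g 0}"

end

(*
Idea. Expanding in exp(i (2 m + theta) x), theta = 0 (periodic) or 1 (antiperiodic), turns the
equation H h = w into
    <e_m, w> = om(m)^2 <e_m, h> + <b_m, h>,   om(m) = |2 m + theta|,  |b_m| <= B,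
and nothing else about the operator is used. Summing these equations shows that H - z is bounded
below when z stays at distance L from all squares, so every eigenvalue lies within L of some n^2.
The finite dimensional invariant subspaces with spectrum near n^2 are handled by triangularization:
at z = n^2 + i L the resolvent has Hilbert-Schmidt norm bounded independently of n, which bounds the
dimension of the cluster space T_n uniformly in n, and the part of w in T_n orthogonal to the
frequencies om(m) = n is at most C / (n + 1) times the norm of w. As the sum of 1 / (n + 1)^2
converges, vectors from different clusters with large n are almost orthogonal:
    |sum w_n|^2 >= (1/4) sum |w_n|^2.
A Schauder basis has uniformly bounded coordinate functionals, hence uniformly good angles inside
each cluster, and the finitely many remaining vectors are controlled by the coordinate functionals
themselves. So the normalized Schauder basis satisfies two-sided square sum estimates, that is, it
is a Riesz basis.
*)
theory Submission
  imports Defs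
begin

section \<open>Complex inner product spaces\<close>

text \<open>Multiplication by V is unbounded in L^2, but |e_m| is constant, so <e_m, V g> = <cnj V
  e_m, g> is bounded by the norm of g uniformly in m. This coefficientwise bound is weaker than a
  bounded perturbation; the summability of 1 / |n^2 - z|^2 over n makes up for it, and L makes that
  sum small enough to absorb the perturbation. The obstacle is inside a cluster: it may contain
  Jordan chains, or eigenvectors whose angles degenerate as n grows. So T_n enters only through its
  dimension and its closeness to the frequency n, while the angles are supplied by the given
  Schauder basis. Orthonormal triangular bases take the place of Riesz projections, because on them
  the resolvent is obtained by back substitution. The rate 1 / n comes from the gap |y^2 - n^2| >= n
  |y - n| between squares. On the concrete side the second derivative exists only almost everywhere.
  Integration by parts therefore rests on writing an absolutely continuous function as an integral,
  with a density obtained from total variation and the Radon-Nikodym theorem.\<close>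

interpretation cspace: vector_space "(*\<^sub>C) :: complex \<Rightarrow> 'a::complex_inner \<Rightarrow> 'a"
  by (rule vector_space_scaleC)

lemma cinner_add_left: "cinner (x + y) z = cinner x z + cinner y z"
  by (metis cinner_add_right cinner_commute complex_cnj_add)

lemma cinner_scaleC_left: "cinner (c *\<^sub>C x) y = cnj c * cinner x y"
  by (metis cinner_commute cinner_scaleC_right complex_cnj_mult)

lemma scaleC_minus1: "(-1) *\<^sub>C x = - (x::'a::complex_inner)"
  using cspace.scale_minus_left[of 1 x] by simp

lemma cinner_minus_right: "cinner x (- y) = - cinner x y"
  using cinner_scaleC_right[of x "-1" y] by (simp add: scaleC_minus1)

lemma cinner_minus_left: "cinner (- x) y = - cinner x y"
  using cinner_scaleC_left[of "-1" x y] by (simp add: scaleC_minus1)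

lemma cinner_diff_right: "cinner x (y - z) = cinner x y - cinner x z"
  using cinner_add_right[of x y "-z"] by (simp add: cinner_minus_right)

lemma cinner_diff_left: "cinner (x - y) z = cinner x z - cinner y z"
  using cinner_add_left[of x "-y" z] by (simp add: cinner_minus_left)

lemma cinner_zero_right [simp]: "cinner x 0 = 0"
  using cinner_diff_right[of x 0 0] by simp

lemma cinner_zero_left [simp]: "cinner 0 x = 0"
  using cinner_diff_left[of 0 0 x] by simp

lemma cinner_sum_right: "cinner x (\<Sum>i\<in>F. f i) = (\<Sum>i\<in>F. cinner x (f i))"
  by (induction F rule: infinite_finite_induct) (auto simp: cinner_add_right)

lemma cinner_sum_left: "cinner (\<Sum>i\<in>F. f i) x = (\<Sum>i\<in>F. cinner (f i) x)"
  by (induction F rule: infinite_finite_induct) (auto simp: cinner_add_left)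

lemma cinner_self: "cinner x x = complex_of_real ((norm x)\<^sup>2)"
proof -
  have "Im (cinner x x) = 0"
    using arg_cong[OF cinner_commute[of x x], of Im] by simp
  moreover have "Re (cinner x x) = (norm x)\<^sup>2"
    by (simp add: inner_cinner[symmetric] power2_norm_eq_inner)
  ultimately show ?thesis
    by (simp add: complex_eq_iff)
qed

lemma norm_scaleC: "norm (c *\<^sub>C x) = cmod c * norm (x::'a::complex_inner)"
proof -
  have "complex_of_real ((norm (c *\<^sub>C x))\<^sup>2) = c * cnj c * complex_of_real ((norm x)\<^sup>2)"
    unfolding cinner_self[symmetric] cinner_scaleC_left cinner_scaleC_right by (simp only: mult_ac)
  also have "\<dots> = complex_of_real ((cmod c * norm x)\<^sup>2)"
    by (simp only: complex_norm_square[symmetric] of_real_mult[symmetric] power_mult_distrib)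
  finally have "(norm (c *\<^sub>C x))\<^sup>2 = (cmod c * norm x)\<^sup>2"
    using of_real_eq_iff by blast
  then show ?thesis
    by (simp add: power2_eq_iff_nonneg)
qed

text \<open>Rotating \<open>y\<close> by a unimodular \<open>u\<close> makes the product real and
  nonnegative. There it equals the real inner product, which has its own Cauchy-Schwarz
  inequality.\<close>

lemma cinner_norm_bound: "cmod (cinner x y) \<le> norm x * norm y"
proof -
  obtain u where u: "cmod u = 1" "u * cinner x y = complex_of_real (cmod (cinner x y))"
  proof (cases "cinner x y = 0")
    case True then show ?thesis by (intro that[of 1]) auto
  next
    case False
    let ?z = "cinner x y" and ?r = "cmod (cinner x y)"
    have "complex_of_real (1 / ?r) * cnj ?z * ?z = complex_of_real (1 / ?r) * complex_of_real (?r\<^sup>2)"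
      unfolding complex_norm_square by (simp only: mult_ac)
    also have "\<dots> = complex_of_real ?r"
      using False unfolding of_real_mult[symmetric] by (simp add: power2_eq_square)
    finally show ?thesis
      using False by (intro that[of "complex_of_real (1 / ?r) * cnj ?z"]) (simp_all add: norm_mult norm_divide)
  qed
  have "cmod (cinner x y) = Re (cinner x (u *\<^sub>C y))"
    by (simp add: cinner_scaleC_right u)
  also have "\<dots> = inner x (u *\<^sub>C y)"
    by (simp add: inner_cinner)
  also have "\<dots> \<le> norm x * norm (u *\<^sub>C y)"
    by (rule norm_cauchy_schwarz)
  finally show ?thesis
    by (simp add: norm_scaleC u)
qed

lemma bounded_linear_cinner_right: "bounded_linear (cinner x)"
proof (rule bounded_linear_intro[where K="norm x"])
  show "cinner x (r *\<^sub>R y) = r *\<^sub>R cinner x y" for r y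
    by (simp add: scaleR_scaleC cinner_scaleC_right scaleR_conv_of_real)
  show "norm (cinner x y) \<le> norm y * norm x" for y
    using cinner_norm_bound[of x y] by (simp add: mult.commute)
qed (simp add: cinner_add_right)

lemma bounded_linear_scaleC: "bounded_linear (\<lambda>x::'a::complex_inner. c *\<^sub>C x)"
  by (rule bounded_linear_intro[where K="cmod c"])
    (auto simp: scaleC_add_right scaleR_scaleC scaleC_scaleC norm_scaleC mult.commute)

section \<open>Orthonormal families\<close>

text \<open>The index type is free so that the exponentials can be indexed by the integers;
  \<open>orthonormal_basis\<close> is the case of \<open>nat\<close>.\<close>

definition onb :: "('i \<Rightarrow> 'a::complex_inner) \<Rightarrow> bool" where
  "onb e \<longleftrightarrow> (\<forall>j k. cinner (e j) (e k) = (if j = k then 1 else 0)) \<and>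
     closure (cspace.span (range e)) = UNIV"

lemma onb_cinner: "onb e \<Longrightarrow> cinner (e j) (e k) = (if j = k then 1 else 0)"
  by (simp add: onb_def)

lemma norm_sum_orthonormal:
  assumes "\<And>j k. j \<in> F \<Longrightarrow> k \<in> F \<Longrightarrow> cinner (e j) (e k) = (if j = k then 1 else 0)"
  shows "(norm (\<Sum>m\<in>F. a m *\<^sub>C e m))\<^sup>2 = (\<Sum>m\<in>F. (cmod (a m))\<^sup>2)"
proof (cases "finite F")
  case True
  have "complex_of_real ((norm (\<Sum>m\<in>F. a m *\<^sub>C e m))\<^sup>2)
      = (\<Sum>j\<in>F. \<Sum>k\<in>F. cnj (a j) * (a k * cinner (e j) (e k)))"
    by (simp add: cinner_self[symmetric] cinner_sum_left cinner_sum_right cinner_scaleC_left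
        cinner_scaleC_right del: of_real_power)
      (subst sum.swap, simp add: sum_distrib_left mult_ac)
  also have "\<dots> = (\<Sum>j\<in>F. cnj (a j) * a j)"
    using True by (intro sum.cong) (auto simp: assms if_distrib cong: if_cong)
  also have "\<dots> = complex_of_real (\<Sum>m\<in>F. (cmod (a m))\<^sup>2)"
    by (simp add: complex_norm_square[symmetric] mult.commute complex_norm_square)
  finally show ?thesis
    using of_real_eq_iff by blast
qed auto

lemma cinner_sum_orthonormal:
  assumes "\<And>j k. j \<in> F \<Longrightarrow> k \<in> F \<Longrightarrow> cinner (e j) (e k) = (if j = k then 1 else 0)" "finite F" "j \<in> F"
  shows "cinner (e j) (\<Sum>m\<in>F. a m *\<^sub>C e m) = a j"
proof -
  have "cinner (e j) (\<Sum>m\<in>F. a m *\<^sub>C e m) = (\<Sum>m\<in>F. if m = j then a m else 0)"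
    unfolding cinner_sum_right cinner_scaleC_right using assms by (intro sum.cong) auto
  then show ?thesis using assms by simp
qed

lemma norm_add_orthogonal:
  assumes "cinner x y = 0"
  shows "(norm (x + y))\<^sup>2 = (norm x)\<^sup>2 + (norm y)\<^sup>2"
proof -
  have "inner x y = 0" using assms by (simp add: inner_cinner)
  then show ?thesis
    by (simp add: power2_norm_eq_inner inner_add_left inner_add_right inner_commute)
qed

text \<open>The remainder is orthogonal to every combination of the \<open>e m\<close> with
  \<open>m \<in> F\<close>. Both claims are then Pythagoras, the second one with the competing error
  split into remainder plus such a combination.\<close>

lemma norm_minus_proj:
  assumes on: "\<And>j k. j \<in> F \<Longrightarrow> k \<in> F \<Longrightarrow> cinner (e j) (e k) = (if j = k then 1 else 0)" and "finite F"
  shows "(norm h)\<^sup>2 = (norm (h - (\<Sum>m\<in>F. cinner (e m) h *\<^sub>C e m)))\<^sup>2 + (\<Sum>m\<in>F. (cmod (cinner (e m) h))\<^sup>2)"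
    and "(norm (h - (\<Sum>m\<in>F. cinner (e m) h *\<^sub>C e m))) \<le> norm (h - (\<Sum>m\<in>F. a m *\<^sub>C e m))"
proof -
  let ?p = "\<Sum>m\<in>F. cinner (e m) h *\<^sub>C e m"
  have orth: "cinner (h - ?p) (\<Sum>m\<in>F. c m *\<^sub>C e m) = 0" for c
  proof -
    have "cinner (h - ?p) (e j) = 0" if "j \<in> F" for j
    proof -
      have "cinner (e j) (h - ?p) = 0"
        using cinner_sum_orthonormal[OF assms that, of "\<lambda>m. cinner (e m) h"] by (simp add: cinner_diff_right)
      then show ?thesis by (metis cinner_commute complex_cnj_zero)
    qed
    then show ?thesis by (simp add: cinner_sum_right cinner_scaleC_right)
  qed
  show "(norm h)\<^sup>2 = (norm (h - ?p))\<^sup>2 + (\<Sum>m\<in>F. (cmod (cinner (e m) h))\<^sup>2)"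
    using norm_add_orthogonal[OF orth[of "\<lambda>m. cinner (e m) h"]] norm_sum_orthonormal[of F e "\<lambda>m. cinner (e m) h"] on
    by simp
  have eq: "h - (\<Sum>m\<in>F. a m *\<^sub>C e m) = (h - ?p) + (\<Sum>m\<in>F. (cinner (e m) h - a m) *\<^sub>C e m)"
    by (simp add: cspace.scale_left_diff_distrib sum_subtractf)
  have "(norm (h - (\<Sum>m\<in>F. a m *\<^sub>C e m)))\<^sup>2 \<ge> (norm (h - ?p))\<^sup>2"
    unfolding eq norm_add_orthogonal[OF orth[of "\<lambda>m. cinner (e m) h - a m"]] by simp
  then show "norm (h - ?p) \<le> norm (h - (\<Sum>m\<in>F. a m *\<^sub>C e m))"
    by (rule power2_le_imp_le) simp
qed

lemma bessel:
  assumes "\<And>j k. j \<in> F \<Longrightarrow> k \<in> F \<Longrightarrow> cinner (e j) (e k) = (if j = k then 1 else 0)" "finite F"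
  shows "(\<Sum>m\<in>F. (cmod (cinner (e m) h))\<^sup>2) \<le> (norm h)\<^sup>2"
  using norm_minus_proj(1)[of F e h] assms by simp

lemma span_range_finite_sum:
  assumes "p \<in> cspace.span (range e)"
  obtains F a where "finite F" "p = (\<Sum>m\<in>F. a m *\<^sub>C e m)"
proof -
  obtain T r where T: "finite T" "T \<subseteq> range e" "p = (\<Sum>v\<in>T. r v *\<^sub>C v)"
    using assms unfolding cspace.span_explicit by blast
  obtain F where F: "inj_on e F" "T = e ` F"
    using T subset_image_inj[of T e UNIV] by blast
  then have "finite F"
    using T finite_imageD[of e F] by simp
  have "p = (\<Sum>m\<in>F. r (e m) *\<^sub>C e m)"
    using T F by (simp add: sum.reindex)
  with \<open>finite F\<close> show ?thesis by (rule that)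
qed

text \<open>The half of Parseval that turns coefficient estimates into norm estimates, with finite
  sums only. A dense finite combination is replaced by the projection onto the same indices, which
  is at least as close to \<open>h\<close>.\<close>

lemma norm_le_coefficients:
  assumes "onb e" "\<And>F. finite F \<Longrightarrow> (\<Sum>m\<in>F. (cmod (cinner (e m) h))\<^sup>2) \<le> X"
  shows "(norm h)\<^sup>2 \<le> X"
proof (rule field_le_epsilon)
  fix \<epsilon> :: real assume "\<epsilon> > 0"
  have "h \<in> closure (cspace.span (range e))"
    using assms by (simp add: onb_def)
  then obtain p where p: "p \<in> cspace.span (range e)" "dist p h < sqrt \<epsilon>"
    using \<open>\<epsilon> > 0\<close> by (meson closure_approachable real_sqrt_gt_zero)
  then obtain F a where F: "finite F" "p = (\<Sum>m\<in>F. a m *\<^sub>C e m)"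
    by (elim span_range_finite_sum)
  let ?q = "h - (\<Sum>m\<in>F. cinner (e m) h *\<^sub>C e m)"
  have on: "cinner (e j) (e k) = (if j = k then 1 else 0)" for j k
    using assms by (simp add: onb_def)
  have "norm ?q \<le> norm (h - p)"
    unfolding F(2) by (intro norm_minus_proj(2)) (auto simp: on F)
  then have "norm ?q \<le> sqrt \<epsilon>"
    using p by (simp add: dist_norm norm_minus_commute)
  then have "(norm ?q)\<^sup>2 \<le> (sqrt \<epsilon>)\<^sup>2"
    by (intro power_mono) auto
  then show "(norm h)\<^sup>2 \<le> X + \<epsilon>"
    using norm_minus_proj(1)[of F e h] on F assms(2)[OF F(1)] \<open>\<epsilon> > 0\<close> by simp
qed

section \<open>Schauder bases and Riesz bases\<close>

text \<open>Otherwise the complements of the closures are open and dense with empty intersection,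
  against Baire. Closures appear because the sets to which this is applied are not known to be
  closed.\<close>

lemma baire_countable_union:
  fixes A :: "nat \<Rightarrow> 'a::complete_space set"
  assumes "(\<Union>n. A n) = UNIV"
  obtains n x r where "r > 0" "ball x r \<subseteq> closure (A n)"
proof (rule ccontr)
  assume H: "\<not> thesis"
  have dense: "closure (- closure (A n)) = UNIV" for n
  proof (rule ccontr)
    assume "closure (- closure (A n)) \<noteq> UNIV"
    then have "interior (closure (A n)) \<noteq> {}" unfolding closure_complement by auto
    then obtain x where "x \<in> interior (closure (A n))" by blast
    then obtain r where "r > 0" "ball x r \<subseteq> closure (A n)" using mem_interior by blast
    then show False using H that by blast
  qed
  have "Met_TC.mtopology closure_of \<Inter>(range (\<lambda>n. - closure (A n))) = UNIV"
  proof (rule Met_TC.metric_Baire_category)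
    show "Met_TC.mcomplete TYPE('a)"
      unfolding mcomplete_iff_complete by (rule complete_UNIV)
  qed (auto simp: dense)
  moreover have "\<Inter>(range (\<lambda>n. - closure (A n))) = {}"
    using assms closure_subset by blast
  ultimately show False by (simp only: closure_of_empty) simp
qed

definition schauder_coeff :: "(nat \<Rightarrow> 'a::complex_inner) \<Rightarrow> 'a \<Rightarrow> nat \<Rightarrow> complex" where
  "schauder_coeff f h = (THE c. (\<lambda>k. c k *\<^sub>C f k) sums h)"

context
  fixes f :: "nat \<Rightarrow> 'a::{complex_inner, banach}"
  assumes f: "schauder_basis f"
begin

lemma schauder_coeff_sums: "(\<lambda>k. schauder_coeff f h k *\<^sub>C f k) sums h"
  using f theI'[of "\<lambda>c. (\<lambda>k. c k *\<^sub>C f k) sums h"] unfolding schauder_basis_def schauder_coeff_def by blast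

lemma schauder_coeff_unique: "(\<lambda>k. c k *\<^sub>C f k) sums h \<Longrightarrow> schauder_coeff f h = c"
  using f schauder_coeff_sums unfolding schauder_basis_def by blast

lemma schauder_coeff_diff: "schauder_coeff f (h - h') = (\<lambda>k. schauder_coeff f h k - schauder_coeff f h' k)"
  by (rule schauder_coeff_unique)
    (simp add: cspace.scale_left_diff_distrib sums_diff[OF schauder_coeff_sums schauder_coeff_sums])

lemma schauder_coeff_scale: "schauder_coeff f (a *\<^sub>C h) = (\<lambda>k. a * schauder_coeff f h k)"
  by (rule schauder_coeff_unique)
    (use bounded_linear.sums[OF bounded_linear_scaleC schauder_coeff_sums, of a h] in simp)

lemma schauder_coeff_sum:
  assumes "finite F"
  shows "schauder_coeff f (\<Sum>k\<in>F. a k *\<^sub>C f k) = (\<lambda>k. if k \<in> F then a k else 0)"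
proof (rule schauder_coeff_unique)
  have "(\<lambda>k. (if k \<in> F then a k else 0) *\<^sub>C f k) sums (\<Sum>k\<in>F. (if k \<in> F then a k else 0) *\<^sub>C f k)"
    by (rule sums_finite[OF assms]) auto
  then show "(\<lambda>k. (if k \<in> F then a k else 0) *\<^sub>C f k) sums (\<Sum>k\<in>F. a k *\<^sub>C f k)" by simp
qed

lemma schauder_basis_nonzero: "f k \<noteq> 0"
proof
  assume "f k = 0"
  then have "(\<lambda>j. (if j = k then 1 else 0 :: complex) *\<^sub>C f j) = (\<lambda>j. 0)" by auto
  then have "schauder_coeff f 0 = (\<lambda>j. if j = k then 1 else 0)"
    by (intro schauder_coeff_unique) simp
  moreover have "schauder_coeff f 0 = (\<lambda>j. 0)"
    by (intro schauder_coeff_unique) simp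
  ultimately show False by (metis zero_neq_one)
qed

definition schauder_sum :: "nat \<Rightarrow> 'a \<Rightarrow> 'a" where
  "schauder_sum N h = (\<Sum>k<N. schauder_coeff f h k *\<^sub>C f k)"

lemma schauder_sum_tendsto: "(\<lambda>N. schauder_sum N h) \<longlonglongrightarrow> h"
  using schauder_coeff_sums[of h] by (simp add: sums_def schauder_sum_def)

lemma schauder_sum_diff: "schauder_sum N (h - h') = schauder_sum N h - schauder_sum N h'"
  by (simp add: schauder_sum_def schauder_coeff_diff cspace.scale_left_diff_distrib sum_subtractf)

lemma schauder_sum_scale: "schauder_sum N (a *\<^sub>C h) = a *\<^sub>C schauder_sum N h"
  by (simp add: schauder_sum_def schauder_coeff_scale cspace.scale_sum_right)

text \<open>Baire is applied to the sets of vectors whose partial sums are bounded by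
  \<open>n\<close>. Continuity of the partial sums is still unknown, so the ball lies only in a
  closure, and the conclusion speaks of approximants of \<open>y\<close> instead of
  \<open>y\<close>.\<close>

lemma schauder_sum_approx:
  obtains K where "K \<ge> 0" "\<And>y \<epsilon>. \<epsilon> > 0 \<Longrightarrow> \<exists>a. (\<forall>N. norm (schauder_sum N a) \<le> K * norm y) \<and> norm (y - a) < \<epsilon>"
proof -
  define A where "A n = {h. \<forall>N. norm (schauder_sum N h) \<le> real n}" for n
  have "(\<Union>n. A n) = UNIV"
  proof -
    have "h \<in> (\<Union>n. A n)" for h
    proof -
      obtain B where B: "\<And>N. norm (schauder_sum N h) \<le> B"
        using convergent_imp_Bseq[OF convergentI[OF schauder_sum_tendsto[of h]]] 
        unfolding Bseq_def by blast
      obtain n :: nat where "B \<le> real n" using real_arch_simple by blast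
      then have "h \<in> A n" using B order_trans unfolding A_def by blast
      then show ?thesis by blast
    qed
    then show ?thesis by blast
  qed
  then obtain n x r where r: "r > 0" "ball x r \<subseteq> closure (A n)" by (rule baire_countable_union)
  \<comment> \<open>The ball around \<open>x\<close> is moved to the origin by subtracting an
    approximant of \<open>x\<close> from one of \<open>x + y\<close>; this doubles the bound
    \<open>n\<close>.\<close>
  have small: "\<exists>a. (\<forall>N. norm (schauder_sum N a) \<le> 2 * real n) \<and> norm (y - a) < \<epsilon>"
    if y: "norm y < r" and \<epsilon>: "\<epsilon> > 0" for y \<epsilon>
  proof -
    have "x + y \<in> closure (A n)" "x \<in> closure (A n)"
      using y r by (auto simp: dist_norm subset_iff)
    then obtain a a' where a: "a \<in> A n" "dist a (x + y) < \<epsilon> / 2" "a' \<in> A n" "dist a' x < \<epsilon> / 2"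
      using \<epsilon> unfolding closure_approachable by (meson half_gt_zero)
    have "norm (schauder_sum N (a - a')) \<le> 2 * real n" for N
    proof -
      have "norm (schauder_sum N a) \<le> real n" "norm (schauder_sum N a') \<le> real n"
        using a by (auto simp: A_def)
      then show ?thesis
        using norm_triangle_ineq4[of "schauder_sum N a" "schauder_sum N a'"]
        unfolding schauder_sum_diff by linarith
    qed
    moreover have eq: "y - (a - a') = (a' - x) - (a - (x + y))" by simp
    have "norm (y - (a - a')) < \<epsilon>"
      unfolding eq using a(2,4) norm_triangle_ineq4[of "a' - x" "a - (x + y)"] unfolding dist_norm by linarith
    ultimately show ?thesis by blast
  qed
  show ?thesis
  \<comment> \<open>The factor \<open>2 / r\<close> comes from scaling \<open>y\<close> to norm
    \<open>r / 2\<close>, safely inside the ball.\<close>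
  proof (rule that[of "2 * real n * (2 / r)"])
    show "2 * real n * (2 / r) \<ge> 0" using r by simp
    fix y :: 'a and \<epsilon> :: real assume \<epsilon>: "\<epsilon> > 0"
    show "\<exists>a. (\<forall>N. norm (schauder_sum N a) \<le> 2 * real n * (2 / r) * norm y) \<and> norm (y - a) < \<epsilon>"
    proof (cases "y = 0")
      case True
      have "schauder_sum N 0 = 0" for N using schauder_sum_diff[of N 0 0] by simp
      then show ?thesis using True \<epsilon> by (intro exI[of _ 0]) simp
    next
      case False
      define t where "t = r / (2 * norm y)"
      have t: "t > 0" using r False by (simp add: t_def)
      have "norm (complex_of_real t *\<^sub>C y) < r"
        using r False by (simp add: norm_scaleC t_def norm_divide norm_mult)
      moreover have "t * \<epsilon> > 0" using t \<epsilon> by simp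
      ultimately obtain a where a: "\<And>N. norm (schauder_sum N a) \<le> 2 * real n"
          "norm (complex_of_real t *\<^sub>C y - a) < t * \<epsilon>"
        using small by blast
      let ?s = "complex_of_real (1 / t)"
      have "norm (schauder_sum N (?s *\<^sub>C a)) \<le> 2 * real n * (2 / r) * norm y" for N
      proof -
        have "norm (schauder_sum N (?s *\<^sub>C a)) = 1 / t * norm (schauder_sum N a)"
          using t unfolding schauder_sum_scale norm_scaleC norm_of_real by simp
        also have "\<dots> \<le> 1 / t * (2 * real n)"
          using t a(1) by (intro mult_left_mono) auto
        also have "\<dots> = 2 * real n * (2 / r) * norm y" by (simp add: t_def)
        finally show ?thesis .
      qed
      moreover have "norm (y - ?s *\<^sub>C a) < \<epsilon>"
      proof -
        have "y - ?s *\<^sub>C a = ?s *\<^sub>C (complex_of_real t *\<^sub>C y - a)"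
          using t by (simp add: cspace.scale_right_diff_distrib)
        then have "norm (y - ?s *\<^sub>C a) = 1 / t * norm (complex_of_real t *\<^sub>C y - a)"
          using t by (simp add: norm_scaleC norm_divide)
        also have "\<dots> < 1 / t * (t * \<epsilon>)"
          using t a(2) by (intro mult_strict_left_mono) auto
        finally show ?thesis using t by simp
      qed
      ultimately show ?thesis by blast
    qed
  qed
qed

text \<open>The successive approximation argument of the open mapping theorem, run directly on the partial sums.\<close>

theorem schauder_sum_bounded:
  obtains K where "K \<ge> 0" "\<And>N y. norm (schauder_sum N y) \<le> K * norm y"
proof -
  obtain K where K: "K \<ge> 0" "\<And>y \<epsilon>. \<epsilon> > 0 \<Longrightarrow> \<exists>a. (\<forall>N. norm (schauder_sum N a) \<le> K * norm y) \<and> norm (y - a) < \<epsilon>"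
    by (rule schauder_sum_approx) blast
  have "norm (schauder_sum N y) \<le> 2 * K * norm y" for N y
  proof (cases "y = 0")
    case True
    then show ?thesis using schauder_sum_diff[of N 0 0] by simp
  next
    case False
    define \<beta> where "\<beta> = norm y"
    have \<beta>: "\<beta> > 0" using False by (simp add: \<beta>_def)
    \<comment> \<open>\<open>r j\<close> is what remains of \<open>y\<close> after \<open>j\<close>
      approximations. Each approximant \<open>r j - r (Suc j)\<close> has controlled partial sums
      and halves the bound on the remainder.\<close>
    have "\<exists>r. \<forall>j. (norm (r j) \<le> \<beta> / 2 ^ j \<and> (j = 0 \<longrightarrow> r j = y)) \<and>
        (\<forall>N. norm (schauder_sum N (r j - r (Suc j))) \<le> K * (\<beta> / 2 ^ j))"
    proof (rule dependent_nat_choice)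
      show "\<exists>x. norm x \<le> \<beta> / 2 ^ 0 \<and> (0 = 0 \<longrightarrow> x = y)" by (simp add: \<beta>_def)
    next
      fix x and j :: nat assume x: "norm x \<le> \<beta> / 2 ^ j \<and> (j = 0 \<longrightarrow> x = y)"
      have "\<beta> / 2 ^ Suc j > 0" using \<beta> by simp
      then obtain a where a: "\<And>N. norm (schauder_sum N a) \<le> K * norm x" "norm (x - a) < \<beta> / 2 ^ Suc j"
        using K(2) by blast
      have "K * norm x \<le> K * (\<beta> / 2 ^ j)" using x K(1) by (intro mult_left_mono) auto
      then have "\<forall>N. norm (schauder_sum N (x - (x - a))) \<le> K * (\<beta> / 2 ^ j)"
        using a(1) order_trans by (auto intro: order_trans)
      then show "\<exists>z. (norm z \<le> \<beta> / 2 ^ Suc j \<and> (Suc j = 0 \<longrightarrow> z = y)) \<and>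
          (\<forall>N. norm (schauder_sum N (x - z)) \<le> K * (\<beta> / 2 ^ j))"
        using a(2) by (intro exI[of _ "x - a"]) auto
    qed
    then obtain r where r: "\<And>j. norm (r j) \<le> \<beta> / 2 ^ j" "r 0 = y"
        "\<And>j N. norm (schauder_sum N (r j - r (Suc j))) \<le> K * (\<beta> / 2 ^ j)" by blast
    \<comment> \<open>The geometric series is summed with its tail subtracted, which lets the
      induction close. The bound does not depend on \<open>N\<close>; this uniformity later permits
      the exchange of limits.\<close>
    have incr: "norm (schauder_sum N (r j - r (j + i))) \<le> 2 * K * \<beta> / 2 ^ j" for N j i
    proof -
      have "norm (schauder_sum N (r j - r (j + i))) \<le> 2 * K * \<beta> / 2 ^ j - 2 * K * \<beta> / 2 ^ (j + i)"
      proof (induction i)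
        case 0
        then show ?case using schauder_sum_diff[of N 0 0] by simp
      next
        case (Suc i)
        have "r j - r (j + Suc i) = (r j - r (j + i)) - (r (j + Suc i) - r (j + i))" by simp
        then have "norm (schauder_sum N (r j - r (j + Suc i)))
            \<le> norm (schauder_sum N (r j - r (j + i))) + norm (schauder_sum N (r (j + i) - r (Suc (j + i))))"
          by (metis add_Suc_right norm_minus_commute norm_triangle_ineq4 schauder_sum_diff)
        also have "\<dots> \<le> (2 * K * \<beta> / 2 ^ j - 2 * K * \<beta> / 2 ^ (j + i)) + K * (\<beta> / 2 ^ (j + i))"
          by (intro add_mono Suc.IH r(3))
        also have "\<dots> = 2 * K * \<beta> / 2 ^ j - 2 * K * \<beta> / 2 ^ (j + Suc i)" by simp
        finally show ?case .
      qed
      moreover have "0 \<le> 2 * K * \<beta> / 2 ^ (j + i)" using K(1) \<beta> by simp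
      ultimately show ?thesis by linarith
    qed
    have zero: "(\<lambda>j. X / 2 ^ j) \<longlonglongrightarrow> 0" for X :: real
      using tendsto_mult[OF tendsto_const[of X] LIMSEQ_realpow_zero[of "1/2"]]
      by (simp add: power_divide)
    have cauchy: "Cauchy (\<lambda>j. schauder_sum N (r j))" for N
      unfolding Cauchy_altdef2
    proof (intro allI impI)
      fix \<epsilon> :: real assume "\<epsilon> > 0"
      then have "\<forall>\<^sub>F j in sequentially. 2 * K * \<beta> / 2 ^ j < \<epsilon>"
        using order_tendstoD(2)[OF zero] by blast
      then obtain J where J: "2 * K * \<beta> / 2 ^ J < \<epsilon>" by (auto simp: eventually_sequentially)
      have "dist (schauder_sum N (r n)) (schauder_sum N (r J)) < \<epsilon>" if "n \<ge> J" for n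
        using incr[of N J "n - J"] J that by (simp add: dist_norm schauder_sum_diff norm_minus_commute)
      then show "\<exists>M. \<forall>n\<ge>M. dist (schauder_sum N (r n)) (schauder_sum N (r M)) < \<epsilon>" by blast
    qed
    define R where "R N = lim (\<lambda>j. schauder_sum N (r j))" for N
    have R: "(\<lambda>j. schauder_sum N (r j)) \<longlonglongrightarrow> R N" for N
      unfolding R_def using cauchy Cauchy_convergent convergent_LIMSEQ_iff by blast
    have Rj: "norm (schauder_sum N (r j) - R N) \<le> 2 * K * \<beta> / 2 ^ j" for N j
    proof -
      have "(\<lambda>i. schauder_sum N (r j) - schauder_sum N (r (i + j))) \<longlonglongrightarrow> schauder_sum N (r j) - R N"
        by (intro tendsto_diff tendsto_const LIMSEQ_ignore_initial_segment R)
      then have "(\<lambda>i. norm (schauder_sum N (r j) - schauder_sum N (r (i + j)))) \<longlonglongrightarrow> norm (schauder_sum N (r j) - R N)"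
        by (rule tendsto_norm)
      then show ?thesis
        using incr[of N j] by (intro Lim_bounded) (auto simp: schauder_sum_diff add.commute)
    qed
    \<comment> \<open>At a fixed index the partial sums converge, hence so does their difference, a
      single term; \<open>f k \<noteq> 0\<close> passes this on to the coefficients.\<close>
    have coeff: "\<exists>q. (\<lambda>j. schauder_coeff f (r j) k) \<longlonglongrightarrow> q" for k
    proof -
      have "Cauchy (\<lambda>j. schauder_sum (Suc k) (r j) - schauder_sum k (r j))"
        by (intro convergent_Cauchy convergent_diff) (use R convergentI in blast)+
      then have C: "Cauchy (\<lambda>j. schauder_coeff f (r j) k *\<^sub>C f k)"
        by (simp add: schauder_sum_def)
      have "Cauchy (\<lambda>j. schauder_coeff f (r j) k)"
        unfolding Cauchy_def
      proof (intro allI impI)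
        fix \<epsilon> :: real assume "\<epsilon> > 0"
        then have "\<epsilon> * norm (f k) > 0" using schauder_basis_nonzero[of k] by simp
        then obtain M where M: "\<And>m n. m \<ge> M \<Longrightarrow> n \<ge> M \<Longrightarrow>
            dist (schauder_coeff f (r m) k *\<^sub>C f k) (schauder_coeff f (r n) k *\<^sub>C f k) < \<epsilon> * norm (f k)"
          using C unfolding Cauchy_def by blast
        have "dist (schauder_coeff f (r m) k) (schauder_coeff f (r n) k) < \<epsilon>" if "m \<ge> M" "n \<ge> M" for m n
          using M[OF that] schauder_basis_nonzero[of k]
          by (simp add: dist_norm norm_scaleC flip: cspace.scale_left_diff_distrib)
        then show "\<exists>M. \<forall>m\<ge>M. \<forall>n\<ge>M. dist (schauder_coeff f (r m) k) (schauder_coeff f (r n) k) < \<epsilon>" by blast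
      qed
      then show ?thesis using Cauchy_convergent_iff convergent_def by blast
    qed
    then obtain q where q: "\<And>k. (\<lambda>j. schauder_coeff f (r j) k) \<longlonglongrightarrow> q k" by metis
    have Rq: "R N = (\<Sum>k<N. q k *\<^sub>C f k)" for N
    proof (rule LIMSEQ_unique[OF R])
      have "(\<lambda>j. schauder_coeff f (r j) k *\<^sub>C f k) \<longlonglongrightarrow> q k *\<^sub>C f k" for k
      proof (rule tendstoI)
        fix \<epsilon> :: real assume "\<epsilon> > 0"
        then have "\<forall>\<^sub>F j in sequentially. dist (schauder_coeff f (r j) k) (q k) < \<epsilon> / norm (f k)"
          using schauder_basis_nonzero[of k] by (intro tendstoD[OF q]) auto
        then show "\<forall>\<^sub>F j in sequentially. dist (schauder_coeff f (r j) k *\<^sub>C f k) (q k *\<^sub>C f k) < \<epsilon>"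
          by eventually_elim (use schauder_basis_nonzero[of k] in
              \<open>simp add: dist_norm norm_scaleC pos_less_divide_eq flip: cspace.scale_left_diff_distrib\<close>)
      qed
      then show "(\<lambda>j. schauder_sum N (r j)) \<longlonglongrightarrow> (\<Sum>k<N. q k *\<^sub>C f k)"
        unfolding schauder_sum_def by (intro tendsto_sum)
    qed
    \<comment> \<open>Exchange of limits: \<open>schauder_sum N (r j)\<close> tends to
      \<open>R N\<close> uniformly in \<open>N\<close>, and \<open>r j\<close> tends to 0. So
      \<open>q\<close> expands 0 and vanishes by uniqueness; then \<open>R = 0\<close>, and the
      estimate at \<open>j = 0\<close> is the claim.\<close>
    have "R \<longlonglongrightarrow> 0"
    proof (rule tendstoI)
      fix \<epsilon> :: real assume "\<epsilon> > 0"
      have "(\<lambda>j. 2 * K * \<beta> / 2 ^ j + \<beta> / 2 ^ j) \<longlonglongrightarrow> 0 + 0"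
        by (intro tendsto_add zero)
      then have "\<forall>\<^sub>F j in sequentially. 2 * K * \<beta> / 2 ^ j + \<beta> / 2 ^ j < \<epsilon> / 2"
        using \<open>\<epsilon> > 0\<close> by (intro order_tendstoD(2)[where y=0]) auto
      then obtain J where J: "2 * K * \<beta> / 2 ^ J + \<beta> / 2 ^ J < \<epsilon> / 2" by (auto simp: eventually_sequentially)
      have "\<forall>\<^sub>F N in sequentially. dist (schauder_sum N (r J)) (r J) < \<epsilon> / 2"
        using \<open>\<epsilon> > 0\<close> by (intro tendstoD[OF schauder_sum_tendsto]) auto
      then show "\<forall>\<^sub>F N in sequentially. dist (R N) 0 < \<epsilon>"
      proof eventually_elim
        case (elim N)
        have "norm (R N) \<le> norm (schauder_sum N (r J) - R N) + norm (schauder_sum N (r J) - r J) + norm (r J)"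
          using norm_triangle_ineq4[of "schauder_sum N (r J)" "schauder_sum N (r J) - R N"]
            norm_triangle_ineq[of "schauder_sum N (r J) - r J" "r J"] by simp
        then show ?case using Rj[of N J] r(1)[of J] J elim unfolding dist_norm diff_zero by linarith
      qed
    qed
    then have "(\<lambda>k. q k *\<^sub>C f k) sums 0" by (simp add: sums_def Rq[symmetric])
    then have "schauder_coeff f 0 = q" by (rule schauder_coeff_unique)
    moreover have "schauder_coeff f 0 = (\<lambda>_. 0)" by (rule schauder_coeff_unique) simp
    ultimately have "q = (\<lambda>_. 0)" by simp
    then have "R N = 0" by (simp add: Rq)
    then show ?thesis using Rj[of N 0] r(2) by (simp add: \<beta>_def)
  qed
  then show ?thesis using that[of "2 * K"] K(1) by simp
qed

text \<open>A term of the expansion is the difference of two consecutive partial sums. The factor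
  \<open>norm (f j)\<close> stays because the basis is not normalized.\<close>

lemma schauder_coeff_bounded:
  obtains C where "C \<ge> 0" "\<And>F a j. finite F \<Longrightarrow> j \<in> F \<Longrightarrow> cmod (a j) * norm (f j) \<le> C * norm (\<Sum>k\<in>F. a k *\<^sub>C f k)"
proof -
  obtain K where K: "K \<ge> 0" "\<And>N y. norm (schauder_sum N y) \<le> K * norm y"
    by (rule schauder_sum_bounded) blast
  show ?thesis
  proof (rule that[of "2 * K"])
    show "2 * K \<ge> 0" using K by simp
    fix F :: "nat set" and a j assume F: "finite F" "j \<in> F"
    let ?w = "\<Sum>k\<in>F. a k *\<^sub>C f k"
    have "a j *\<^sub>C f j = schauder_sum (Suc j) ?w - schauder_sum j ?w"
      unfolding schauder_sum_def schauder_coeff_sum[OF F(1)] using F(2) by simp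
    then have "cmod (a j) * norm (f j) = norm (schauder_sum (Suc j) ?w - schauder_sum j ?w)"
      by (metis norm_scaleC)
    also have "\<dots> \<le> norm (schauder_sum (Suc j) ?w) + norm (schauder_sum j ?w)"
      by (rule norm_triangle_ineq4)
    also have "\<dots> \<le> 2 * K * norm ?w"
      using K(2)[of "Suc j" ?w] K(2)[of j ?w] by simp
    finally show "cmod (a j) * norm (f j) \<le> 2 * K * norm ?w" .
  qed
qed

lemma schauder_basis_closure_span: "closure (cspace.span (range f)) = UNIV"
proof -
  have "h \<in> closure (cspace.span (range f))" for h
  proof (rule Lim_in_closed_set[OF closed_closure _ _ schauder_sum_tendsto[of h]])
    have "schauder_sum N h \<in> cspace.span (range f)" for N
      unfolding schauder_sum_def by (intro cspace.span_sum cspace.span_scale cspace.span_base) auto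
    then show "\<forall>\<^sub>F N in sequentially. schauder_sum N h \<in> closure (cspace.span (range f))"
      using closure_subset by (intro always_eventually) blast
  qed auto
  then show ?thesis by blast
qed

end

section \<open>Riesz bases and two-sided square sum estimates\<close>

lemma orthonormal_basis_iff_onb: "orthonormal_basis e \<longleftrightarrow> onb e"
  by (simp add: orthonormal_basis_def onb_def)

lemma onb_sums:
  fixes e :: "nat \<Rightarrow> 'a::complex_inner"
  assumes "onb e"
  shows "(\<lambda>k. cinner (e k) x *\<^sub>C e k) sums x"
  unfolding sums_def
proof (rule tendstoI)
  fix \<epsilon> :: real assume "\<epsilon> > 0"
  have "x \<in> closure (cspace.span (range e))"
    using assms by (simp add: onb_def)
  then obtain p where p: "p \<in> cspace.span (range e)" "dist p x < \<epsilon>"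
    using \<open>\<epsilon> > 0\<close> by (meson closure_approachable)
  then obtain F a where F: "finite F" "p = (\<Sum>m\<in>F. a m *\<^sub>C e m)"
    by (elim span_range_finite_sum)
  obtain N0 where N0: "F \<subseteq> {..<N0}" using F(1) finite_nat_iff_bounded by blast
  have "dist (\<Sum>k<N. cinner (e k) x *\<^sub>C e k) x < \<epsilon>" if "N \<ge> N0" for N
  proof -
    have sub: "F \<subseteq> {..<N}" using N0 that by auto
    have "p = (\<Sum>m<N. (if m \<in> F then a m else 0) *\<^sub>C e m)"
      unfolding F(2) using sub by (intro sum.mono_neutral_cong_left) auto
    then have "norm (x - (\<Sum>k<N. cinner (e k) x *\<^sub>C e k)) \<le> norm (x - p)"
      using norm_minus_proj(2)[of "{..<N}" e x "\<lambda>m. if m \<in> F then a m else 0"] onb_cinner[OF assms] by simp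
    then show ?thesis using p(2) by (simp add: dist_norm norm_minus_commute)
  qed
  then show "\<forall>\<^sub>F N in sequentially. dist (\<Sum>k<N. cinner (e k) x *\<^sub>C e k) x < \<epsilon>"
    unfolding eventually_sequentially by blast
qed

text \<open>\<open>A\<close> carries the orthonormal expansion of \<open>inv A h\<close> to an
  expansion of \<open>h\<close>. Conversely, \<open>inv A\<close> carries any expansion back, where
  inner products with \<open>e j\<close> read off its coefficients.\<close>

theorem schauder_basis_if_riesz_basis:
  fixes f :: "nat \<Rightarrow> 'a::complex_inner"
  assumes "riesz_basis f"
  shows "schauder_basis f"
proof -
  obtain A :: "'a \<Rightarrow> 'a" and e where A: "bounded_clinear A" "bij A" "bounded_clinear (inv A)" and e: "onb e" and "\<forall>k. f k = A (e k)"
    using assms unfolding riesz_basis_def orthonormal_basis_iff_onb by blast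
  then have f: "f k = A (e k)" for k
    by blast
  have lin: "bounded_linear A" "bounded_linear (inv A)" and
      sc: "\<And>c x. A (c *\<^sub>C x) = c *\<^sub>C A x" "\<And>c x. inv A (c *\<^sub>C x) = c *\<^sub>C inv A x"
    using A by (auto simp: bounded_clinear_def)
  show ?thesis
    unfolding schauder_basis_def
  proof (intro allI ex1I)
    fix h
    have "(\<lambda>k. A (cinner (e k) (inv A h) *\<^sub>C e k)) sums A (inv A h)"
      by (intro bounded_linear.sums[OF lin(1)] onb_sums e)
    then show "(\<lambda>k. cinner (e k) (inv A h) *\<^sub>C f k) sums h"
      using A(2) by (simp add: sc f bij_is_surj surj_f_inv_f)
  next
    fix h c assume c: "(\<lambda>k. c k *\<^sub>C f k) sums h"
    have "(\<lambda>k. inv A (c k *\<^sub>C f k)) sums inv A h"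
      by (intro bounded_linear.sums[OF lin(2)] c)
    then have s: "(\<lambda>k. c k *\<^sub>C e k) sums inv A h"
      using A(2) by (simp add: sc f bij_is_inj inv_f_f)
    show "c = (\<lambda>k. cinner (e k) (inv A h))"
    proof
      fix j
      have "(\<lambda>k. cinner (e j) (c k *\<^sub>C e k)) sums cinner (e j) (inv A h)"
        by (intro bounded_linear.sums[OF bounded_linear_cinner_right] s)
      also have "(\<lambda>k. cinner (e j) (c k *\<^sub>C e k)) = (\<lambda>k. if k = j then c k else 0)"
        using onb_cinner[OF e] by (auto simp: cinner_scaleC_right)
      finally have "(\<lambda>k. if k = j then c k else 0) sums cinner (e j) (inv A h)" .
      then show "c j = cinner (e j) (inv A h)"
        using sums_unique2[OF sums_single[of j c]] by metis
    qed
  qed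
qed

text \<open>Bessel makes the coefficients square summable, and the upper estimate transfers the
  Cauchy property of their square sums to the vector series.\<close>

lemma summable_expansion:
  fixes e :: "nat \<Rightarrow> 'b::complex_inner" and g :: "nat \<Rightarrow> 'a::{complex_inner, banach}"
  assumes e: "\<And>j k. cinner (e j) (e k) = (if j = k then 1 else 0)"
    and C: "C \<ge> 0"
    and upper: "\<And>F a. finite F \<Longrightarrow> (norm (\<Sum>k\<in>F. a k *\<^sub>C g k))\<^sup>2 \<le> C * (\<Sum>k\<in>F. (cmod (a k))\<^sup>2)"
  shows "summable (\<lambda>k. cinner (e k) x *\<^sub>C g k)"
  unfolding summable_Cauchy
proof (intro allI impI)
  fix \<epsilon> :: real assume \<epsilon>: "\<epsilon> > 0"
  have "summable (\<lambda>k. (cmod (cinner (e k) x))\<^sup>2)"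
  proof (rule summableI_nonneg_bounded)
    fix n show "(\<Sum>k<n. (cmod (cinner (e k) x))\<^sup>2) \<le> (norm x)\<^sup>2"
      using e by (intro bessel) auto
  qed auto
  \<comment> \<open>\<open>C + 1\<close> keeps the quotient meaningful when
    \<open>C = 0\<close>.\<close>
  moreover have "\<epsilon>\<^sup>2 / (C + 1) > 0" using \<epsilon> C by simp
  ultimately obtain N where N: "\<And>m n. m \<ge> N \<Longrightarrow> norm (\<Sum>k\<in>{m..<n}. (cmod (cinner (e k) x))\<^sup>2) < \<epsilon>\<^sup>2 / (C + 1)"
    unfolding summable_Cauchy by blast
  have "norm (\<Sum>k\<in>{m..<n}. cinner (e k) x *\<^sub>C g k) < \<epsilon>" if "m \<ge> N" for m n
  proof -
    have "(norm (\<Sum>k\<in>{m..<n}. cinner (e k) x *\<^sub>C g k))\<^sup>2 \<le> C * (\<Sum>k\<in>{m..<n}. (cmod (cinner (e k) x))\<^sup>2)"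
      by (rule upper) simp
    also have "\<dots> \<le> (C + 1) * (\<Sum>k\<in>{m..<n}. (cmod (cinner (e k) x))\<^sup>2)"
      by (intro mult_right_mono sum_nonneg) auto
    also have "\<dots> < (C + 1) * (\<epsilon>\<^sup>2 / (C + 1))"
      using N[OF that, of n] C by (intro mult_strict_left_mono) (auto simp: abs_of_nonneg sum_nonneg)
    also have "\<dots> = \<epsilon>\<^sup>2" using C by simp
    finally show ?thesis using \<epsilon> by (simp add: power_less_imp_less_base)
  qed
  then show "\<exists>N. \<forall>m\<ge>N. \<forall>n. norm (\<Sum>k\<in>{m..<n}. cinner (e k) x *\<^sub>C g k) < \<epsilon>" by blast
qed

text \<open>Completeness gives the Fourier series of \<open>x\<close> a sum; its difference from
  \<open>x\<close> is orthogonal to every \<open>e k\<close>, hence 0.\<close>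

lemma onb_if_total:
  fixes e :: "nat \<Rightarrow> 'a::{complex_inner, banach}"
  assumes on: "\<And>j k. cinner (e j) (e k) = (if j = k then 1 else 0)"
    and total: "\<And>h. (\<And>k. cinner (e k) h = 0) \<Longrightarrow> h = 0"
  shows "onb e"
proof -
  have "x \<in> closure (cspace.span (range e))" for x
  proof -
    have "summable (\<lambda>k. cinner (e k) x *\<^sub>C e k)"
      by (rule summable_expansion[OF on, of 1]) (simp_all add: norm_sum_orthonormal on)
    then obtain y where y: "(\<lambda>k. cinner (e k) x *\<^sub>C e k) sums y" using summable_def by blast
    have "x - y = 0"
    proof (rule total)
      fix j
      have "(\<lambda>k. cinner (e j) (cinner (e k) x *\<^sub>C e k)) sums cinner (e j) y"
        by (rule bounded_linear.sums[OF bounded_linear_cinner_right y])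
      also have "(\<lambda>k. cinner (e j) (cinner (e k) x *\<^sub>C e k)) = (\<lambda>k. if k = j then cinner (e k) x else 0)"
        using on by (auto simp: cinner_scaleC_right)
      finally have "cinner (e j) y = cinner (e j) x"
        using sums_unique2[OF sums_single[of j "\<lambda>k. cinner (e k) x"]] by metis
      then show "cinner (e j) (x - y) = 0" by (simp add: cinner_diff_right)
    qed
    then have "(\<lambda>n. \<Sum>k<n. cinner (e k) x *\<^sub>C e k) \<longlonglongrightarrow> x" using y by (simp add: sums_def)
    moreover have "(\<Sum>k<n. cinner (e k) x *\<^sub>C e k) \<in> cspace.span (range e)" for n
      by (intro cspace.span_sum cspace.span_scale cspace.span_base) auto
    ultimately show ?thesis
      unfolding closure_sequential by (intro exI[of _ "\<lambda>n. \<Sum>k<n. cinner (e k) x *\<^sub>C e k"] conjI allI)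
  qed
  then show ?thesis using on unfolding onb_def by blast
qed

text \<open>The operator sending \<open>e k\<close> to \<open>g k\<close> is bounded by the upper
  estimate and bounded below by the lower one. So it is injective with closed range, and the range
  contains the dense span of \<open>g\<close>.\<close>

theorem riesz_basis_if_bounds:
  fixes g :: "nat \<Rightarrow> 'a::{complex_inner, banach}"
  assumes e: "onb (e :: nat \<Rightarrow> 'a)" and dense: "closure (cspace.span (range g)) = UNIV"
    and C: "C \<ge> 0"
    and upper: "\<And>F a. finite F \<Longrightarrow> (norm (\<Sum>k\<in>F. a k *\<^sub>C g k))\<^sup>2 \<le> C * (\<Sum>k\<in>F. (cmod (a k))\<^sup>2)"
    and lower: "\<And>F a. finite F \<Longrightarrow> (\<Sum>k\<in>F. (cmod (a k))\<^sup>2) \<le> C * (norm (\<Sum>k\<in>F. a k *\<^sub>C g k))\<^sup>2"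
  shows "riesz_basis g"
proof -
  have summable: "summable (\<lambda>k. cinner (e k) x *\<^sub>C g k)" for x
    by (rule summable_expansion[OF onb_cinner[OF e] C upper])
  define A where "A x = (\<Sum>k. cinner (e k) x *\<^sub>C g k)" for x
  have A: "(\<lambda>k. cinner (e k) x *\<^sub>C g k) sums A x" for x
    unfolding A_def using summable by (rule summable_sums)
  have A_lim: "(\<lambda>n. \<Sum>k<n. cinner (e k) x *\<^sub>C g k) \<longlonglongrightarrow> A x" for x
    using A unfolding sums_def .
  have A_add: "A (x + y) = A x + A y" for x y
    using sums_add[OF A A, of x y] by (intro sums_unique2[OF A]) (simp add: cinner_add_right cspace.scale_left_distrib)
  have A_scale: "A (c *\<^sub>C x) = c *\<^sub>C A x" for c x
    using bounded_linear.sums[OF bounded_linear_scaleC A, of c x] by (intro sums_unique2[OF A]) (simp add: cinner_scaleC_right)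
  have A_le: "(norm (A x))\<^sup>2 \<le> C * (norm x)\<^sup>2" for x
  proof (rule LIMSEQ_le_const2[OF tendsto_power[OF tendsto_norm[OF A_lim]]])
    have "(norm (\<Sum>k<n. cinner (e k) x *\<^sub>C g k))\<^sup>2 \<le> C * (norm x)\<^sup>2" for n
    proof -
      have "(norm (\<Sum>k<n. cinner (e k) x *\<^sub>C g k))\<^sup>2 \<le> C * (\<Sum>k<n. (cmod (cinner (e k) x))\<^sup>2)"
        by (rule upper) simp
      also have "\<dots> \<le> C * (norm x)\<^sup>2"
        using C onb_cinner[OF e] by (intro mult_left_mono bessel) auto
      finally show ?thesis .
    qed
    then show "\<exists>N. \<forall>n\<ge>N. (norm (\<Sum>k<n. cinner (e k) x *\<^sub>C g k))\<^sup>2 \<le> C * (norm x)\<^sup>2" by blast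
  qed
  have A_ge: "(norm x)\<^sup>2 \<le> C * (norm (A x))\<^sup>2" for x
  proof (rule norm_le_coefficients[OF e])
    fix F :: "nat set" assume "finite F"
    then obtain N where N: "F \<subseteq> {..<N}" using finite_nat_iff_bounded by blast
    have le: "(\<Sum>k\<in>F. (cmod (cinner (e k) x))\<^sup>2) \<le> C * (norm (\<Sum>k<n. cinner (e k) x *\<^sub>C g k))\<^sup>2" if "n \<ge> N" for n
    proof -
      have "(\<Sum>k\<in>F. (cmod (cinner (e k) x))\<^sup>2) \<le> (\<Sum>k<n. (cmod (cinner (e k) x))\<^sup>2)"
        using N that by (intro sum_mono2) auto
      also have "\<dots> \<le> C * (norm (\<Sum>k<n. cinner (e k) x *\<^sub>C g k))\<^sup>2"
        by (rule lower) simp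
      finally show ?thesis .
    qed
    have "(\<lambda>n. C * (norm (\<Sum>k<n. cinner (e k) x *\<^sub>C g k))\<^sup>2) \<longlonglongrightarrow> C * (norm (A x))\<^sup>2"
      by (intro tendsto_intros A_lim)
    then show "(\<Sum>k\<in>F. (cmod (cinner (e k) x))\<^sup>2) \<le> C * (norm (A x))\<^sup>2"
      by (rule LIMSEQ_le_const) (intro exI[of _ N] allI impI le)
  qed
  have A_le': "norm (A x) \<le> sqrt C * norm x" and A_ge': "norm x \<le> sqrt C * norm (A x)" for x
    using real_sqrt_le_mono[OF A_le[of x]] real_sqrt_le_mono[OF A_ge[of x]] by (simp_all add: real_sqrt_mult)
  have A_diff: "A (x - y) = A x - A y" for x y
    using A_add[of x "-y"] A_scale[of "-1" y] by (simp add: scaleC_minus1)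
  have A_e: "A (e j) = g j" for j
  proof -
    have "(\<lambda>k. cinner (e k) (e j) *\<^sub>C g k) = (\<lambda>k. if k = j then g k else 0)"
      using onb_cinner[OF e] by auto
    then show ?thesis using A[of "e j"] sums_unique2[OF sums_single[of j g]] by metis
  qed
  have inj: "inj A"
  proof (rule injI)
    fix x y assume "A x = A y"
    then show "x = y" using A_ge'[of "x - y"] by (simp add: A_diff)
  qed
  have A_0: "A 0 = 0" using A_diff[of 0 0] by simp
  have span: "cspace.span (range g) \<subseteq> range A"
  proof
    fix p assume "p \<in> cspace.span (range g)"
    then show "p \<in> range A"
    proof (induction rule: cspace.span_induct_alt)
      case base then show ?case using A_0 by (metis rangeI)
    next
      case (step c x y)
      then obtain j z where "x = A (e j)" "y = A z" using A_e by auto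
      then have "c *\<^sub>C x + y = A (c *\<^sub>C e j + z)" by (simp add: A_add A_scale)
      then show ?case by blast
    qed
  qed
  \<comment> \<open>Closedness of the range: by \<open>A_ge'\<close> the preimages of a convergent
    sequence form a Cauchy sequence.\<close>
  have "y \<in> range A" for y
  proof -
    have "y \<in> closure (range A)" using dense closure_mono[OF span] by auto
    then obtain s where s: "\<And>n. s n \<in> range A" "s \<longlonglongrightarrow> y" unfolding closure_sequential by blast
    define x where "x n = inv A (s n)" for n
    have x: "s n = A (x n)" for n
      unfolding x_def by (rule f_inv_into_f[OF s(1), symmetric])
    have "Cauchy x"
      unfolding Cauchy_def
    proof (intro allI impI)
      fix \<epsilon> :: real assume \<epsilon>: "\<epsilon> > 0"
      have "Cauchy s" using s(2) by (rule LIMSEQ_imp_Cauchy)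
      moreover have "\<epsilon> / (sqrt C + 1) > 0" using \<epsilon> C by (simp add: add_nonneg_pos)
      ultimately obtain M where M: "\<And>m n. m \<ge> M \<Longrightarrow> n \<ge> M \<Longrightarrow> dist (s m) (s n) < \<epsilon> / (sqrt C + 1)"
        unfolding Cauchy_def by blast
      have "dist (x m) (x n) < \<epsilon>" if "m \<ge> M" "n \<ge> M" for m n
      proof -
        have "norm (x m - x n) \<le> sqrt C * norm (A (x m - x n))" by (rule A_ge')
        also have "\<dots> \<le> (sqrt C + 1) * norm (A (x m - x n))" by (intro mult_right_mono) auto
        also have "\<dots> < (sqrt C + 1) * (\<epsilon> / (sqrt C + 1))"
          using M[OF that] C by (intro mult_strict_left_mono) (auto simp: dist_norm x A_diff add_nonneg_pos)
        also have "\<dots> = \<epsilon>" using C by (simp add: add_nonneg_eq_0_iff)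
        finally show ?thesis by (simp add: dist_norm)
      qed
      then show "\<exists>M. \<forall>m\<ge>M. \<forall>n\<ge>M. dist (x m) (x n) < \<epsilon>" by blast
    qed
    then obtain z where z: "x \<longlonglongrightarrow> z" using Cauchy_convergent convergent_def by blast
    have "(\<lambda>n. sqrt C * norm (x n - z)) \<longlonglongrightarrow> sqrt C * norm (z - z)"
      by (intro tendsto_intros z)
    then have lim: "(\<lambda>n. sqrt C * norm (x n - z)) \<longlonglongrightarrow> 0" by simp
    have "(\<lambda>n. s n - A z) \<longlonglongrightarrow> 0"
    proof (rule Lim_null_comparison[OF _ lim])
      have "norm (s n - A z) \<le> sqrt C * norm (x n - z)" for n
        using A_le'[of "x n - z"] unfolding x A_diff .
      then show "\<forall>\<^sub>F n in sequentially. norm (s n - A z) \<le> sqrt C * norm (x n - z)" by simp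
    qed
    then have "s \<longlonglongrightarrow> A z" by (rule LIM_zero_cancel)
    then have "y = A z" using s(2) LIMSEQ_unique by blast
    then show ?thesis by blast
  qed
  then have surj: "surj A" by blast
  have bij: "bij A" using inj surj by (simp add: bij_def)
  have AiA: "A (inv A y) = y" for y using surj by (rule surj_f_inv_f)
  have "bounded_clinear A"
    unfolding bounded_clinear_def
  proof (intro conjI allI bounded_linear_intro[where K="sqrt C"])
    show "A (r *\<^sub>R x) = r *\<^sub>R A x" for r x by (simp add: scaleR_scaleC A_scale)
    show "norm (A x) \<le> norm x * sqrt C" for x using A_le'[of x] by (simp add: mult.commute)
  qed (simp_all add: A_add A_scale)
  moreover have "bounded_clinear (inv A)"
    unfolding bounded_clinear_def
  proof (intro conjI allI bounded_linear_intro[where K="sqrt C"])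
    show sc: "inv A (c *\<^sub>C x) = c *\<^sub>C inv A x" for c x
      by (rule injD[OF inj]) (simp add: A_scale AiA)
    show "inv A (r *\<^sub>R x) = r *\<^sub>R inv A x" for r x by (simp add: scaleR_scaleC sc)
    show "inv A (x + y) = inv A x + inv A y" for x y
      by (rule injD[OF inj]) (simp add: A_add AiA)
    show "norm (inv A x) \<le> norm x * sqrt C" for x
      using A_ge'[of "inv A x"] by (simp add: AiA mult.commute)
  qed
  ultimately show ?thesis
    unfolding riesz_basis_def orthonormal_basis_iff_onb using bij e A_e by metis
qed

section \<open>Bounded coefficientwise perturbations of a diagonal operator\<close>

text \<open>A bound for the sum of \<open>1 / max 1 ((y - t)^2)\<close> over naturals
  \<open>y\<close>, uniform in \<open>t\<close>. Of the factor 8, 2 counts the two sides of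
  \<open>t\<close>, and 4 pays for replacing the distance to \<open>t\<close> by the distance to an
  integer.\<close>

definition gap_const :: real where
  "gap_const = 8 * (\<Sum>j. 1 / (max 1 (real j))\<^sup>2)"

lemma summable_gap: "summable (\<lambda>j. 1 / (max 1 (real j))\<^sup>2)"
proof -
  have "\<forall>\<^sub>F j in sequentially. inverse (real j ^ 2) = 1 / (max 1 (real j))\<^sup>2"
    using eventually_ge_at_top[of 1] by eventually_elim (auto simp: max_def divide_simps)
  then show ?thesis
    using inverse_power_summable[of 2, where 'a=real] summable_cong by fastforce
qed

lemma gap_const_ge: "8 \<le> gap_const"
proof -
  have "(\<Sum>j\<in>{0::nat}. 1 / (max 1 (real j))\<^sup>2) \<le> (\<Sum>j. 1 / (max 1 (real j))\<^sup>2)"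
    by (intro sum_le_suminf summable_gap) auto
  then show ?thesis by (simp add: gap_const_def)
qed

text \<open>On each side of \<open>k = floor t\<close> the numbers \<open>y\<close> are indexed
  injectively by \<open>j = |y - k|\<close>, and the comparison series runs over
  \<open>j\<close>.\<close>

lemma sum_gap_le:
  fixes t :: real
  assumes "t \<ge> 0" "finite F"
  shows "(\<Sum>y\<in>F. 1 / max 1 ((real y - t)\<^sup>2)) \<le> gap_const"
proof -
  let ?g = "\<lambda>j::nat. 1 / (max 1 (real j))\<^sup>2"
  define k where "k = nat \<lfloor>t\<rfloor>"
  have k: "real k \<le> t" "t < real k + 1"
    using assms by (auto simp: k_def)
  \<comment> \<open>For \<open>y\<close> above \<open>t\<close> the distance to \<open>t\<close> may
    fall short of \<open>j\<close> by almost 1. It is still at least \<open>j / 2\<close> once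
    \<open>j \<ge> 2\<close>, and small \<open>j\<close> are covered by the lower bound 1.\<close>
  have dom: "1 / max 1 ((real y - t)\<^sup>2) \<le> 4 * ?g j"
    if "real j / 2 \<le> \<bar>real y - t\<bar> \<or> j \<le> 2" for y j
  proof -
    have "(max 1 (real j))\<^sup>2 / 4 \<le> max 1 ((real y - t)\<^sup>2)"
    proof (cases "j \<le> 2")
      case True
      then have "(max 1 (real j))\<^sup>2 \<le> 2\<^sup>2" by (intro power_mono) auto
      then show ?thesis by simp
    next
      case False
      then have "(real j / 2)\<^sup>2 \<le> \<bar>real y - t\<bar>\<^sup>2" using that by (intro power_mono) auto
      then show ?thesis using False by (simp add: power_divide max_def)
    qed
    then have "1 / max 1 ((real y - t)\<^sup>2) \<le> 1 / ((max 1 (real j))\<^sup>2 / 4)"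
      by (intro divide_left_mono) auto
    then show ?thesis by simp
  qed
  have part: "(\<Sum>y\<in>G. 1 / max 1 ((real y - t)\<^sup>2)) \<le> 4 * (\<Sum>j. ?g j)"
    if "finite G" "inj_on \<phi> G" "\<And>y. y \<in> G \<Longrightarrow> real (\<phi> y) / 2 \<le> \<bar>real y - t\<bar> \<or> \<phi> y \<le> 2" for G and \<phi> :: "nat \<Rightarrow> nat"
  proof -
    have "(\<Sum>y\<in>G. 1 / max 1 ((real y - t)\<^sup>2)) \<le> (\<Sum>y\<in>G. 4 * ?g (\<phi> y))"
      using that by (intro sum_mono dom) auto
    also have "\<dots> = 4 * (\<Sum>j\<in>\<phi> ` G. ?g j)"
      using that by (simp add: sum.reindex sum_distrib_left)
    also have "\<dots> \<le> 4 * (\<Sum>j. ?g j)"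
      using that by (intro mult_left_mono sum_le_suminf summable_gap) auto
    finally show ?thesis .
  qed
  have "(\<Sum>y\<in>F. 1 / max 1 ((real y - t)\<^sup>2))
      = (\<Sum>y\<in>{y\<in>F. k \<le> y}. 1 / max 1 ((real y - t)\<^sup>2)) + (\<Sum>y\<in>{y\<in>F. \<not> k \<le> y}. 1 / max 1 ((real y - t)\<^sup>2))"
    using assms by (subst sum.union_disjoint[symmetric]) (auto intro!: sum.cong)
  also have "\<dots> \<le> 4 * (\<Sum>j. ?g j) + 4 * (\<Sum>j. ?g j)"
  proof (intro add_mono)
    show "(\<Sum>y\<in>{y\<in>F. k \<le> y}. 1 / max 1 ((real y - t)\<^sup>2)) \<le> 4 * (\<Sum>j. ?g j)"
      using assms k by (intro part[where \<phi>="\<lambda>y. y - k"]) (auto simp: inj_on_def of_nat_diff)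
    show "(\<Sum>y\<in>{y\<in>F. \<not> k \<le> y}. 1 / max 1 ((real y - t)\<^sup>2)) \<le> 4 * (\<Sum>j. ?g j)"
      using assms k by (intro part[where \<phi>="\<lambda>y. k - y"]) (auto simp: inj_on_def of_nat_diff)
  qed
  finally show ?thesis by (simp add: gap_const_def)
qed

text \<open>Of the two factors in the squared distance, one is bounded below by \<open>K\<close> and
  the other by \<open>max 1 ((y - t)^2)\<close>. The first yields the decay in \<open>K\<close>, the
  second the convergence.\<close>

lemma sum_resolvent_le:
  assumes "K \<ge> 1" "finite F" "\<And>y. y \<in> F \<Longrightarrow> K \<le> cmod ((of_nat y)\<^sup>2 - \<mu>)"
  shows "(\<Sum>y\<in>F. 1 / (cmod ((of_nat y)\<^sup>2 - \<mu>))\<^sup>2) \<le> gap_const / K"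
proof -
  \<comment> \<open>For \<open>Re \<mu> \<ge> 0\<close> the factorization of
    \<open>y^2 - t^2\<close> gives \<open>(y - t)^2 \<le> |y^2 - Re \<mu>|\<close>, as
    \<open>|y - t| \<le> y + t\<close>; for \<open>Re \<mu> < 0\<close> the choice
    \<open>t = 0\<close> works.\<close>
  define t where "t = sqrt (max (Re \<mu>) 0)"
  have t: "t \<ge> 0" by (simp add: t_def)
  have q: "(real y - t)\<^sup>2 \<le> cmod ((of_nat y)\<^sup>2 - \<mu>)" for y
  proof -
    have "\<bar>Re ((of_nat y)\<^sup>2 - \<mu>)\<bar> \<le> cmod ((of_nat y)\<^sup>2 - \<mu>)"
      by (rule abs_Re_le_cmod)
    then have 1: "\<bar>(real y)\<^sup>2 - Re \<mu>\<bar> \<le> cmod ((of_nat y)\<^sup>2 - \<mu>)"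
      by (simp add: Re_power2)
    show ?thesis
    proof (cases "Re \<mu> \<ge> 0")
      case True
      then have "(real y)\<^sup>2 - Re \<mu> = (real y - t) * (real y + t)"
        by (simp add: t_def max_def algebra_simps power2_eq_square)
      then have "\<bar>(real y)\<^sup>2 - Re \<mu>\<bar> = \<bar>real y - t\<bar> * \<bar>real y + t\<bar>"
        by (simp add: abs_mult)
      moreover have "\<bar>real y - t\<bar> * \<bar>real y - t\<bar> \<le> \<bar>real y - t\<bar> * \<bar>real y + t\<bar>"
        using t by (intro mult_left_mono) auto
      ultimately show ?thesis using 1 by (simp add: power2_eq_square)
    next
      case False
      then show ?thesis using 1 by (simp add: t_def max_def)
    qed
  qed
  have "(\<Sum>y\<in>F. 1 / (cmod ((of_nat y)\<^sup>2 - \<mu>))\<^sup>2) \<le> (\<Sum>y\<in>F. 1 / K * (1 / max 1 ((real y - t)\<^sup>2)))"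
  proof (intro sum_mono)
    fix y assume "y \<in> F"
    have "K * max 1 ((real y - t)\<^sup>2) \<le> cmod ((of_nat y)\<^sup>2 - \<mu>) * cmod ((of_nat y)\<^sup>2 - \<mu>)"
      using assms(1) assms(3)[OF \<open>y \<in> F\<close>] q[of y] by (intro mult_mono) auto
    then have "1 / (cmod ((of_nat y)\<^sup>2 - \<mu>) * cmod ((of_nat y)\<^sup>2 - \<mu>)) \<le> 1 / (K * max 1 ((real y - t)\<^sup>2))"
      using assms(1) assms(3)[OF \<open>y \<in> F\<close>] by (intro divide_left_mono mult_pos_pos) linarith+
    then show "1 / (cmod ((of_nat y)\<^sup>2 - \<mu>))\<^sup>2 \<le> 1 / K * (1 / max 1 ((real y - t)\<^sup>2))"
      by (simp add: power2_eq_square)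
  qed
  also have "\<dots> = 1 / K * (\<Sum>y\<in>F. 1 / max 1 ((real y - t)\<^sup>2))"
    by (simp add: sum_distrib_left)
  also have "\<dots> \<le> 1 / K * gap_const"
    using assms t by (intro mult_left_mono sum_gap_le) auto
  finally show ?thesis by simp
qed

text \<open>The gap \<open>|y^2 - n^2| \<ge> |y - n| n\<close> loses at most
  \<open>K \<le> n / 2\<close> when \<open>n^2\<close> is replaced by \<open>\<mu>\<close>. Thus at
  least \<open>|y - n| n / 2\<close> survives, and squaring gives the factor
  \<open>4 / n^2\<close>.\<close>

lemma sum_off_cluster_le:
  assumes "K \<ge> 0" "n \<ge> 1" "real n \<ge> 2 * K" "cmod ((of_nat n)\<^sup>2 - \<mu>) \<le> K" "finite F" "n \<notin> F"
  shows "(\<Sum>y\<in>F. 1 / (cmod ((of_nat y)\<^sup>2 - \<mu>))\<^sup>2) \<le> 4 * gap_const / (real n)\<^sup>2"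
    and "y \<noteq> n \<Longrightarrow> cmod ((of_nat y)\<^sup>2 - \<mu>) > 0"
proof -
  have low: "\<bar>real y - real n\<bar> * real n / 2 \<le> cmod ((of_nat y)\<^sup>2 - \<mu>)" "1 \<le> \<bar>real y - real n\<bar>" if "y \<noteq> n" for y
  proof -
    show 1: "1 \<le> \<bar>real y - real n\<bar>" using that by linarith
    have "\<bar>(real y)\<^sup>2 - (real n)\<^sup>2\<bar> = \<bar>real y - real n\<bar> * (real y + real n)"
      by (simp add: power2_eq_square square_diff_square_factored abs_mult mult.commute)
    moreover have "\<bar>real y - real n\<bar> * real n \<le> \<bar>real y - real n\<bar> * (real y + real n)"
      by (intro mult_left_mono) auto
    moreover have "\<bar>(real y)\<^sup>2 - (real n)\<^sup>2\<bar> = cmod ((of_nat y)\<^sup>2 - (of_nat n)\<^sup>2)"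
      unfolding norm_of_real[symmetric, where 'a=complex] by simp
    moreover have "cmod ((of_nat y)\<^sup>2 - (of_nat n)\<^sup>2) \<le> cmod ((of_nat y)\<^sup>2 - \<mu>) + cmod ((of_nat n)\<^sup>2 - \<mu>)"
      using norm_triangle_ineq4[of "(of_nat y)\<^sup>2 - \<mu>" "(of_nat n)\<^sup>2 - \<mu>"] by simp
    moreover have "1 * real n \<le> \<bar>real y - real n\<bar> * real n"
      using 1 by (intro mult_right_mono) auto
    ultimately show "\<bar>real y - real n\<bar> * real n / 2 \<le> cmod ((of_nat y)\<^sup>2 - \<mu>)"
      using assms(3,4) by linarith
  qed
  show "y \<noteq> n \<Longrightarrow> cmod ((of_nat y)\<^sup>2 - \<mu>) > 0"
  proof -
    assume "y \<noteq> n"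
    have "0 < \<bar>real y - real n\<bar> * real n / 2" using low(2)[OF \<open>y \<noteq> n\<close>] assms(2) by simp
    then show ?thesis using low(1)[OF \<open>y \<noteq> n\<close>] by linarith
  qed
  have "(\<Sum>y\<in>F. 1 / (cmod ((of_nat y)\<^sup>2 - \<mu>))\<^sup>2) \<le> (\<Sum>y\<in>F. 4 / (real n)\<^sup>2 * (1 / max 1 ((real y - real n)\<^sup>2)))"
  proof (intro sum_mono)
    fix y assume "y \<in> F"
    then have "y \<noteq> n" using assms by auto
    have pos: "0 < \<bar>real y - real n\<bar> * real n / 2" using low(2)[OF \<open>y \<noteq> n\<close>] assms(2) by simp
    have "1\<^sup>2 \<le> \<bar>real y - real n\<bar>\<^sup>2" using low(2)[OF \<open>y \<noteq> n\<close>] by (intro power_mono) auto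
    then have m: "max 1 ((real y - real n)\<^sup>2) = (real y - real n)\<^sup>2" by simp
    have "(\<bar>real y - real n\<bar> * real n / 2)\<^sup>2 \<le> (cmod ((of_nat y)\<^sup>2 - \<mu>))\<^sup>2"
      using low(1)[OF \<open>y \<noteq> n\<close>] pos by (intro power_mono) auto
    then have "1 / (cmod ((of_nat y)\<^sup>2 - \<mu>))\<^sup>2 \<le> 1 / (\<bar>real y - real n\<bar> * real n / 2)\<^sup>2"
      using pos low(1)[OF \<open>y \<noteq> n\<close>] by (intro divide_left_mono mult_pos_pos zero_less_power) auto
    also have "\<dots> = 4 / (real n)\<^sup>2 * (1 / max 1 ((real y - real n)\<^sup>2))"
      unfolding m by (simp add: power_mult_distrib power_divide)
    finally show "1 / (cmod ((of_nat y)\<^sup>2 - \<mu>))\<^sup>2 \<le> 4 / (real n)\<^sup>2 * (1 / max 1 ((real y - real n)\<^sup>2))" .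
  qed
  also have "\<dots> = 4 / (real n)\<^sup>2 * (\<Sum>y\<in>F. 1 / max 1 ((real y - real n)\<^sup>2))"
    by (simp add: sum_distrib_left)
  also have "\<dots> \<le> 4 / (real n)\<^sup>2 * gap_const"
    using assms by (intro mult_left_mono sum_gap_le) auto
  finally show "(\<Sum>y\<in>F. 1 / (cmod ((of_nat y)\<^sup>2 - \<mu>))\<^sup>2) \<le> 4 * gap_const / (real n)\<^sup>2" by simp
qed

lemma square_add_le: "(a + b)\<^sup>2 \<le> 2 * a\<^sup>2 + 2 * (b::real)\<^sup>2"
  using zero_le_power2[of "a - b"] by (simp add: power2_diff power2_sum)

lemma norm_onb: "onb e \<Longrightarrow> norm (e m) = 1"
  using cinner_self[of "e m"] onb_cinner[of e m m] norm_ge_zero[of "e m"]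
  by (simp add: power2_eq_1_iff del: norm_ge_zero flip: of_real_power)

section \<open>Resolvent estimates from the coefficient equations\<close>

text \<open>\<open>B\<close> bounds the functionals \<open>b m\<close> one at a time; the operator
  with these coefficients may be unbounded. Fibres have up to two elements because
  \<open>2 m + \<theta>\<close> and its negative have the same square.\<close>

locale perturbed_diagonal =
  fixes e :: "'i \<Rightarrow> 'a::complex_inner" and \<omega> :: "'i \<Rightarrow> nat" and b :: "'i \<Rightarrow> 'a" and B :: real
  assumes onb: "onb e"
    and fin_fibre: "finite {m. \<omega> m = y}" and card_fibre: "card {m. \<omega> m = y} \<le> 2"
    and b_le: "norm (b m) \<le> B"
begin

text \<open>Unlike the graph of the Schroedinger operator, whose second derivative is only determined up to
  null sets, this coefficientwise form is linear by inspection.\<close>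

definition op :: "('a \<times> 'a) set" where
  "op = {(h, w). \<forall>m. cinner (e m) w = (of_nat (\<omega> m))\<^sup>2 * cinner (e m) h + cinner (b m) h}"

text \<open>Chosen so that \<open>4 * B^2 * gap_const / L \<le> 1 / 2\<close>, which lets
  \<open>resolvent_bound\<close> absorb the perturbation. The summand 1 ensures
  \<open>L \<ge> 1\<close>, as \<open>sum_resolvent_le\<close> requires.\<close>

definition L :: real where "L = 1 + 8 * B\<^sup>2 * gap_const"

lemma B_nonneg: "B \<ge> 0"
  using b_le norm_ge_zero order_trans by blast

lemma L_ge_1: "L \<ge> 1"
  using gap_const_ge by (simp add: L_def)

lemma op_add: "(h, w) \<in> op \<Longrightarrow> (h', w') \<in> op \<Longrightarrow> (h + h', w + w') \<in> op"
  by (auto simp: op_def cinner_add_right algebra_simps)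

lemma op_scale: "(h, w) \<in> op \<Longrightarrow> (c *\<^sub>C h, c *\<^sub>C w) \<in> op"
  by (auto simp: op_def cinner_scaleC_right algebra_simps)

lemma op_zero: "(0, 0) \<in> op"
  by (auto simp: op_def)

lemma op_diff: "(h, w) \<in> op \<Longrightarrow> (h', w') \<in> op \<Longrightarrow> (h - h', w - w') \<in> op"
  by (auto simp: op_def cinner_diff_right algebra_simps)

lemma op_sum: "(\<And>i. i \<in> I \<Longrightarrow> (h i, w i) \<in> op) \<Longrightarrow> (\<Sum>i\<in>I. c i *\<^sub>C h i, \<Sum>i\<in>I. c i *\<^sub>C w i) \<in> op"
  by (induction I rule: infinite_finite_induct) (auto intro: op_add op_scale op_zero)

lemma op_coeff:
  assumes "(h, w) \<in> op"
  shows "cmod ((of_nat (\<omega> m))\<^sup>2 * cinner (e m) h - cinner (e m) w) \<le> B * norm h"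
proof -
  have "cmod (cinner (b m) h) \<le> norm (b m) * norm h"
    by (rule cinner_norm_bound)
  also have "\<dots> \<le> B * norm h"
    by (intro mult_right_mono b_le) auto
  finally show ?thesis
    using assms by (simp add: op_def norm_minus_commute)
qed

lemma sum_fibre_le:
  assumes "finite F" "\<And>y. \<phi> y \<ge> (0::real)"
  shows "(\<Sum>m\<in>F. \<phi> (\<omega> m)) \<le> 2 * (\<Sum>y\<in>\<omega> ` F. \<phi> y)"
proof -
  have "(\<Sum>m\<in>F. \<phi> (\<omega> m)) = (\<Sum>y\<in>\<omega> ` F. \<Sum>m\<in>{m\<in>F. \<omega> m = y}. \<phi> (\<omega> m))"
    by (rule sum.image_gen[OF assms(1)])
  also have "\<dots> \<le> (\<Sum>y\<in>\<omega> ` F. 2 * \<phi> y)"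
  proof (intro sum_mono)
    fix y
    have "card {m\<in>F. \<omega> m = y} \<le> 2"
      using card_fibre[of y] card_mono[OF fin_fibre[of y], of "{m\<in>F. \<omega> m = y}"] by fastforce
    then have "real (card {m\<in>F. \<omega> m = y}) * \<phi> y \<le> 2 * \<phi> y"
      using assms(2) by (intro mult_right_mono) auto
    then show "(\<Sum>m\<in>{m\<in>F. \<omega> m = y}. \<phi> (\<omega> m)) \<le> 2 * \<phi> y"
      by simp
  qed
  finally show ?thesis by (simp add: sum_distrib_left)
qed

lemma sum_resolvent_fibre_le:
  assumes "finite F" "\<And>y. L \<le> cmod ((of_nat y)\<^sup>2 - z)"
  shows "(\<Sum>m\<in>F. 1 / (cmod ((of_nat (\<omega> m))\<^sup>2 - z))\<^sup>2) \<le> 2 * gap_const / L"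
  using sum_fibre_le[of F "\<lambda>y. 1 / (cmod ((of_nat y)\<^sup>2 - z))\<^sup>2"]
    sum_resolvent_le[of L "\<omega> ` F" z] assms L_ge_1 by simp

text \<open>The hypothesis says that \<open>h\<close> solves \<open>(op - z) h = u\<close>. Each
  coefficient of \<open>h\<close> is that of \<open>u\<close> plus an error of size
  \<open>B * norm h\<close>, divided by the distance to \<open>z\<close>. Summing squares, the error
  contributes at most half of the squared norm of \<open>h\<close>. The second bound, whose
  distances are square summable, plays the role of a Hilbert-Schmidt estimate.\<close>

lemma resolvent_bound:
  assumes h: "(h, u + z *\<^sub>C h) \<in> op" and z: "\<And>y. L \<le> cmod ((of_nat y)\<^sup>2 - z)"
  shows "norm h \<le> 2 * norm u"
    and "cmod (cinner (e m) h) \<le> (1 + 2 * B) * norm u / cmod ((of_nat (\<omega> m))\<^sup>2 - z)"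
proof -
  let ?d = "\<lambda>m. cmod ((of_nat (\<omega> m))\<^sup>2 - z)"
  have d: "?d m \<ge> L" "?d m > 0" for m
    using z[of "\<omega> m"] L_ge_1 by auto
  have c: "cmod (cinner (e m) h) \<le> (cmod (cinner (e m) u) + B * norm h) / ?d m" for m
  proof -
    have "cinner (e m) h * ((of_nat (\<omega> m))\<^sup>2 - z)
        = ((of_nat (\<omega> m))\<^sup>2 * cinner (e m) h - cinner (e m) (u + z *\<^sub>C h)) + cinner (e m) u"
      by (simp add: cinner_add_right cinner_scaleC_right algebra_simps)
    then have "cmod (cinner (e m) h) * ?d m \<le> B * norm h + cmod (cinner (e m) u)"
      unfolding norm_mult[symmetric]
      using op_coeff[OF h, of m]
        norm_triangle_ineq[of "(of_nat (\<omega> m))\<^sup>2 * cinner (e m) h - cinner (e m) (u + z *\<^sub>C h)" "cinner (e m) u"]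
      by simp
    then show ?thesis using d[of m] by (simp add: field_simps)
  qed
  have "(norm h)\<^sup>2 \<le> 2 * (norm u)\<^sup>2 + (norm h)\<^sup>2 / 2"
  proof (rule norm_le_coefficients[OF onb])
    fix F :: "'i set" assume F: "finite F"
    have "(\<Sum>m\<in>F. (cmod (cinner (e m) h))\<^sup>2)
        \<le> (\<Sum>m\<in>F. 2 * (cmod (cinner (e m) u))\<^sup>2 + 2 * B\<^sup>2 * (norm h)\<^sup>2 * (1 / (?d m)\<^sup>2))"
    proof (intro sum_mono)
      fix m
      have "(cmod (cinner (e m) h))\<^sup>2 \<le> ((cmod (cinner (e m) u) + B * norm h) / ?d m)\<^sup>2"
        using c[of m] by (intro power_mono) auto
      also have "\<dots> \<le> (2 * (cmod (cinner (e m) u))\<^sup>2 + 2 * (B * norm h)\<^sup>2) / (?d m)\<^sup>2"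
        unfolding power_divide by (intro divide_right_mono square_add_le) auto
      also have "\<dots> = 2 * (cmod (cinner (e m) u))\<^sup>2 / (?d m)\<^sup>2 + 2 * B\<^sup>2 * (norm h)\<^sup>2 * (1 / (?d m)\<^sup>2)"
        by (simp add: add_divide_distrib power_mult_distrib)
      also have "2 * (cmod (cinner (e m) u))\<^sup>2 / (?d m)\<^sup>2 \<le> 2 * (cmod (cinner (e m) u))\<^sup>2 / 1"
        using d[of m] L_ge_1 by (intro divide_left_mono) (auto intro!: one_le_power)
      finally show "(cmod (cinner (e m) h))\<^sup>2
          \<le> 2 * (cmod (cinner (e m) u))\<^sup>2 + 2 * B\<^sup>2 * (norm h)\<^sup>2 * (1 / (?d m)\<^sup>2)" by simp
    qed
    also have "\<dots> = 2 * (\<Sum>m\<in>F. (cmod (cinner (e m) u))\<^sup>2) + 2 * B\<^sup>2 * (norm h)\<^sup>2 * (\<Sum>m\<in>F. 1 / (?d m)\<^sup>2)"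
      by (simp add: sum.distrib sum_distrib_left)
    also have "\<dots> \<le> 2 * (norm u)\<^sup>2 + 2 * B\<^sup>2 * (norm h)\<^sup>2 * (2 * gap_const / L)"
      using F z by (intro add_mono mult_left_mono sum_resolvent_fibre_le bessel) (auto simp: onb_cinner[OF onb])
    also have "2 * B\<^sup>2 * (norm h)\<^sup>2 * (2 * gap_const / L) = (norm h)\<^sup>2 * (4 * B\<^sup>2 * gap_const / L)"
      by simp
    also have "\<dots> \<le> (norm h)\<^sup>2 * (1 / 2)"
    proof (intro mult_left_mono)
      have "4 * B\<^sup>2 * gap_const \<le> L / 2" by (simp add: L_def)
      then show "4 * B\<^sup>2 * gap_const / L \<le> 1 / 2" using L_ge_1 by (simp add: divide_le_eq)
    qed simp
    finally show "(\<Sum>m\<in>F. (cmod (cinner (e m) h))\<^sup>2) \<le> 2 * (norm u)\<^sup>2 + (norm h)\<^sup>2 / 2" by simp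
  qed
  then have "(norm h)\<^sup>2 \<le> (2 * norm u)\<^sup>2" by (simp add: power_mult_distrib)
  then show hu: "norm h \<le> 2 * norm u" by (rule power2_le_imp_le) simp
  have "cmod (cinner (e m) u) \<le> norm u"
    using cinner_norm_bound[of "e m" u] norm_onb[OF onb, of m] by simp
  moreover have "B * norm h \<le> B * (2 * norm u)"
    using hu B_nonneg by (rule mult_left_mono)
  ultimately have "cmod (cinner (e m) u) + B * norm h \<le> (1 + 2 * B) * norm u"
    by (simp add: algebra_simps)
  then show "cmod (cinner (e m) h) \<le> (1 + 2 * B) * norm u / ?d m"
    using c[of m] d[of m] by (meson divide_right_mono less_imp_le order_trans)
qed

text \<open>Far from all squares, \<open>resolvent_bound\<close> with \<open>u = 0\<close> forces
  \<open>h = 0\<close>.\<close>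

lemma eigenvalue_near_square:
  assumes "(h, \<mu> *\<^sub>C h) \<in> op" "h \<noteq> 0"
  obtains n where "cmod ((of_nat n)\<^sup>2 - \<mu>) < L"
proof (rule ccontr)
  assume "\<not> thesis"
  then have "\<And>y. L \<le> cmod ((of_nat y)\<^sup>2 - \<mu>)"
    using that not_less by blast
  then have "norm h \<le> 2 * norm (0::'a)"
    using assms by (intro resolvent_bound(1)[of h 0 \<mu>]) auto
  then show False using assms by simp
qed

section \<open>Triangular bases of the cluster spaces\<close>

text \<open>A Schur form: an orthonormal basis of a finite dimensional invariant subspace in which
  \<open>op\<close> is upper triangular with diagonal entries near \<open>n^2\<close>.
  Orthonormality survives even when eigenvectors nearly coincide.\<close>

definition flag :: "nat \<Rightarrow> nat \<Rightarrow> (nat \<Rightarrow> 'a) \<Rightarrow> bool" where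
  "flag n d u \<longleftrightarrow> (\<forall>i<d. \<forall>j<d. cinner (u i) (u j) = (if i = j then 1 else 0)) \<and>
     (\<forall>k<d. \<exists>\<mu> v. cmod ((of_nat n)\<^sup>2 - \<mu>) < L \<and> v \<in> cspace.span (u ` {..<k}) \<and> (u k, \<mu> *\<^sub>C u k + v) \<in> op)"

lemma flag_orthonormal: "flag n d u \<Longrightarrow> i < d \<Longrightarrow> j < d \<Longrightarrow> cinner (u i) (u j) = (if i = j then 1 else 0)"
  by (simp add: flag_def)

lemma cinner_span_eq_0:
  assumes "p \<in> cspace.span S" "\<And>x. x \<in> S \<Longrightarrow> cinner y x = 0"
  shows "cinner y p = 0"
  using assms(1)
  by (induction rule: cspace.span_induct_alt) (auto simp: cinner_add_right cinner_scaleC_right assms(2))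

text \<open>Back substitution along the flag. The diagonal entry \<open>\<mu> - z\<close> is nonzero
  since \<open>z\<close> is at distance exactly \<open>L\<close> from \<open>n^2\<close> and
  \<open>\<mu>\<close> is strictly closer; for the same reason its modulus is at most
  \<open>2 * L\<close>.\<close>

lemma flag_resolvent:
  assumes "flag n d u" "cmod ((of_nat n)\<^sup>2 - z) = L" "k \<le> d"
  shows "\<forall>p\<in>cspace.span (u ` {..<k}). \<exists>h\<in>cspace.span (u ` {..<k}). (h, p + z *\<^sub>C h) \<in> op"
    and "k < d \<Longrightarrow> \<exists>h. (h, u k + z *\<^sub>C h) \<in> op \<and> cmod (cinner (u k) h) \<ge> 1 / (2 * L)"
proof -
  have step: "\<exists>h\<in>cspace.span (u ` {..<Suc k}). (h, u k + z *\<^sub>C h) \<in> op \<and> cmod (cinner (u k) h) \<ge> 1 / (2 * L)"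
    if k: "k < d" and IH: "\<forall>p\<in>cspace.span (u ` {..<k}). \<exists>h\<in>cspace.span (u ` {..<k}). (h, p + z *\<^sub>C h) \<in> op" for k
  proof -
    obtain \<mu> v where \<mu>: "cmod ((of_nat n)\<^sup>2 - \<mu>) < L" and v: "v \<in> cspace.span (u ` {..<k})" "(u k, \<mu> *\<^sub>C u k + v) \<in> op"
      using assms(1) k by (auto simp: flag_def)
    obtain hv where hv: "hv \<in> cspace.span (u ` {..<k})" "(hv, v + z *\<^sub>C hv) \<in> op"
      using IH v(1) by blast
    have ne: "\<mu> - z \<noteq> 0" using \<mu> assms(2) by auto
    have le: "cmod (\<mu> - z) \<le> 2 * L"
      using \<mu> assms(2) norm_triangle_ineq4[of "(of_nat n)\<^sup>2 - z" "(of_nat n)\<^sup>2 - \<mu>"] by simp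
    \<comment> \<open>\<open>hv\<close> removes the off-diagonal part \<open>v\<close> and lies in
      the span of the earlier vectors. It is orthogonal to \<open>u k\<close>, so the diagonal entry
      of the inverse is exactly \<open>1 / (\<mu> - z)\<close>.\<close>
    define h where "h = (1 / (\<mu> - z)) *\<^sub>C (u k - hv)"
    have hsp: "h \<in> cspace.span (u ` {..<Suc k})"
      unfolding h_def lessThan_Suc using hv(1)
      by (intro cspace.span_scale cspace.span_diff) (auto intro: cspace.span_base cspace.span_mono[THEN subsetD, of "u ` {..<k}"])
    have "(u k - hv, \<mu> *\<^sub>C u k + v - (v + z *\<^sub>C hv)) \<in> op"
      by (rule op_diff[OF v(2) hv(2)])
    also have "\<mu> *\<^sub>C u k + v - (v + z *\<^sub>C hv) = (\<mu> - z) *\<^sub>C u k + z *\<^sub>C (u k - hv)"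
      by (simp add: algebra_simps cspace.scale_left_diff_distrib cspace.scale_right_diff_distrib)
    finally have "(h, (1 / (\<mu> - z)) *\<^sub>C ((\<mu> - z) *\<^sub>C u k + z *\<^sub>C (u k - hv))) \<in> op"
      unfolding h_def by (rule op_scale)
    also have "(1 / (\<mu> - z)) *\<^sub>C ((\<mu> - z) *\<^sub>C u k + z *\<^sub>C (u k - hv)) = u k + z *\<^sub>C h"
      using ne by (simp add: h_def cspace.scale_right_distrib mult.commute)
    finally have hop: "(h, u k + z *\<^sub>C h) \<in> op" .
    have "cinner (u k) hv = 0"
      using hv(1) k flag_orthonormal[OF assms(1)] by (elim cinner_span_eq_0) auto
    then have "cinner (u k) h = 1 / (\<mu> - z)"
      using flag_orthonormal[OF assms(1) k k] by (simp add: h_def cinner_scaleC_right cinner_diff_right)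
    then have "cmod (cinner (u k) h) \<ge> 1 / (2 * L)"
      using le ne L_ge_1 by (simp add: norm_divide frac_le)
    then show ?thesis using hsp hop by blast
  qed
  have all: "\<forall>p\<in>cspace.span (u ` {..<k}). \<exists>h\<in>cspace.span (u ` {..<k}). (h, p + z *\<^sub>C h) \<in> op" if "k \<le> d" for k
    using that
  proof (induction k)
    case 0 then show ?case using op_zero by auto
  next
    case (Suc k)
    then have IH: "\<forall>p\<in>cspace.span (u ` {..<k}). \<exists>h\<in>cspace.span (u ` {..<k}). (h, p + z *\<^sub>C h) \<in> op"
      by simp
    obtain hk where hk: "hk \<in> cspace.span (u ` {..<Suc k})" "(hk, u k + z *\<^sub>C hk) \<in> op"
      using step[OF _ IH] Suc by auto
    show ?case
    proof
      fix p assume "p \<in> cspace.span (u ` {..<Suc k})"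
      then obtain c where c: "p - c *\<^sub>C u k \<in> cspace.span (u ` {..<k})"
        using cspace.span_breakdown_eq[of p "u k" "u ` {..<k}"] by (auto simp: lessThan_Suc)
      then obtain h' where h': "h' \<in> cspace.span (u ` {..<k})" "(h', p - c *\<^sub>C u k + z *\<^sub>C h') \<in> op"
        using IH by blast
      have "(h' + c *\<^sub>C hk, (p - c *\<^sub>C u k + z *\<^sub>C h') + c *\<^sub>C (u k + z *\<^sub>C hk)) \<in> op"
        by (intro op_add h' op_scale hk)
      also have "(p - c *\<^sub>C u k + z *\<^sub>C h') + c *\<^sub>C (u k + z *\<^sub>C hk) = p + z *\<^sub>C (h' + c *\<^sub>C hk)"
        by (simp add: cspace.scale_right_distrib mult.commute)
      finally have "(h' + c *\<^sub>C hk, p + z *\<^sub>C (h' + c *\<^sub>C hk)) \<in> op" .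
      moreover have "h' + c *\<^sub>C hk \<in> cspace.span (u ` {..<Suc k})"
        using h'(1) hk(1) cspace.span_mono[of "u ` {..<k}" "u ` {..<Suc k}"]
        by (intro cspace.span_add cspace.span_scale) (auto simp: lessThan_Suc)
      ultimately show "\<exists>h\<in>cspace.span (u ` {..<Suc k}). (h, p + z *\<^sub>C h) \<in> op" by blast
    qed
  qed
  show "\<forall>p\<in>cspace.span (u ` {..<k}). \<exists>h\<in>cspace.span (u ` {..<k}). (h, p + z *\<^sub>C h) \<in> op"
    by (rule all[OF assms(3)])
  show "k < d \<Longrightarrow> \<exists>h. (h, u k + z *\<^sub>C h) \<in> op \<and> cmod (cinner (u k) h) \<ge> 1 / (2 * L)"
    using step all by (meson less_imp_le)
qed

end

context perturbed_diagonal begin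

lemma flag_norm: "flag n d u \<Longrightarrow> k < d \<Longrightarrow> norm (u k) = 1"
  using cinner_self[of "u k"] flag_orthonormal[of n d u k k] norm_ge_zero[of "u k"]
  by (simp add: power2_eq_1_iff del: norm_ge_zero flip: of_real_power)

text \<open>The product of the square sum bound \<open>(1 + 2 * B)^2 * (2 * gap_const / L)\<close>
  over all columns and the reciprocal \<open>8 * L^2\<close> of the lower bound per column.\<close>

definition max_flag :: real where "max_flag = 16 * L * (1 + 2 * B)\<^sup>2 * gap_const"

text \<open>The resolvent at \<open>z = n\<^sup>2 + \<i> L\<close> is triangular in the flag with diagonal entries \<open>1 / (\<mu> - z)\<close>,
  so each column has norm at least \<open>1 / (2 L)\<close>. By duality the coefficient of index \<open>m\<close> contributes
  at most \<open>((1 + 2 B) / \<bar>\<omega> m\<^sup>2 - z\<bar>)\<^sup>2\<close> to the sum of the squared norms of all columns.\<close>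

lemma flag_length_le:
  assumes "flag n d u"
  shows "real d \<le> max_flag"
proof -
  define z where "z = (of_nat n)\<^sup>2 + \<i> * complex_of_real L"
  have Lpos: "L > 0" using L_ge_1 by simp
  have zn: "cmod ((of_nat n)\<^sup>2 - z) = L"
    using Lpos by (simp add: z_def norm_mult)
  have z: "L \<le> cmod ((of_nat y)\<^sup>2 - z)" for y
  proof -
    have "\<bar>Im ((of_nat y)\<^sup>2 - z)\<bar> = L"
      using Lpos by (simp add: z_def Im_power2)
    then show ?thesis using abs_Im_le_cmod by metis
  qed
  have "\<forall>k\<in>{..<d}. \<exists>h. (h, u k + z *\<^sub>C h) \<in> op \<and> cmod (cinner (u k) h) \<ge> 1 / (2 * L)"
    using flag_resolvent(2)[OF assms zn] by auto
  then obtain h where h: "\<And>k. k < d \<Longrightarrow> (h k, u k + z *\<^sub>C h k) \<in> op"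
      "\<And>k. k < d \<Longrightarrow> cmod (cinner (u k) (h k)) \<ge> 1 / (2 * L)"
    unfolding bchoice_iff by auto
  have nh: "1 / (4 * L\<^sup>2) \<le> (norm (h k))\<^sup>2" if "k < d" for k
  proof -
    have "1 / (2 * L) \<le> norm (h k)"
      using h(2)[OF that] cinner_norm_bound[of "u k" "h k"] flag_norm[OF assms that] by simp
    then have "(1 / (2 * L))\<^sup>2 \<le> (norm (h k))\<^sup>2"
      using Lpos by (intro power_mono) auto
    then show ?thesis by (simp add: power_divide power_mult_distrib)
  qed
  \<comment> \<open>Half of the squared norm of each column sits in finitely many coefficients, so
    that the double sum below is finite and can be swapped. This turns 4 into 8.\<close>
  have "\<exists>F. finite F \<and> 1 / (8 * L\<^sup>2) \<le> (\<Sum>m\<in>F. (cmod (cinner (e m) (h k)))\<^sup>2)" if "k < d" for k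
  proof (rule ccontr)
    assume "\<nexists>F. finite F \<and> 1 / (8 * L\<^sup>2) \<le> (\<Sum>m\<in>F. (cmod (cinner (e m) (h k)))\<^sup>2)"
    then have "(norm (h k))\<^sup>2 \<le> 1 / (8 * L\<^sup>2)"
      by (intro norm_le_coefficients[OF onb]) (auto simp: not_le intro: less_imp_le)
    then have "1 / (4 * L\<^sup>2) \<le> 1 / (8 * L\<^sup>2)"
      using nh[OF that] by linarith
    then show False using Lpos by (simp add: field_simps)
  qed
  then have "\<forall>k\<in>{..<d}. \<exists>F. finite F \<and> 1 / (8 * L\<^sup>2) \<le> (\<Sum>m\<in>F. (cmod (cinner (e m) (h k)))\<^sup>2)"
    by auto
  then obtain F where F: "\<And>k. k < d \<Longrightarrow> finite (F k)"
      "\<And>k. k < d \<Longrightarrow> 1 / (8 * L\<^sup>2) \<le> (\<Sum>m\<in>F k. (cmod (cinner (e m) (h k)))\<^sup>2)"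
    unfolding bchoice_iff by auto
  define G where "G = (\<Union>k<d. F k)"
  have G: "finite G" "\<And>k. k < d \<Longrightarrow> F k \<subseteq> G" using F(1) by (auto simp: G_def)
  let ?d = "\<lambda>m. cmod ((of_nat (\<omega> m))\<^sup>2 - z)"
  have col: "(\<Sum>k<d. (cmod (cinner (e m) (h k)))\<^sup>2) \<le> (1 + 2 * B)\<^sup>2 * (1 / (?d m)\<^sup>2)" for m
  proof -
    define s where "s = (\<Sum>k<d. (cmod (cinner (e m) (h k)))\<^sup>2)"
    \<comment> \<open>The extremal choice for duality: with conjugated coefficients the combined
      solution has \<open>m\<close>-th coefficient \<open>s\<close>, while its right-hand side
      \<open>w\<close> has squared norm \<open>s\<close>. The linear bound in \<open>norm w\<close>
      thus bounds \<open>s\<close> itself.\<close>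
    define a where "a k = cnj (cinner (e m) (h k))" for k
    define w where "w = (\<Sum>k<d. a k *\<^sub>C u k)"
    have "(\<Sum>k<d. a k *\<^sub>C h k, \<Sum>k<d. a k *\<^sub>C (u k + z *\<^sub>C h k)) \<in> op"
      using h(1) by (intro op_sum) auto
    also have "(\<Sum>k<d. a k *\<^sub>C (u k + z *\<^sub>C h k)) = w + z *\<^sub>C (\<Sum>k<d. a k *\<^sub>C h k)"
      by (simp add: w_def cspace.scale_right_distrib sum.distrib cspace.scale_sum_right mult.commute)
    finally have "cmod (cinner (e m) (\<Sum>k<d. a k *\<^sub>C h k)) \<le> (1 + 2 * B) * norm w / ?d m"
      by (rule resolvent_bound(2)) (rule z)
    moreover have "cinner (e m) (\<Sum>k<d. a k *\<^sub>C h k) = complex_of_real s"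
      unfolding s_def of_real_sum complex_norm_square
      by (simp add: cinner_sum_right cinner_scaleC_right a_def mult.commute)
    moreover have "s \<ge> 0" by (simp add: s_def sum_nonneg)
    ultimately have 1: "s \<le> (1 + 2 * B) * norm w / ?d m" by simp
    have 2: "(norm w)\<^sup>2 = s"
      unfolding w_def s_def
      by (subst norm_sum_orthonormal) (auto simp: a_def flag_orthonormal[OF assms])
    have "s \<le> ((1 + 2 * B) / ?d m)\<^sup>2"
    proof (cases "norm w = 0")
      case True then show ?thesis using 2 by simp
    next
      case False
      then have "norm w * norm w \<le> ((1 + 2 * B) / ?d m) * norm w"
        using 1 2 by (simp add: power2_eq_square)
      then have "norm w \<le> (1 + 2 * B) / ?d m"
        using False by (intro mult_right_le_imp_le[of "norm w" "norm w"]) auto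
      then have "(norm w)\<^sup>2 \<le> ((1 + 2 * B) / ?d m)\<^sup>2" by (intro power_mono) auto
      then show ?thesis using 2 by simp
    qed
    then show ?thesis by (simp add: s_def power_divide)
  qed
  have "real d * (1 / (8 * L\<^sup>2)) = (\<Sum>k<d. 1 / (8 * L\<^sup>2))" by simp
  also have "\<dots> \<le> (\<Sum>k<d. \<Sum>m\<in>G. (cmod (cinner (e m) (h k)))\<^sup>2)"
  proof (intro sum_mono)
    fix k assume "k \<in> {..<d}"
    then show "1 / (8 * L\<^sup>2) \<le> (\<Sum>m\<in>G. (cmod (cinner (e m) (h k)))\<^sup>2)"
      using F(2)[of k] sum_mono2[OF G(1) G(2)[of k], of "\<lambda>m. (cmod (cinner (e m) (h k)))\<^sup>2"] by simp
  qed
  also have "\<dots> = (\<Sum>m\<in>G. \<Sum>k<d. (cmod (cinner (e m) (h k)))\<^sup>2)"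
    by (rule sum.swap)
  also have "\<dots> \<le> (\<Sum>m\<in>G. (1 + 2 * B)\<^sup>2 * (1 / (?d m)\<^sup>2))"
    by (intro sum_mono col)
  also have "\<dots> = (1 + 2 * B)\<^sup>2 * (\<Sum>m\<in>G. 1 / (?d m)\<^sup>2)"
    by (simp add: sum_distrib_left)
  also have "\<dots> \<le> (1 + 2 * B)\<^sup>2 * (2 * gap_const / L)"
    by (intro mult_left_mono sum_resolvent_fibre_le G z) auto
  finally show ?thesis
    using Lpos by (simp add: max_flag_def field_simps power2_eq_square)
qed

lemma flag_span_invariant:
  assumes "flag n d u" "p \<in> cspace.span (u ` {..<d})"
  shows "\<exists>p'\<in>cspace.span (u ` {..<d}). (p, p') \<in> op"
  using assms(2)
proof (induction rule: cspace.span_induct_alt)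
  case base
  then show ?case using op_zero cspace.span_zero by blast
next
  case (step c x y)
  then obtain k where k: "k < d" "x = u k" by auto
  obtain \<mu> v where v: "v \<in> cspace.span (u ` {..<k})" "(u k, \<mu> *\<^sub>C u k + v) \<in> op"
    using assms(1) k(1) unfolding flag_def by blast
  have "u ` {..<k} \<subseteq> u ` {..<d}"
    using k by auto
  then have "v \<in> cspace.span (u ` {..<d})"
    using v(1) cspace.span_mono by blast
  then have "\<mu> *\<^sub>C u k + v \<in> cspace.span (u ` {..<d})"
    using k by (auto intro!: cspace.span_add cspace.span_scale intro: cspace.span_base)
  moreover obtain y' where "y' \<in> cspace.span (u ` {..<d})" "(y, y') \<in> op"
    using step by blast
  ultimately show ?case
    using v(2) k(2) op_add[OF op_scale] cspace.span_add[OF cspace.span_scale] by meson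
qed

text \<open>Otherwise the last vector outside the span in the chain \<open>f, (H - \<mu>) f, \<dots>, 0\<close> would extend the flag.\<close>

lemma root_vector_in_maximal_flag:
  assumes fl: "flag n d u" and max: "\<And>d' u'. flag n d' u' \<Longrightarrow> d' \<le> d"
    and \<mu>: "cmod ((of_nat n)\<^sup>2 - \<mu>) < L" and "(f, 0) \<in> shift_op op \<mu> ^^ m"
  shows "f \<in> cspace.span (u ` {..<d})"
  using assms(4)
proof (induction m arbitrary: f)
  case 0
  then show ?case by (simp add: cspace.span_zero)
next
  case (Suc m)
  obtain y where y: "(f, y) \<in> shift_op op \<mu>" "(y, 0) \<in> shift_op op \<mu> ^^ m"
    using relpow_Suc_D2[OF Suc.prems] by blast
  let ?U = "cspace.span (u ` {..<d})"
  have yU: "y \<in> ?U" by (rule Suc.IH[OF y(2)])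
  obtain g where g: "(f, g) \<in> op" "y = g - \<mu> *\<^sub>C f"
    using y(1) by (auto simp: shift_op_def)
  show ?case
  proof (rule ccontr)
    assume f: "f \<notin> ?U"
    define p where "p = (\<Sum>k<d. cinner (u k) f *\<^sub>C u k)"
    have pU: "p \<in> ?U"
      unfolding p_def by (intro cspace.span_sum cspace.span_scale cspace.span_base) auto
    obtain p' where p': "p' \<in> ?U" "(p, p') \<in> op"
      using flag_span_invariant[OF fl pU] by blast
    \<comment> \<open>The part of \<open>f\<close> orthogonal to the span. Modulo the span it is an
      eigenvector for \<open>\<mu>\<close>, because the image of \<open>f\<close> under the shifted
      operator and that of \<open>p\<close> under \<open>op\<close> both stay in the span.\<close>
    define r where "r = f - p"
    have r0: "r \<noteq> 0" using f pU by (auto simp: r_def)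
    define v where "v = y + \<mu> *\<^sub>C p - p'"
    have vU: "v \<in> ?U"
      unfolding v_def by (intro cspace.span_add cspace.span_diff cspace.span_scale yU pU p')
    have "(r, g - p') \<in> op" unfolding r_def by (rule op_diff[OF g(1) p'(2)])
    also have "g - p' = \<mu> *\<^sub>C r + v"
      by (simp add: g(2) v_def r_def cspace.scale_right_diff_distrib)
    finally have rop: "(r, \<mu> *\<^sub>C r + v) \<in> op" .
    define c where "c = complex_of_real (1 / norm r)"
    define u' where "u' = u(d := c *\<^sub>C r)"
    have orth: "cinner (u k) r = 0" "cinner r (u k) = 0" if "k < d" for k
    proof -
      show "cinner (u k) r = 0"
        using that cinner_sum_orthonormal[of "{..<d}" u k "\<lambda>k. cinner (u k) f"] flag_orthonormal[OF fl]
        by (simp add: r_def p_def cinner_diff_right)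
      then show "cinner r (u k) = 0" by (metis cinner_commute complex_cnj_zero)
    qed
    have cr: "cinner (c *\<^sub>C r) (c *\<^sub>C r) = 1"
      unfolding cinner_self norm_scaleC using r0 by (simp add: c_def norm_divide)
    have img: "u' ` {..<k} = u ` {..<k}" if "k \<le> d" for k
      using that by (auto simp: u'_def image_def)
    have "flag n (Suc d) u'"
      unfolding flag_def
    proof (intro conjI allI impI)
      fix i j assume "i < Suc d" "j < Suc d"
      then show "cinner (u' i) (u' j) = (if i = j then 1 else 0)"
        using flag_orthonormal[OF fl, of i j] orth cr
        by (auto simp: u'_def less_Suc_eq cinner_scaleC_left cinner_scaleC_right)
    next
      fix k assume k: "k < Suc d"
      show "\<exists>\<mu> v. cmod ((of_nat n)\<^sup>2 - \<mu>) < L \<and> v \<in> cspace.span (u' ` {..<k}) \<and> (u' k, \<mu> *\<^sub>C u' k + v) \<in> op"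
      proof (cases "k < d")
        case True
        then show ?thesis using fl img[of k] by (simp add: flag_def u'_def)
      next
        case False
        then have [simp]: "k = d" using k by simp
        have "(c *\<^sub>C r, c *\<^sub>C (\<mu> *\<^sub>C r + v)) \<in> op" by (rule op_scale[OF rop])
        then have "(u' k, \<mu> *\<^sub>C u' k + c *\<^sub>C v) \<in> op"
          by (simp add: u'_def cspace.scale_right_distrib mult.commute)
        moreover have "c *\<^sub>C v \<in> cspace.span (u' ` {..<k})"
          using img[of d] vU by (simp add: cspace.span_scale)
        ultimately show ?thesis using \<mu> by blast
      qed
    qed
    then show False using max by fastforce
  qed
qed

section \<open>Concentration of a cluster at its frequency\<close>

definition proj :: "nat \<Rightarrow> 'a \<Rightarrow> 'a" where
  "proj n h = (\<Sum>m\<in>{m. \<omega> m = n}. cinner (e m) h *\<^sub>C e m)"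

lemma proj_add: "proj n (h + k) = proj n h + proj n k"
  by (simp add: proj_def cinner_add_right cspace.scale_left_distrib sum.distrib)

lemma proj_scale: "proj n (c *\<^sub>C h) = c *\<^sub>C proj n h"
  by (simp add: proj_def cinner_scaleC_right cspace.scale_sum_right)

lemma cinner_proj: "cinner (e m) (proj n h) = (if \<omega> m = n then cinner (e m) h else 0)"
  using fin_fibre[of n]
  by (auto simp: proj_def cinner_sum_right cinner_scaleC_right onb_cinner[OF onb] if_distrib cong: if_cong)

lemma norm_proj: "(norm (proj n h))\<^sup>2 = (\<Sum>m\<in>{m. \<omega> m = n}. (cmod (cinner (e m) h))\<^sup>2)"
  unfolding proj_def by (rule norm_sum_orthonormal) (simp add: onb_cinner[OF onb])

lemma norm_minus_proj_le: "norm (h - proj n h) \<le> norm h"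
  using norm_minus_proj(2)[of "{m. \<omega> m = n}" e h "\<lambda>_. 0"] fin_fibre[of n]
  by (simp add: proj_def onb_cinner[OF onb])

lemma norm_minus_proj_coefficients:
  assumes "\<And>F. finite F \<Longrightarrow> (\<And>m. m \<in> F \<Longrightarrow> \<omega> m \<noteq> n) \<Longrightarrow> (\<Sum>m\<in>F. (cmod (cinner (e m) h))\<^sup>2) \<le> X"
  shows "(norm (h - proj n h))\<^sup>2 \<le> X"
proof (rule norm_le_coefficients[OF onb])
  fix F :: "'i set" assume F: "finite F"
  have "(\<Sum>m\<in>F. (cmod (cinner (e m) (h - proj n h)))\<^sup>2) = (\<Sum>m\<in>{m\<in>F. \<omega> m \<noteq> n}. (cmod (cinner (e m) h))\<^sup>2)"
    using F by (intro sum.mono_neutral_cong_right) (auto simp: cinner_diff_right cinner_proj)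
  also have "\<dots> \<le> X"
    using F by (intro assms) auto
  finally show "(\<Sum>m\<in>F. (cmod (cinner (e m) (h - proj n h)))\<^sup>2) \<le> X" .
qed

text \<open>In \<open>flag_vector_remainder\<close> the off-diagonal part contributes
  \<open>4 * (L + B)\<close> and the perturbation at most \<open>B\<close>, which gives 5; under the
  root, 2 is the fibre size and 4 the constant of \<open>sum_off_cluster_le\<close>.\<close>

definition rem_const :: real where "rem_const = 5 * (L + B) * sqrt (8 * gap_const)"

lemma rem_const_nonneg: "rem_const \<ge> 0"
  using L_ge_1 B_nonneg gap_const_ge by (simp add: rem_const_def)

text \<open>The off-diagonal part \<open>v\<close> of the flag is bounded because its coefficients at the frequencies
  \<open>\<omega> m = n\<close> are, and these already carry at least half of its norm.\<close>

lemma flag_vector_remainder: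
  assumes fl: "flag n d u" and k: "k < d" and n: "n \<ge> 1" "real n \<ge> 2 * L"
    and IH: "\<And>w. w \<in> cspace.span (u ` {..<k}) \<Longrightarrow> norm (w - proj n w) \<le> norm w / 2"
  shows "norm (u k - proj n (u k)) \<le> rem_const / real n"
proof -
  obtain \<mu> v where \<mu>: "cmod ((of_nat n)\<^sup>2 - \<mu>) < L" and v: "v \<in> cspace.span (u ` {..<k})" "(u k, \<mu> *\<^sub>C u k + v) \<in> op"
    using fl k unfolding flag_def by blast
  have nu: "norm (u k) = 1" by (rule flag_norm[OF fl k])
  have eu: "cmod (cinner (e m) (u k)) \<le> 1" for m
    using cinner_norm_bound[of "e m" "u k"] nu norm_onb[OF onb] by simp
  have co: "cmod (((of_nat (\<omega> m))\<^sup>2 - \<mu>) * cinner (e m) (u k) - cinner (e m) v) \<le> B" for m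
    using op_coeff[OF v(2), of m] nu by (simp add: cinner_add_right cinner_scaleC_right algebra_simps)
  \<comment> \<open>At \<open>\<omega> m = n\<close> the equation for \<open>u k\<close> determines
    the coefficient of \<open>v\<close> up to \<open>|n^2 - \<mu>| + B \<le> L + B\<close>.\<close>
  have "(norm (proj n v))\<^sup>2 \<le> (\<Sum>m\<in>{m. \<omega> m = n}. (L + B)\<^sup>2)"
    unfolding norm_proj
  proof (intro sum_mono power_mono)
    fix m assume "m \<in> {m. \<omega> m = n}"
    then have [simp]: "\<omega> m = n" by simp
    have "cmod (cinner (e m) v) \<le> cmod (((of_nat (\<omega> m))\<^sup>2 - \<mu>) * cinner (e m) (u k)) +
        cmod (((of_nat (\<omega> m))\<^sup>2 - \<mu>) * cinner (e m) (u k) - cinner (e m) v)"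
      by (metis add_diff_cancel_left' diff_add_cancel norm_triangle_ineq4)
    moreover have "cmod (((of_nat (\<omega> m))\<^sup>2 - \<mu>) * cinner (e m) (u k)) \<le> L * 1"
      unfolding norm_mult using \<mu> eu[of m] L_ge_1 by (intro mult_mono) auto
    ultimately show "cmod (cinner (e m) v) \<le> L + B" using co[of m] by linarith
  qed auto
  also have "\<dots> = real (card {m. \<omega> m = n}) * (L + B)\<^sup>2" by simp
  also have "\<dots> \<le> 4 * (L + B)\<^sup>2"
    using card_fibre[of n] by (intro mult_right_mono) auto
  also have "\<dots> = (2 * (L + B))\<^sup>2" by (simp only: power_mult_distrib) simp
  finally have pv: "norm (proj n v) \<le> 2 * (L + B)"
    by (rule power2_le_imp_le) (use L_ge_1 B_nonneg in simp)
  have "norm v \<le> norm (v - proj n v) + norm (proj n v)"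
    using norm_triangle_ineq[of "v - proj n v" "proj n v"] by simp
  \<comment> \<open>At most half of the norm of \<open>v\<close> lies outside the frequency
    \<open>n\<close>, so \<open>norm v\<close> is at most twice the norm of its projection.\<close>
  then have nv: "norm v \<le> 4 * (L + B)"
    using IH[OF v(1)] pv by argo
  have "(norm (u k - proj n (u k)))\<^sup>2 \<le> (5 * (L + B))\<^sup>2 * (2 * (4 * gap_const / (real n)\<^sup>2))"
  proof (rule norm_minus_proj_coefficients)
    fix F :: "'i set" assume F: "finite F" "\<And>m. m \<in> F \<Longrightarrow> \<omega> m \<noteq> n"
    have off: "finite (\<omega> ` F)" "n \<notin> \<omega> ` F" using F by auto
    have "(\<Sum>m\<in>F. (cmod (cinner (e m) (u k)))\<^sup>2) \<le> (\<Sum>m\<in>F. (5 * (L + B))\<^sup>2 * (1 / (cmod ((of_nat (\<omega> m))\<^sup>2 - \<mu>))\<^sup>2))"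
    proof (intro sum_mono)
      fix m assume "m \<in> F"
      have pos: "cmod ((of_nat (\<omega> m))\<^sup>2 - \<mu>) > 0"
        using sum_off_cluster_le(2)[of L n \<mu> "{}" "\<omega> m"] F(2)[OF \<open>m \<in> F\<close>] n \<mu> L_ge_1 by simp
      have "cmod (cinner (e m) v) \<le> norm v"
        using cinner_norm_bound[of "e m" v] norm_onb[OF onb] by simp
      moreover have "cmod (((of_nat (\<omega> m))\<^sup>2 - \<mu>) * cinner (e m) (u k)) \<le> cmod (cinner (e m) v) +
        cmod (((of_nat (\<omega> m))\<^sup>2 - \<mu>) * cinner (e m) (u k) - cinner (e m) v)"
        by (rule norm_triangle_sub)
      ultimately have "cmod ((of_nat (\<omega> m))\<^sup>2 - \<mu>) * cmod (cinner (e m) (u k)) \<le> 5 * (L + B)"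
        unfolding norm_mult[symmetric] using nv co[of m] L_ge_1 by argo
      then have "cmod (cinner (e m) (u k)) \<le> 5 * (L + B) / cmod ((of_nat (\<omega> m))\<^sup>2 - \<mu>)"
        using pos by (simp add: field_simps)
      then have "(cmod (cinner (e m) (u k)))\<^sup>2 \<le> (5 * (L + B) / cmod ((of_nat (\<omega> m))\<^sup>2 - \<mu>))\<^sup>2"
        by (intro power_mono) auto
      then show "(cmod (cinner (e m) (u k)))\<^sup>2 \<le> (5 * (L + B))\<^sup>2 * (1 / (cmod ((of_nat (\<omega> m))\<^sup>2 - \<mu>))\<^sup>2)"
        by (simp add: power_divide)
    qed
    also have "\<dots> = (5 * (L + B))\<^sup>2 * (\<Sum>m\<in>F. 1 / (cmod ((of_nat (\<omega> m))\<^sup>2 - \<mu>))\<^sup>2)"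
      by (simp add: sum_distrib_left)
    also have "(\<Sum>m\<in>F. 1 / (cmod ((of_nat (\<omega> m))\<^sup>2 - \<mu>))\<^sup>2) \<le> 2 * (\<Sum>y\<in>\<omega> ` F. 1 / (cmod ((of_nat y)\<^sup>2 - \<mu>))\<^sup>2)"
      by (rule sum_fibre_le[of F "\<lambda>y. 1 / (cmod ((of_nat y)\<^sup>2 - \<mu>))\<^sup>2"]) (use F in auto)
    also have "(\<Sum>y\<in>\<omega> ` F. 1 / (cmod ((of_nat y)\<^sup>2 - \<mu>))\<^sup>2) \<le> 4 * gap_const / (real n)\<^sup>2"
      using \<mu> L_ge_1 by (intro sum_off_cluster_le(1)[of L] n off) auto
    finally show "(\<Sum>m\<in>F. (cmod (cinner (e m) (u k)))\<^sup>2) \<le> (5 * (L + B))\<^sup>2 * (2 * (4 * gap_const / (real n)\<^sup>2))"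
      by (simp add: mult_left_mono)
  qed
  also have "\<dots> = (rem_const / real n)\<^sup>2"
    using gap_const_ge by (simp add: rem_const_def power_mult_distrib power_divide)
  finally show ?thesis
    by (rule power2_le_imp_le) (use rem_const_nonneg in simp)
qed

text \<open>Orthogonal components are no longer than \<open>w\<close>, so each flag vector adds one
  \<open>rem_const / n\<close>. The estimate for \<open>u k\<close> presupposes that the earlier
  span keeps half of its norm at frequency \<open>n\<close>; the lower bound on \<open>n\<close> in
  terms of \<open>d\<close> guarantees this from the induction hypothesis.\<close>

lemma flag_span_remainder:
  assumes fl: "flag n d u" and n: "n \<ge> 1" "real n \<ge> 2 * L" "real n \<ge> 2 * (real d * rem_const)"
    and "k \<le> d" "w \<in> cspace.span (u ` {..<k})"
  shows "norm (w - proj n w) \<le> real k * rem_const / real n * norm w"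
  using assms(5,6)
proof (induction k arbitrary: w)
  case 0
  then show ?case by (simp add: proj_def)
next
  case (Suc k)
  then have k: "k < d" by simp
  have half: "norm (w - proj n w) \<le> norm w / 2" if "w \<in> cspace.span (u ` {..<k})" for w
  proof -
    have "norm (w - proj n w) \<le> real k * rem_const / real n * norm w"
      using Suc.IH[OF _ that] k by simp
    also have "real k * rem_const \<le> real d * rem_const"
      using k rem_const_nonneg by (intro mult_right_mono) auto
    then have "real k * rem_const / real n * norm w \<le> 1 / 2 * norm w"
      using n by (intro mult_right_mono) (auto simp: field_simps)
    finally show ?thesis by simp
  qed
  obtain c where c: "w - c *\<^sub>C u k \<in> cspace.span (u ` {..<k})"
    using Suc.prems(2) cspace.span_breakdown_eq[of w "u k" "u ` {..<k}"] by (auto simp: lessThan_Suc)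
  define w' where "w' = w - c *\<^sub>C u k"
  have w: "w = w' + c *\<^sub>C u k" by (simp add: w'_def)
  have "cinner (u k) w' = 0"
    using c k flag_orthonormal[OF fl] unfolding w'_def[symmetric] by (elim cinner_span_eq_0) auto
  then have "cinner w' (c *\<^sub>C u k) = 0"
    by (metis cinner_commute complex_cnj_zero cinner_scaleC_right mult_zero_right)
  then have nw: "(norm w)\<^sup>2 = (norm w')\<^sup>2 + (cmod c)\<^sup>2"
    unfolding w using flag_norm[OF fl k] by (simp add: norm_add_orthogonal norm_scaleC)
  have le: "norm w' \<le> norm w" "cmod c \<le> norm w"
    by (rule power2_le_imp_le; simp add: nw)+
  have "w - proj n w = (w' - proj n w') + c *\<^sub>C (u k - proj n (u k))"
    unfolding w by (simp add: proj_add proj_scale cspace.scale_right_diff_distrib)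
  then have "norm (w - proj n w) \<le> norm (w' - proj n w') + cmod c * norm (u k - proj n (u k))"
    by (metis norm_scaleC norm_triangle_ineq)
  also have "\<dots> \<le> real k * rem_const / real n * norm w + norm w * (rem_const / real n)"
  proof (intro add_mono mult_mono le)
    have "norm (w' - proj n w') \<le> real k * rem_const / real n * norm w'"
      using Suc.IH[of w'] c k by (simp add: w'_def)
    also have "\<dots> \<le> real k * rem_const / real n * norm w"
      using rem_const_nonneg le by (intro mult_left_mono) auto
    finally show "norm (w' - proj n w') \<le> real k * rem_const / real n * norm w" .
    show "norm (u k - proj n (u k)) \<le> rem_const / real n"
      by (rule flag_vector_remainder[OF fl k n(1,2) half])
  qed auto
  also have "\<dots> = real (Suc k) * rem_const / real n * norm w"
    by (simp add: add_divide_distrib ring_distribs mult_ac)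
  finally show ?case .
qed

text \<open>\<open>T n\<close> is a flag of maximal length, which exists because lengths are
  bounded. Maximality puts every root vector with eigenvalue near \<open>n^2\<close> into its
  span.\<close>

theorem root_vector_clusters:
  obtains C T where "C \<ge> 0" "\<And>n. finite (T n)" "\<And>n. real (card (T n)) \<le> max_flag"
    "\<And>n \<mu> f m. cmod ((of_nat n)\<^sup>2 - \<mu>) < L \<Longrightarrow> (f, 0) \<in> shift_op op \<mu> ^^ m \<Longrightarrow> f \<in> cspace.span (T n)"
    "\<And>n w. w \<in> cspace.span (T n) \<Longrightarrow> norm (w - proj n w) \<le> C / (real n + 1) * norm w"
proof -
  have "\<exists>d u. flag n d u \<and> (\<forall>d' u'. flag n d' u' \<longrightarrow> d' \<le> d)" for n
  proof -
    have "\<exists>u. flag n 0 u" by (auto simp: flag_def)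
    moreover have "d \<le> nat \<lceil>max_flag\<rceil>" if "\<exists>u. flag n d u" for d
    proof -
      have "real d \<le> real (nat \<lceil>max_flag\<rceil>)"
        using that flag_length_le of_nat_ceiling[of max_flag] order_trans by blast
      then show ?thesis by simp
    qed
    ultimately show ?thesis
      using Nat.ex_has_greatest_nat[of "\<lambda>d. \<exists>u. flag n d u" 0 "nat \<lceil>max_flag\<rceil>"] by metis
  qed
  then obtain d u where fl: "\<And>n. flag n (d n) (u n)" and max: "\<And>n d' u'. flag n d' u' \<Longrightarrow> d' \<le> d n"
    by metis
  have M: "max_flag \<ge> 0" using flag_length_le[OF fl[of 0]] by simp
  \<comment> \<open>Above \<open>D\<close> all lower bounds on \<open>n\<close> in
    \<open>flag_span_remainder\<close> hold. Below \<open>D\<close> the factor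
    \<open>2 * D / (n + 1)\<close> is at least 1 and the estimate is trivial.\<close>
  define D where "D = max 1 (max (2 * L) (2 * (max_flag * rem_const)))"
  show ?thesis
  proof (rule that[of "2 * D" "\<lambda>n. u n ` {..<d n}"])
    show "2 * D \<ge> 0" by (simp add: D_def)
    fix n
    show "finite (u n ` {..<d n})" by simp
    have "real (card (u n ` {..<d n})) \<le> real (d n)"
      using card_image_le[of "{..<d n}" "u n"] by simp
    then show "real (card (u n ` {..<d n})) \<le> max_flag"
      using flag_length_le[OF fl[of n]] by linarith
    show "f \<in> cspace.span (u n ` {..<d n})"
      if "cmod ((of_nat n)\<^sup>2 - \<mu>) < L" "(f, 0) \<in> shift_op op \<mu> ^^ m" for \<mu> f m
      by (rule root_vector_in_maximal_flag[OF fl max that])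
    fix w assume w: "w \<in> cspace.span (u n ` {..<d n})"
    show "norm (w - proj n w) \<le> 2 * D / (real n + 1) * norm w"
    proof (cases "real n \<ge> D")
      case True
      have dM: "real (d n) * rem_const \<le> max_flag * rem_const"
        using flag_length_le[OF fl[of n]] rem_const_nonneg by (rule mult_right_mono)
      have n: "n \<ge> 1" "real n \<ge> 2 * L" "real n \<ge> 2 * (real (d n) * rem_const)"
        using True dM by (auto simp: D_def)
      have "norm (w - proj n w) \<le> real (d n) * rem_const / real n * norm w"
        by (rule flag_span_remainder[OF fl n order_refl w])
      also have "\<dots> \<le> 2 * D / (real n + 1) * norm w"
      proof (intro mult_right_mono)
        have "real (d n) * rem_const / real n \<le> D / real n"
          using dM n(1) by (intro divide_right_mono) (auto simp: D_def)
        also have "\<dots> \<le> 2 * D / (real n + 1)"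
        proof -
          have "D * (real n + 1) \<le> D * (2 * real n)"
            using n(1) by (intro mult_left_mono) (auto simp: D_def)
          then show ?thesis using n(1) by (simp add: divide_simps mult_ac)
        qed
        finally show "real (d n) * rem_const / real n \<le> 2 * D / (real n + 1)" .
      qed simp
      finally show ?thesis .
    next
      case False
      have "D \<ge> 1" by (simp add: D_def)
      then have "1 \<le> 2 * D / (real n + 1)" using False by (simp add: field_simps)
      then have "1 * norm w \<le> 2 * D / (real n + 1) * norm w" by (intro mult_right_mono) auto
      then show ?thesis using norm_minus_proj_le[of w n] by simp
    qed
  qed
qed

end

section \<open>Almost orthogonality of different clusters\<close>

lemma norm_sum_orthogonal_family:
  fixes p :: "'b \<Rightarrow> 'a::complex_inner"
  assumes "finite N" "\<And>m n. m \<in> N \<Longrightarrow> n \<in> N \<Longrightarrow> m \<noteq> n \<Longrightarrow> cinner (p m) (p n) = 0"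
  shows "(norm (\<Sum>n\<in>N. p n))\<^sup>2 = (\<Sum>n\<in>N. (norm (p n))\<^sup>2)"
  using assms
proof (induction N rule: finite_induct)
  case (insert x N)
  have "cinner (p x) (\<Sum>n\<in>N. p n) = 0"
    unfolding cinner_sum_right using insert by (intro sum.neutral) auto
  then show ?case using insert by (simp add: norm_add_orthogonal)
qed auto

lemma summable_inverse_Suc_square: "summable (\<lambda>n. (C / (real n + 1))\<^sup>2)"
proof -
  have "summable (\<lambda>n. inverse (real (Suc n) ^ 2))"
    using inverse_power_summable[of 2, where 'a=real] summable_Suc_iff[of "\<lambda>n. inverse (real n ^ 2)"] by simp
  then have "summable (\<lambda>n. C\<^sup>2 * inverse (real (Suc n) ^ 2))" by (rule summable_mult)
  then show ?thesis by (simp add: power_mult_distrib power_inverse divide_inverse add.commute)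
qed

lemma summable_tail_sums_less:
  fixes s :: "nat \<Rightarrow> real"
  assumes "summable s" "\<And>n. s n \<ge> 0" "\<epsilon> > 0"
  obtains N0 where "\<And>N. finite N \<Longrightarrow> (\<And>n. n \<in> N \<Longrightarrow> n \<ge> N0) \<Longrightarrow> sum s N \<le> \<epsilon>"
proof -
  obtain N0 where N0: "\<And>n. n \<ge> N0 \<Longrightarrow> norm (\<Sum>i. s (i + n)) < \<epsilon>"
    using suminf_exist_split[OF assms(3,1)] by blast
  show ?thesis
  proof (rule that)
    fix N assume N: "finite N" "\<And>n. n \<in> N \<Longrightarrow> n \<ge> N0"
    have "sum s N = (\<Sum>i\<in>(\<lambda>n. n - N0) ` N. s (i + N0))"
      using N(2) by (subst sum.reindex) (auto simp: inj_on_def, metis le_add_diff_inverse)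
    also have "\<dots> \<le> (\<Sum>i. s (i + N0))"
      using assms N(1) by (intro sum_le_suminf) (auto simp: summable_iff_shift)
    also have "\<dots> \<le> \<epsilon>" using N0[of N0] by simp
    finally show "sum s N \<le> \<epsilon>" .
  qed
qed

context perturbed_diagonal begin

context
  fixes C :: real and T :: "nat \<Rightarrow> 'a set"
  assumes C: "C \<ge> 0"
    and rem: "\<And>n w. w \<in> cspace.span (T n) \<Longrightarrow> norm (w - proj n w) \<le> C / (real n + 1) * norm w"
begin

text \<open>The projections form an orthogonal sum \<open>p\<close>; the remainders form
  \<open>q\<close>, whose squared norm is at most \<open>D * s\<close> by Cauchy-Schwarz. For
  \<open>D \<le> 1 / 16\<close> the norm of \<open>p\<close> is at least 3/4 and that of
  \<open>q\<close> at most 1/4 of \<open>sqrt s\<close>, so \<open>p + q\<close> keeps one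
  half.\<close>

lemma cluster_sum_bounds:
  assumes N: "finite N" and w: "\<And>n. n \<in> N \<Longrightarrow> w n \<in> cspace.span (T n)"
    and D: "(\<Sum>n\<in>N. (C / (real n + 1))\<^sup>2) \<le> D"
  shows "(norm (\<Sum>n\<in>N. w n))\<^sup>2 \<le> 2 * (1 + D) * (\<Sum>n\<in>N. (norm (w n))\<^sup>2)"
    and "D \<le> 1 / 16 \<Longrightarrow> (\<Sum>n\<in>N. (norm (w n))\<^sup>2) \<le> 4 * (norm (\<Sum>n\<in>N. w n))\<^sup>2"
proof -
  define s where "s = (\<Sum>n\<in>N. (norm (w n))\<^sup>2)"
  have s: "s \<ge> 0" by (simp add: s_def sum_nonneg)
  define p where "p = (\<Sum>n\<in>N. proj n (w n))"
  define q where "q = (\<Sum>n\<in>N. w n - proj n (w n))"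
  have pq: "(\<Sum>n\<in>N. w n) = p + q" by (simp add: p_def q_def sum.distrib[symmetric])
  have orth: "cinner (proj m x) (proj n y) = 0" if "m \<noteq> n" for m n x y
  proof -
    have "cinner (proj m x) (proj n y) = (\<Sum>j\<in>{j. \<omega> j = m}. cnj (cinner (e j) x) * cinner (e j) (proj n y))"
      unfolding proj_def[of m] by (simp add: cinner_sum_left cinner_scaleC_left)
    also have "\<dots> = 0" using that by (intro sum.neutral) (auto simp: cinner_proj)
    finally show ?thesis .
  qed
  have np: "(norm p)\<^sup>2 = (\<Sum>n\<in>N. (norm (proj n (w n)))\<^sup>2)"
    unfolding p_def by (intro norm_sum_orthogonal_family N orth)
  have pw: "norm (proj n h) \<le> norm h" for n h
  proof (rule power2_le_imp_le)
    show "(norm (proj n h))\<^sup>2 \<le> (norm h)\<^sup>2"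
      unfolding norm_proj using onb_cinner[OF onb] fin_fibre by (intro bessel) auto
  qed simp
  have "norm q \<le> (\<Sum>n\<in>N. C / (real n + 1) * norm (w n))"
    unfolding q_def using w rem by (intro sum_norm_le) auto
  then have "(norm q)\<^sup>2 \<le> (\<Sum>n\<in>N. C / (real n + 1) * norm (w n))\<^sup>2"
    by (intro power_mono) auto
  also have "\<dots> \<le> (\<Sum>n\<in>N. (C / (real n + 1))\<^sup>2) * s"
    unfolding s_def by (rule Cauchy_Schwarz_ineq_sum)
  also have "\<dots> \<le> D * s" using D s by (intro mult_right_mono)
  finally have nq: "(norm q)\<^sup>2 \<le> D * s" .
  have "(norm p)\<^sup>2 \<le> s"
    unfolding np s_def by (intro sum_mono power_mono pw) auto
  moreover have "(norm (p + q))\<^sup>2 \<le> 2 * (norm p)\<^sup>2 + 2 * (norm q)\<^sup>2"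
    by (rule order_trans[OF power_mono[OF norm_triangle_ineq norm_ge_zero] square_add_le])
  ultimately show "(norm (\<Sum>n\<in>N. w n))\<^sup>2 \<le> 2 * (1 + D) * (\<Sum>n\<in>N. (norm (w n))\<^sup>2)"
    unfolding pq s_def[symmetric] using nq by (simp add: algebra_simps)
  assume D16: "D \<le> 1 / 16"
  have "(3 / 4)\<^sup>2 * s \<le> (norm p)\<^sup>2"
    unfolding np s_def sum_distrib_left
  proof (intro sum_mono)
    fix n assume n: "n \<in> N"
    \<comment> \<open>A single term is below the whole sum, so each cluster vector keeps 3/4 of its
      norm under the projection.\<close>
    have "(C / (real n + 1))\<^sup>2 \<le> (\<Sum>n\<in>N. (C / (real n + 1))\<^sup>2)"
      by (intro member_le_sum n N) auto
    also have "\<dots> \<le> 1 / 16" using D D16 by linarith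
    also have "(1 / 16 :: real) = (1 / 4)\<^sup>2" by (simp add: power2_eq_square)
    finally have "(C / (real n + 1))\<^sup>2 \<le> (1 / 4)\<^sup>2" .
    then have "C / (real n + 1) \<le> 1 / 4" by (rule power2_le_imp_le) simp
    then have "C / (real n + 1) * norm (w n) \<le> 1 / 4 * norm (w n)" by (intro mult_right_mono) auto
    then have "norm (w n - proj n (w n)) \<le> 1 / 4 * norm (w n)" using rem[OF w[OF n]] by linarith
    then have "3 / 4 * norm (w n) \<le> norm (proj n (w n))"
      using norm_triangle_ineq[of "w n - proj n (w n)" "proj n (w n)"] by simp
    then have "(3 / 4 * norm (w n))\<^sup>2 \<le> (norm (proj n (w n)))\<^sup>2" by (intro power_mono) auto
    then show "(3 / 4)\<^sup>2 * (norm (w n))\<^sup>2 \<le> (norm (proj n (w n)))\<^sup>2" by (simp only: power_mult_distrib)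
  qed
  then have "sqrt ((3 / 4)\<^sup>2 * s) \<le> norm p" by (intro real_le_lsqrt) auto
  then have p: "3 / 4 * sqrt s \<le> norm p" by (simp add: real_sqrt_mult)
  have "D * s \<le> (1 / 4)\<^sup>2 * s" using D16 s by (intro mult_right_mono) (auto simp: power2_eq_square)
  then have "norm q \<le> sqrt ((1 / 4)\<^sup>2 * s)" using nq by (intro real_le_rsqrt) linarith
  then have q: "norm q \<le> 1 / 4 * sqrt s" by (simp add: real_sqrt_mult)
  have "norm p \<le> norm (p + q) + norm q"
    using norm_triangle_ineq4[of "p + q" q] by simp
  then have "sqrt s \<le> 2 * norm (p + q)" using p q by linarith
  then have "(sqrt s)\<^sup>2 \<le> (2 * norm (p + q))\<^sup>2" using s by (intro power_mono) auto
  then show "(\<Sum>n\<in>N. (norm (w n))\<^sup>2) \<le> 4 * (norm (\<Sum>n\<in>N. w n))\<^sup>2"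
    unfolding pq s_def[symmetric] using s by (simp add: power_mult_distrib)
qed

text \<open>The coefficient bound makes the \<open>g k\<close> independent, so at most
  \<open>M\<close> of them share a cluster. Within a cluster it also controls coefficients by the
  norm of the cluster part; between clusters with large index almost orthogonality takes over; the
  boundedly many vectors in low clusters are bounded directly.\<close>

lemma clustered_system_bounds:
  fixes g :: "nat \<Rightarrow> 'a" and \<nu> :: "nat \<Rightarrow> nat"
  assumes T: "\<And>n. finite (T n)" "\<And>n. real (card (T n)) \<le> M"
    and g: "\<And>k. norm (g k) = 1" "\<And>k. g k \<in> cspace.span (T (\<nu> k))"
    and coeff: "\<And>F a j. finite F \<Longrightarrow> j \<in> F \<Longrightarrow> cmod (a j) \<le> C' * norm (\<Sum>k\<in>F. a k *\<^sub>C g k)"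
  obtains K where "K \<ge> 0"
    "\<And>F a. finite F \<Longrightarrow> (norm (\<Sum>k\<in>F. a k *\<^sub>C g k))\<^sup>2 \<le> K * (\<Sum>k\<in>F. (cmod (a k))\<^sup>2)"
    "\<And>F a. finite F \<Longrightarrow> (\<Sum>k\<in>F. (cmod (a k))\<^sup>2) \<le> K * (norm (\<Sum>k\<in>F. a k *\<^sub>C g k))\<^sup>2"
proof -
  have M: "M \<ge> 0" using T(2)[of 0] by simp
  have C': "C' \<ge> 0" using coeff[of "{0}" 0 "\<lambda>_. 1"] g(1)[of 0] by simp
  have card: "real (card G) \<le> M" if "finite G" "\<And>k. k \<in> G \<Longrightarrow> \<nu> k = n" for G n
  proof -
    \<comment> \<open>Equal vectors at different indices, with coefficients 1 and -1, would violate
      the coefficient bound.\<close>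
    have inj: "inj_on g G"
    proof (rule inj_onI, rule ccontr)
      fix i j assume ij: "i \<in> G" "j \<in> G" "g i = g j" "i \<noteq> j"
      have "cmod 1 \<le> C' * norm (\<Sum>k\<in>{i, j}. (if k = i then 1 else -1 :: complex) *\<^sub>C g k)"
        using coeff[of "{i, j}" i "\<lambda>k. if k = i then 1 else -1"] by simp
      then show False using ij by (simp add: scaleC_minus1)
    qed
    have "\<not> cspace.dependent (g ` G)"
    proof
      assume "cspace.dependent (g ` G)"
      then obtain u v where u: "v \<in> g ` G" "u v \<noteq> 0" "(\<Sum>v\<in>g ` G. u v *\<^sub>C v) = 0"
        using cspace.dependent_finite[OF finite_imageI[OF \<open>finite G\<close>], of g] by blast
      then obtain j where j: "j \<in> G" "v = g j" by blast
      have "(\<Sum>k\<in>G. u (g k) *\<^sub>C g k) = 0" using u(3) inj by (simp add: sum.reindex)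
      then show False using coeff[of G j "\<lambda>k. u (g k)"] that(1) j u(2) by simp
    qed
    moreover have "g ` G \<subseteq> cspace.span (T n)" using g(2) that(2) by force
    ultimately have "card (g ` G) \<le> card (T n)"
      using cspace.independent_span_bound[OF T(1)] by blast
    then have "real (card G) \<le> real (card (T n))" using inj by (simp add: card_image)
    then show ?thesis using T(2)[of n] by linarith
  qed
  define clus where "clus F n = {k\<in>F. \<nu> k = n}" for F n
  have clus_fin: "finite F \<Longrightarrow> finite (clus F n)" for F n by (simp add: clus_def)
  have clus_card: "finite F \<Longrightarrow> real (card (clus F n)) \<le> M" for F n
    by (rule card) (auto simp: clus_def)
  note split = sum.image_gen[where g=\<nu>, folded clus_def]
  have in_span: "(\<Sum>k\<in>clus F n. a k *\<^sub>C g k) \<in> cspace.span (T n)" for F n a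
    using g(2) by (intro cspace.span_sum cspace.span_scale) (auto simp: clus_def)
  define D where "D = (\<Sum>n. (C / (real n + 1))\<^sup>2)"
  have D0: "D \<ge> 0" unfolding D_def by (intro suminf_nonneg summable_inverse_Suc_square) auto
  have D: "(\<Sum>n\<in>N. (C / (real n + 1))\<^sup>2) \<le> D" if "finite N" for N
    unfolding D_def by (intro sum_le_suminf summable_inverse_Suc_square that) auto
  have pos: "(0::real) < 1 / 16" by simp
  obtain N0 where N0: "\<And>N. finite N \<Longrightarrow> (\<And>n. n \<in> N \<Longrightarrow> n \<ge> N0) \<Longrightarrow> (\<Sum>n\<in>N. (C / (real n + 1))\<^sup>2) \<le> 1 / 16"
    by (rule summable_tail_sums_less[OF summable_inverse_Suc_square[of C] zero_le_power2 pos]) blast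
  define Q where "Q = real N0 * M"
  have Q: "Q \<ge> 0" using M by (simp add: Q_def)
  define K1 where "K1 = 2 * (1 + D) * M"
  \<comment> \<open>The first summand serves the at most \<open>Q\<close> indices in clusters below
    \<open>N0\<close>. In the second, \<open>1 + Q * C'\<close> is the cost of removing those
    indices from the sum, 4 that of separating clusters and \<open>M * C'^2\<close> that of
    separating coefficients inside one.\<close>
  define K2 where "K2 = Q * C'\<^sup>2 + M * C'\<^sup>2 * (4 * (1 + Q * C')\<^sup>2)"
  have K: "K1 \<ge> 0" "K2 \<ge> 0" using D0 M Q C' by (simp_all add: K1_def K2_def)
  have upper: "(norm (\<Sum>k\<in>F. a k *\<^sub>C g k))\<^sup>2 \<le> K1 * (\<Sum>k\<in>F. (cmod (a k))\<^sup>2)" if F: "finite F" for F a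
  proof -
    have "(norm (\<Sum>k\<in>F. a k *\<^sub>C g k))\<^sup>2 \<le> 2 * (1 + D) * (\<Sum>n\<in>\<nu> ` F. (norm (\<Sum>k\<in>clus F n. a k *\<^sub>C g k))\<^sup>2)"
      unfolding split[OF F] using F in_span D by (intro cluster_sum_bounds(1)) auto
    also have "\<dots> \<le> 2 * (1 + D) * (\<Sum>n\<in>\<nu> ` F. M * (\<Sum>k\<in>clus F n. (cmod (a k))\<^sup>2))"
    proof (intro mult_left_mono sum_mono)
      fix n
      have "norm (\<Sum>k\<in>clus F n. a k *\<^sub>C g k) \<le> (\<Sum>k\<in>clus F n. cmod (a k))"
        by (intro sum_norm_le) (simp add: norm_scaleC g(1))
      then have "(norm (\<Sum>k\<in>clus F n. a k *\<^sub>C g k))\<^sup>2 \<le> (\<Sum>k\<in>clus F n. cmod (a k))\<^sup>2"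
        by (intro power_mono) auto
      also have "\<dots> \<le> (\<Sum>k\<in>clus F n. (cmod (a k))\<^sup>2) * real (card (clus F n))"
        by (rule sum_squared_le_sum_of_squares)
      also have "\<dots> \<le> (\<Sum>k\<in>clus F n. (cmod (a k))\<^sup>2) * M"
        by (intro mult_left_mono clus_card F sum_nonneg) auto
      finally show "(norm (\<Sum>k\<in>clus F n. a k *\<^sub>C g k))\<^sup>2 \<le> M * (\<Sum>k\<in>clus F n. (cmod (a k))\<^sup>2)"
        by (simp add: mult.commute)
    qed (use D0 in simp)
    also have "\<dots> = K1 * (\<Sum>k\<in>F. (cmod (a k))\<^sup>2)"
      unfolding split[OF F] by (simp add: K1_def sum_distrib_left mult.assoc)
    finally show ?thesis .
  qed
  have lower: "(\<Sum>k\<in>F. (cmod (a k))\<^sup>2) \<le> K2 * (norm (\<Sum>k\<in>F. a k *\<^sub>C g k))\<^sup>2" if F: "finite F" for F a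
  proof -
    define w where "w = (\<Sum>k\<in>F. a k *\<^sub>C g k)"
    define F0 where "F0 = {k\<in>F. \<nu> k < N0}"
    define F1 where "F1 = {k\<in>F. \<not> \<nu> k < N0}"
    have F01: "finite F0" "finite F1" "F = F0 \<union> F1" "F0 \<inter> F1 = {}" using F by (auto simp: F0_def F1_def)
    have a: "cmod (a k) \<le> C' * norm w" if "k \<in> F" for k
      unfolding w_def by (rule coeff[OF F that])
    have cF0: "real (card F0) \<le> Q"
    proof -
      have "real (card F0) = (\<Sum>n\<in>\<nu> ` F0. real (card (clus F0 n)))"
        using split[OF F01(1), of "\<lambda>_. 1::real"] by simp
      also have "\<dots> \<le> (\<Sum>n\<in>\<nu> ` F0. M)" by (intro sum_mono clus_card F01)
      also have "\<dots> = real (card (\<nu> ` F0)) * M" by simp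
      also have "\<dots> \<le> Q"
        unfolding Q_def using M card_mono[of "{..<N0}" "\<nu> ` F0"] by (intro mult_right_mono) (auto simp: F0_def)
      finally show ?thesis .
    qed
    have a0: "(\<Sum>k\<in>F0. (cmod (a k))\<^sup>2) \<le> Q * C'\<^sup>2 * (norm w)\<^sup>2"
    proof -
      have "(\<Sum>k\<in>F0. (cmod (a k))\<^sup>2) \<le> (\<Sum>k\<in>F0. (C' * norm w)\<^sup>2)"
        using a by (intro sum_mono power_mono) (auto simp: F0_def)
      also have "\<dots> = real (card F0) * (C' * norm w)\<^sup>2" by simp
      also have "\<dots> \<le> Q * (C' * norm w)\<^sup>2" by (intro mult_right_mono cF0) auto
      finally show ?thesis by (simp add: power_mult_distrib)
    qed
    have n0: "norm (\<Sum>k\<in>F0. a k *\<^sub>C g k) \<le> Q * C' * norm w"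
    proof -
      have "norm (\<Sum>k\<in>F0. a k *\<^sub>C g k) \<le> (\<Sum>k\<in>F0. C' * norm w)"
        using a by (intro sum_norm_le) (auto simp: F0_def norm_scaleC g(1))
      also have "\<dots> = real (card F0) * (C' * norm w)" by simp
      also have "\<dots> \<le> Q * (C' * norm w)" using C' by (intro mult_right_mono cF0) auto
      finally show ?thesis by simp
    qed
    define w1 where "w1 = (\<Sum>k\<in>F1. a k *\<^sub>C g k)"
    have "w1 = w - (\<Sum>k\<in>F0. a k *\<^sub>C g k)"
      unfolding w1_def w_def F01(3) using F01 by (simp add: sum.union_disjoint)
    then have "norm w1 \<le> norm w + norm (\<Sum>k\<in>F0. a k *\<^sub>C g k)"
      using norm_triangle_ineq4 by metis
    then have w1: "norm w1 \<le> (1 + Q * C') * norm w"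
      using n0 unfolding distrib_right by linarith
    have "(\<Sum>n\<in>\<nu> ` F1. (norm (\<Sum>k\<in>clus F1 n. a k *\<^sub>C g k))\<^sup>2) \<le> 4 * (norm w1)\<^sup>2"
    proof -
      have eq: "w1 = (\<Sum>n\<in>\<nu> ` F1. \<Sum>k\<in>clus F1 n. a k *\<^sub>C g k)"
        unfolding w1_def by (rule split[OF F01(2)])
      have small: "(\<Sum>n\<in>\<nu> ` F1. (C / (real n + 1))\<^sup>2) \<le> 1 / 16"
        by (rule N0) (use F01(2) in \<open>auto simp: F1_def not_less\<close>)
      show ?thesis
        unfolding eq by (rule cluster_sum_bounds(2)[OF finite_imageI[OF F01(2)] in_span small order_refl])
    qed
    also have "\<dots> \<le> 4 * ((1 + Q * C') * norm w)\<^sup>2" using w1 by (intro mult_left_mono power_mono) auto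
    finally have s1: "(\<Sum>n\<in>\<nu> ` F1. (norm (\<Sum>k\<in>clus F1 n. a k *\<^sub>C g k))\<^sup>2) \<le> 4 * (1 + Q * C')\<^sup>2 * (norm w)\<^sup>2"
      by (simp add: power_mult_distrib)
    have "(\<Sum>k\<in>F1. (cmod (a k))\<^sup>2) = (\<Sum>n\<in>\<nu> ` F1. \<Sum>k\<in>clus F1 n. (cmod (a k))\<^sup>2)"
      by (rule split[OF F01(2)])
    also have "\<dots> \<le> (\<Sum>n\<in>\<nu> ` F1. M * C'\<^sup>2 * (norm (\<Sum>k\<in>clus F1 n. a k *\<^sub>C g k))\<^sup>2)"
    proof (intro sum_mono)
      fix n
      let ?v = "\<Sum>k\<in>clus F1 n. a k *\<^sub>C g k"
      \<comment> \<open>The coefficient bound is applied to the cluster part alone, so that the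
        right-hand side is the norm of that part.\<close>
      have "(\<Sum>k\<in>clus F1 n. (cmod (a k))\<^sup>2) \<le> (\<Sum>k\<in>clus F1 n. (C' * norm ?v)\<^sup>2)"
        using F01(2) by (intro sum_mono power_mono coeff clus_fin) auto
      also have "\<dots> = real (card (clus F1 n)) * (C' * norm ?v)\<^sup>2" by simp
      also have "\<dots> \<le> M * (C' * norm ?v)\<^sup>2" by (intro mult_right_mono clus_card F01) auto
      finally show "(\<Sum>k\<in>clus F1 n. (cmod (a k))\<^sup>2) \<le> M * C'\<^sup>2 * (norm ?v)\<^sup>2"
        by (simp add: power_mult_distrib)
    qed
    also have "\<dots> = M * C'\<^sup>2 * (\<Sum>n\<in>\<nu> ` F1. (norm (\<Sum>k\<in>clus F1 n. a k *\<^sub>C g k))\<^sup>2)"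
      by (simp add: sum_distrib_left)
    also have "\<dots> \<le> M * C'\<^sup>2 * (4 * (1 + Q * C')\<^sup>2 * (norm w)\<^sup>2)"
      using M by (intro mult_left_mono s1) auto
    finally have "(\<Sum>k\<in>F1. (cmod (a k))\<^sup>2) \<le> M * C'\<^sup>2 * (4 * (1 + Q * C')\<^sup>2 * (norm w)\<^sup>2)" .
    moreover have "(\<Sum>k\<in>F. (cmod (a k))\<^sup>2) = (\<Sum>k\<in>F0. (cmod (a k))\<^sup>2) + (\<Sum>k\<in>F1. (cmod (a k))\<^sup>2)"
      unfolding F01(3) using F01 by (simp add: sum.union_disjoint)
    ultimately have "(\<Sum>k\<in>F. (cmod (a k))\<^sup>2) \<le> Q * C'\<^sup>2 * (norm w)\<^sup>2 + M * C'\<^sup>2 * (4 * (1 + Q * C')\<^sup>2 * (norm w)\<^sup>2)"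
      using a0 by linarith
    then show ?thesis unfolding w_def[symmetric] K2_def by (simp add: algebra_simps)
  qed
  show ?thesis
  proof (rule that[of "K1 + K2"])
    show "K1 + K2 \<ge> 0" using K by simp
    fix F :: "nat set" and a :: "nat \<Rightarrow> complex" assume F: "finite F"
    show "(norm (\<Sum>k\<in>F. a k *\<^sub>C g k))\<^sup>2 \<le> (K1 + K2) * (\<Sum>k\<in>F. (cmod (a k))\<^sup>2)"
      by (rule order_trans[OF upper[OF F]]) (use K in \<open>auto intro!: mult_right_mono sum_nonneg\<close>)
    show "(\<Sum>k\<in>F. (cmod (a k))\<^sup>2) \<le> (K1 + K2) * (norm (\<Sum>k\<in>F. a k *\<^sub>C g k))\<^sup>2"
      by (rule order_trans[OF lower[OF F]]) (use K in \<open>auto intro!: mult_right_mono\<close>)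
  qed
qed

end

end

lemma relpow_mono:
  fixes R S :: "('a \<times> 'a) set"
  shows "R \<subseteq> S \<Longrightarrow> R ^^ m \<subseteq> S ^^ m"
  by (induction m) (simp_all add: relcomp_mono)

text \<open>Every \<open>f k\<close> lies in the cluster of a square near its eigenvalue.
  Normalizing turns the bound on the terms of an expansion into one on its coefficients.
  \<open>e0\<close> supplies the orthonormal basis indexed by \<open>nat\<close> that
  \<open>riesz_basis\<close> asks for, while \<open>e\<close> may be indexed by the
  integers.\<close>

theorem riesz_basis_of_root_vectors:
  fixes e :: "'i \<Rightarrow> 'a::{complex_inner, banach}"
  assumes pd: "perturbed_diagonal e \<omega> b B" and e0: "onb (e0 :: nat \<Rightarrow> 'a)"
    and f: "schauder_basis f" "range f \<subseteq> root_vectors A" and A: "A \<subseteq> perturbed_diagonal.op e \<omega> b"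
  shows "riesz_basis (\<lambda>k. complex_of_real (1 / norm (f k)) *\<^sub>C f k)"
proof -
  interpret perturbed_diagonal e \<omega> b B by (rule pd)
  obtain C T where C: "C \<ge> 0" and T: "\<And>n. finite (T n)" "\<And>n. real (card (T n)) \<le> max_flag"
    and root: "\<And>n \<mu> f m. cmod ((of_nat n)\<^sup>2 - \<mu>) < L \<Longrightarrow> (f, 0) \<in> shift_op op \<mu> ^^ m \<Longrightarrow> f \<in> cspace.span (T n)"
    and rem: "\<And>n w. w \<in> cspace.span (T n) \<Longrightarrow> norm (w - proj n w) \<le> C / (real n + 1) * norm w"
    by (rule root_vector_clusters) blast
  have "\<exists>n. f k \<in> cspace.span (T n)" for k
  proof -
    obtain \<mu> m where \<mu>: "eigenvalue A \<mu>" "(f k, 0) \<in> shift_op A \<mu> ^^ m"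
    proof -
      have "f k \<in> root_vectors A" using f(2) by auto
      then show ?thesis using that unfolding root_vectors_def by blast
    qed
    obtain h where h: "h \<noteq> 0" "(h, \<mu> *\<^sub>C h) \<in> A" using \<mu>(1) by (auto simp: eigenvalue_def)
    obtain n where n: "cmod ((of_nat n)\<^sup>2 - \<mu>) < L" using eigenvalue_near_square[of h \<mu>] h A by blast
    have "shift_op A \<mu> \<subseteq> shift_op op \<mu>" using A by (auto simp: shift_op_def)
    then show ?thesis using root[OF n] \<mu>(2) relpow_mono by blast
  qed
  then obtain \<nu> where \<nu>: "\<And>k. f k \<in> cspace.span (T (\<nu> k))" by metis
  define s where "s k = complex_of_real (1 / norm (f k))" for k
  define g where "g k = s k *\<^sub>C f k" for k
  have nz: "norm (f k) \<noteq> 0" for k using schauder_basis_nonzero[OF f(1)] by simp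
  have s: "cmod (s k) * norm (f k) = 1" "s k \<noteq> 0" for k
    using nz[of k] by (simp_all add: s_def norm_divide)
  have g1: "norm (g k) = 1" for k using s by (simp add: g_def norm_scaleC)
  have gT: "g k \<in> cspace.span (T (\<nu> k))" for k unfolding g_def by (intro cspace.span_scale \<nu>)
  obtain C' where C': "\<And>F a j. finite F \<Longrightarrow> j \<in> F \<Longrightarrow> cmod (a j) * norm (f j) \<le> C' * norm (\<Sum>k\<in>F. a k *\<^sub>C f k)"
    using schauder_coeff_bounded[OF f(1)] by metis
  have coeff: "cmod (a j) \<le> C' * norm (\<Sum>k\<in>F. a k *\<^sub>C g k)" if "finite F" "j \<in> F" for F a j
    using C'[OF that, of "\<lambda>k. a k * s k"] s(1)[of j] by (simp add: g_def norm_mult mult.assoc)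
  obtain K where K: "K \<ge> 0"
    "\<And>F a. finite F \<Longrightarrow> (norm (\<Sum>k\<in>F. a k *\<^sub>C g k))\<^sup>2 \<le> K * (\<Sum>k\<in>F. (cmod (a k))\<^sup>2)"
    "\<And>F a. finite F \<Longrightarrow> (\<Sum>k\<in>F. (cmod (a k))\<^sup>2) \<le> K * (norm (\<Sum>k\<in>F. a k *\<^sub>C g k))\<^sup>2"
    by (rule clustered_system_bounds[where C=C and T=T and g=g and \<nu>=\<nu> and C'=C' and M=max_flag,
          OF C rem T g1 gT coeff]) blast+
  have "range f \<subseteq> cspace.span (range g)"
  proof
    fix x assume "x \<in> range f"
    then obtain k where "x = f k" by blast
    then have "x = (1 / s k) *\<^sub>C g k" using s(2)[of k] by (simp add: g_def)
    then show "x \<in> cspace.span (range g)" by (simp add: cspace.span_scale cspace.span_base)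
  qed
  then have "cspace.span (range f) \<subseteq> cspace.span (range g)"
    using cspace.span_mono[of "range f" "cspace.span (range g)"] by (simp add: cspace.span_span)
  then have "closure (cspace.span (range g)) = UNIV"
    using schauder_basis_closure_span[OF f(1)] closure_mono by blast
  then have "riesz_basis g" by (rule riesz_basis_if_bounds[OF e0 _ K])
  then show ?thesis unfolding g_def s_def .
qed

section \<open>Absolutely continuous functions\<close>

text \<open>\<open>integrable_ccontinuous_explicit\<close> concerns averages over intervals to the
  right of \<open>x\<close>. Applied to the reflected function \<open>g'\<close> it yields the
  left-hand averages, at the price of the reflected exceptional set.\<close>

theorem lebesgue_differentiation:
  fixes f :: "real \<Rightarrow> 'b::euclidean_space"
  assumes f: "integrable (lebesgue_on {a..b}) f"
  shows "AE x in lebesgue_on {a..b}. ((\<lambda>t. integral {a..t} f) has_vector_derivative f x) (at x within {a..b})"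
proof -
  define g where "g x = (if x \<in> {a..b} then f x else 0)" for x
  have gU: "integrable lebesgue g"
    unfolding g_def using f by (subst Lebesgue_Measure.integrable_restrict_UNIV) auto
  then have gabs: "g absolutely_integrable_on UNIV"
    by (simp add: set_integrable_def)
  have gint: "g integrable_on {c..d}" for c d
    using set_integrable_subset[OF gabs, of "{c..d}"] set_lebesgue_integral_eq_integral(1) by auto
  define g' where "g' x = g (- x)" for x
  have g'int: "g' integrable_on {c..d}" for c d
    using Henstock_Kurzweil_Integration.integrable_reflect_real[where f=g and a="-d" and b="-c"] gint[of "-d" "-c"]
    by (simp add: g'_def[abs_def])
  obtain N where N: "negligible N"
      "\<And>x e. x \<notin> N \<Longrightarrow> 0 < e \<Longrightarrow> \<exists>d>0. \<forall>h. 0 < h \<and> h < d \<longrightarrow> norm (integral (cbox x (x + h *\<^sub>R One)) g /\<^sub>R h ^ DIM(real) - g x) < e"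
    by (rule integrable_ccontinuous_explicit[of g]) (use gint in auto)
  obtain N' where N': "negligible N'"
      "\<And>x e. x \<notin> N' \<Longrightarrow> 0 < e \<Longrightarrow> \<exists>d>0. \<forall>h. 0 < h \<and> h < d \<longrightarrow> norm (integral (cbox x (x + h *\<^sub>R One)) g' /\<^sub>R h ^ DIM(real) - g' x) < e"
    by (rule integrable_ccontinuous_explicit[of g']) (use g'int in auto)
  have deriv: "((\<lambda>t. integral {a..t} f) has_vector_derivative f x) (at x within {a..b})"
    if x: "x \<in> {a..b}" "x \<notin> N" "- x \<notin> N'" for x
    unfolding has_vector_derivative_def has_derivative_within_alt
  proof (intro conjI allI impI)
    show "bounded_linear (\<lambda>h. h *\<^sub>R f x)" by (rule bounded_linear_scaleR_left)
    fix e :: real assume e: "e > 0"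
    obtain d1 where d1: "d1 > 0" "\<And>h. 0 < h \<Longrightarrow> h < d1 \<Longrightarrow> norm (integral {x..x + h} g /\<^sub>R h - g x) < e"
      using N(2)[OF x(2) e] by (auto simp: cbox_interval)
    obtain d2 where d2: "d2 > 0" "\<And>h. 0 < h \<Longrightarrow> h < d2 \<Longrightarrow> norm (integral {- x..- x + h} g' /\<^sub>R h - g' (- x)) < e"
      using N'(2)[OF x(3) e] by (auto simp: cbox_interval)
    have gx: "g x = f x" "g' (- x) = f x" using x by (simp_all add: g_def g'_def)
    have scale: "norm (I - h *\<^sub>R f x) \<le> e * h" if "h > 0" "norm (I /\<^sub>R h - f x) < e" for I h
    proof -
      have "I - h *\<^sub>R f x = h *\<^sub>R (I /\<^sub>R h - f x)" using that by (simp add: scaleR_right_diff_distrib)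
      then have "norm (I - h *\<^sub>R f x) = h * norm (I /\<^sub>R h - f x)" using that by simp
      also have "\<dots> \<le> h * e" using that by (intro mult_left_mono) auto
      finally show ?thesis by (simp add: mult.commute)
    qed
    have gf: "integral {c..d} g = integral {c..d} f" if "{c..d} \<subseteq> {a..b}" for c d
      using that by (intro integral_cong) (auto simp: g_def)
    have fint: "f integrable_on {c..d}" if "{c..d} \<subseteq> {a..b}" for c d
      using gint[of c d] that by (subst integrable_cong[of _ _ g]) (auto simp: g_def)
    show "\<exists>d>0. \<forall>y\<in>{a..b}. norm (y - x) < d \<longrightarrow>
        norm (integral {a..y} f - integral {a..x} f - (y - x) *\<^sub>R f x) \<le> e * norm (y - x)"
    proof (intro exI[of _ "min d1 d2"] conjI ballI impI)
      show "min d1 d2 > 0" using d1 d2 by simp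
      fix y assume y: "y \<in> {a..b}" "norm (y - x) < min d1 d2"
      consider "y = x" | "y > x" | "y < x" by linarith
      then show "norm (integral {a..y} f - integral {a..x} f - (y - x) *\<^sub>R f x) \<le> e * norm (y - x)"
      proof cases
        case 2
        have "integral {a..x} f + integral {x..y} f = integral {a..y} f"
          using x y 2 by (intro Henstock_Kurzweil_Integration.integral_combine fint) auto
        then have eq: "integral {a..y} f - integral {a..x} f = integral {x..x + (y - x)} g"
          using x y gf[of x y] by (simp add: algebra_simps)
        have "norm (integral {x..x + (y - x)} g - (y - x) *\<^sub>R f x) \<le> e * (y - x)"
          using d1(2)[of "y - x"] 2 y(2) by (intro scale) (auto simp: gx)
        then show ?thesis using 2 unfolding eq by simp
      next
        case 3
        have "integral {a..y} f + integral {y..x} f = integral {a..x} f"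
          using x y 3 by (intro Henstock_Kurzweil_Integration.integral_combine fint) auto
        moreover have "integral {- x..- x + (x - y)} g' = integral {y..x} f"
          using x y gf[of y x] Henstock_Kurzweil_Integration.integral_reflect_real[where f=g and a=y and b=x] by (simp add: g'_def[abs_def])
        ultimately have eq: "integral {a..x} f - integral {a..y} f = integral {- x..- x + (x - y)} g'"
          by (simp add: algebra_simps)
        have "norm (integral {- x..- x + (x - y)} g' - (x - y) *\<^sub>R f x) \<le> e * (x - y)"
          using d2(2)[of "x - y"] 3 y(2) by (intro scale) (auto simp: gx)
        moreover have "norm (integral {a..y} f - integral {a..x} f - (y - x) *\<^sub>R f x)
            = norm (integral {a..x} f - integral {a..y} f - (x - y) *\<^sub>R f x)"
          by (subst norm_minus_cancel[symmetric]) (simp add: algebra_simps)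
        ultimately show ?thesis using 3 unfolding eq by simp
      qed simp
    qed
  qed
  have neg: "negligible (N \<union> uminus ` N')"
    using N(1) N'(1)
    by (intro negligible_Un negligible_differentiable_image_negligible) (auto intro!: derivative_intros)
  show ?thesis
  proof (rule AE_I')
    show "(N \<union> uminus ` N') \<inter> {a..b} \<in> null_sets (lebesgue_on {a..b})"
      using neg by (subst null_sets_restrict_space) (auto simp: negligible_iff_null_sets intro: null_set_Int2)
    show "{x \<in> space (lebesgue_on {a..b}). \<not> ((\<lambda>t. integral {a..t} f) has_vector_derivative f x) (at x within {a..b})}
        \<subseteq> (N \<union> uminus ` N') \<inter> {a..b}"
      using deriv by (force simp: image_iff)
  qed
qed

text \<open>The indefinite integral is constantly 0, so its derivative is both 0 and, almost
  everywhere, \<open>f x\<close>.\<close>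

lemma AE_zero_if_integrals_zero:
  fixes f :: "real \<Rightarrow> 'b::euclidean_space"
  assumes "integrable (lebesgue_on {a..b}) f" "a < b" "\<And>t. t \<in> {a..b} \<Longrightarrow> integral {a..t} f = 0"
  shows "AE x in lebesgue_on {a..b}. f x = 0"
proof -
  have "AE x in lebesgue_on {a..b}. x \<in> {a..b}" using AE_space[of "lebesgue_on {a..b}"] by simp
  then show ?thesis
    using lebesgue_differentiation[OF assms(1)]
  proof eventually_elim
    case (elim x)
    have "((\<lambda>t. 0) has_vector_derivative f x) (at x within {a..b})"
      using elim(1) assms(3) by (intro has_vector_derivative_transform[OF _ _ elim(2)]) auto
    moreover have "((\<lambda>t. 0 :: 'b) has_vector_derivative 0) (at x within {a..b})" by simp
    ultimately show ?case
      using vector_derivative_unique_within_closed_interval[of a b x "\<lambda>t. 0" "f x" 0] assms(2) elim(1) by simp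
  qed
qed

section \<open>Families of intervals and total variation\<close>

text \<open>Endpoints are strictly ordered, unlike in \<open>absolutely_continuous_on_Icc\<close>:
  for nondegenerate pairs disjoint interiors force distinctness, so images and unions of families
  can be summed without multiplicities.\<close>

definition parts :: "real \<Rightarrow> real \<Rightarrow> (real \<times> real) set set" where
  "parts a b = {D. finite D \<and> (\<forall>p\<in>D. a \<le> fst p \<and> fst p < snd p \<and> snd p \<le> b) \<and>
     pairwise (\<lambda>p q. {fst p<..<snd p} \<inter> {fst q<..<snd q} = {}) D}"

lemma partsD:
  assumes "D \<in> parts a b"
  shows "finite D" "\<And>p. p \<in> D \<Longrightarrow> a \<le> fst p" "\<And>p. p \<in> D \<Longrightarrow> fst p < snd p" "\<And>p. p \<in> D \<Longrightarrow> snd p \<le> b"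
    "\<And>p q. p \<in> D \<Longrightarrow> q \<in> D \<Longrightarrow> p \<noteq> q \<Longrightarrow> {fst p<..<snd p} \<inter> {fst q<..<snd q} = {}"
  using assms unfolding parts_def pairwise_def by auto

lemma partsI:
  assumes "finite D" "\<And>p. p \<in> D \<Longrightarrow> a \<le> fst p" "\<And>p. p \<in> D \<Longrightarrow> fst p < snd p" "\<And>p. p \<in> D \<Longrightarrow> snd p \<le> b"
    "\<And>p q. p \<in> D \<Longrightarrow> q \<in> D \<Longrightarrow> p \<noteq> q \<Longrightarrow> {fst p<..<snd p} \<inter> {fst q<..<snd q} = {}"
  shows "D \<in> parts a b"
  using assms unfolding parts_def pairwise_def by auto

lemma empty_parts: "{} \<in> parts a b"
  by (simp add: parts_def)

text \<open>Additivity of Lebesgue measure on the disjoint open intervals.\<close>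

lemma sum_length_parts_le:
  assumes "D \<in> parts a b" "a \<le> b"
  shows "(\<Sum>p\<in>D. snd p - fst p) \<le> b - a"
proof -
  note D = partsD[OF assms(1)]
  have le: "fst p \<le> snd p" if "p \<in> D" for p
    using D(3)[OF that] by simp
  have "ennreal (\<Sum>p\<in>D. snd p - fst p) = (\<Sum>p\<in>D. ennreal (snd p - fst p))"
    by (rule sum_ennreal[symmetric]) (simp only: le diff_ge_0_iff_ge)
  also have "\<dots> = (\<Sum>p\<in>D. emeasure lborel {fst p<..<snd p})"
    by (intro sum.cong refl emeasure_lborel_Ioo[symmetric] le)
  also have "\<dots> = emeasure lborel (\<Union>p\<in>D. {fst p<..<snd p})"
    using D by (intro sum_emeasure) (auto simp: disjoint_family_on_def)
  also have "\<dots> \<le> emeasure lborel {a..b}"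
  proof (intro emeasure_mono UN_least)
    fix p assume "p \<in> D"
    then show "{fst p<..<snd p} \<subseteq> {a..b}" using D(2)[of p] D(4)[of p] by auto
  qed simp
  also have "\<dots> = ennreal (b - a)" using assms by simp
  finally show ?thesis using assms by simp
qed

text \<open>Pairs that become degenerate are dropped, which keeps clamping injective on the remaining ones.\<close>

definition clamp_parts :: "real \<Rightarrow> real \<Rightarrow> (real \<times> real) set \<Rightarrow> (real \<times> real) set" where
  "clamp_parts a b D = (\<lambda>p. (max a (min b (fst p)), max a (min b (snd p)))) `
     {p\<in>D. max a (min b (fst p)) < max a (min b (snd p))}"

text \<open>Clamping to two adjacent intervals cuts a family at their common endpoint. A summand
  \<open>h\<close> vanishing on the diagonal does not see the dropped pairs.\<close>

lemma clamp_parts: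
  assumes D: "D \<in> parts c d" and ab: "a \<le> b"
  shows "clamp_parts a b D \<in> parts a b"
    and "(\<And>x. h x x = 0) \<Longrightarrow> (\<Sum>q\<in>clamp_parts a b D. h (fst q) (snd q))
        = (\<Sum>p\<in>D. h (max a (min b (fst p))) (max a (min b (snd p))) :: 'b::comm_monoid_add)"
proof -
  note D' = partsD[OF D]
  let ?\<kappa> = "\<lambda>x. max a (min b x)"
  let ?S = "{p\<in>D. ?\<kappa> (fst p) < ?\<kappa> (snd p)}"
  have sub: "{?\<kappa> (fst p)<..<?\<kappa> (snd p)} \<subseteq> {fst p<..<snd p}" if "p \<in> ?S" for p
    using that by (auto simp: max_def min_def split: if_splits)
  have sep: "{?\<kappa> (fst p)<..<?\<kappa> (snd p)} \<inter> {?\<kappa> (fst q)<..<?\<kappa> (snd q)} = {}" if "p \<in> ?S" "q \<in> ?S" "p \<noteq> q" for p q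
    using sub[OF that(1)] sub[OF that(2)] D'(5)[of p q] that by blast
  have inj: "inj_on (\<lambda>p. (?\<kappa> (fst p), ?\<kappa> (snd p))) ?S"
  proof (rule inj_onI, rule ccontr)
    fix p q assume pq: "p \<in> ?S" "q \<in> ?S" "(?\<kappa> (fst p), ?\<kappa> (snd p)) = (?\<kappa> (fst q), ?\<kappa> (snd q))" "p \<noteq> q"
    then have "{?\<kappa> (fst p)<..<?\<kappa> (snd p)} = {}" using sep[OF pq(1,2,4)] by simp
    then have "?\<kappa> (snd p) \<le> ?\<kappa> (fst p)" by (simp only: greaterThanLessThan_empty_iff)
    moreover have "?\<kappa> (fst p) < ?\<kappa> (snd p)" using pq(1) by blast
    ultimately show False by linarith
  qed
  show "clamp_parts a b D \<in> parts a b"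
  proof (rule partsI)
    show "finite (clamp_parts a b D)" using D'(1) by (simp add: clamp_parts_def)
    fix p assume "p \<in> clamp_parts a b D"
    then show "a \<le> fst p" "fst p < snd p" "snd p \<le> b" using ab by (auto simp: clamp_parts_def)
  next
    fix p q assume pq: "p \<in> clamp_parts a b D" "q \<in> clamp_parts a b D" "p \<noteq> q"
    obtain p' where p': "p' \<in> ?S" "p = (?\<kappa> (fst p'), ?\<kappa> (snd p'))" using pq(1) by (auto simp: clamp_parts_def)
    obtain q' where q': "q' \<in> ?S" "q = (?\<kappa> (fst q'), ?\<kappa> (snd q'))" using pq(2) by (auto simp: clamp_parts_def)
    have "p' \<noteq> q'" using p' q' pq(3) by auto
    then show "{fst p<..<snd p} \<inter> {fst q<..<snd q} = {}"
      unfolding p'(2) q'(2) fst_conv snd_conv by (rule sep[OF p'(1) q'(1)])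
  qed
  assume h: "\<And>x. h x x = 0"
  have "(\<Sum>q\<in>clamp_parts a b D. h (fst q) (snd q)) = (\<Sum>p\<in>?S. h (?\<kappa> (fst p)) (?\<kappa> (snd p)))"
    unfolding clamp_parts_def sum.reindex[OF inj] by (simp only: o_def fst_conv snd_conv)
  also have "\<dots> = (\<Sum>p\<in>D. h (?\<kappa> (fst p)) (?\<kappa> (snd p)))"
  proof (rule sum.mono_neutral_left[OF D'(1)])
    show "\<forall>p\<in>D - ?S. h (?\<kappa> (fst p)) (?\<kappa> (snd p)) = 0"
    proof
      fix p assume p: "p \<in> D - ?S"
      have "?\<kappa> (fst p) \<le> ?\<kappa> (snd p)"
        using D'(3)[of p] p by (intro max.mono min.mono) auto
      moreover have "\<not> ?\<kappa> (fst p) < ?\<kappa> (snd p)" using p by blast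
      ultimately have eq: "?\<kappa> (snd p) = ?\<kappa> (fst p)" by linarith
      show "h (?\<kappa> (fst p)) (?\<kappa> (snd p)) = 0" unfolding eq by (rule h)
    qed
  qed blast
  finally show "(\<Sum>q\<in>clamp_parts a b D. h (fst q) (snd q)) = (\<Sum>p\<in>D. h (?\<kappa> (fst p)) (?\<kappa> (snd p)))" .
qed

text \<open>Lets a family be chosen inside each member of \<open>E\<close> independently, as is done
  for the increments of the variation function.\<close>

lemma Union_parts:
  assumes E: "E \<in> parts a b" and D: "\<And>p. p \<in> E \<Longrightarrow> D p \<in> parts (fst p) (snd p)"
  shows "(\<Union>p\<in>E. D p) \<in> parts a b"
    and "(\<Sum>q\<in>(\<Union>p\<in>E. D p). h q) = (\<Sum>p\<in>E. \<Sum>q\<in>D p. h q :: 'b::comm_monoid_add)"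
proof -
  note E' = partsD[OF E]
  note D' = partsD[OF D]
  have sub: "{fst q<..<snd q} \<subseteq> {fst p<..<snd p}" "{fst q<..<snd q} \<noteq> {}" if "p \<in> E" "q \<in> D p" for p q
    using D'(2-4)[OF that] by (auto simp: greaterThanLessThan_empty_iff not_le)
  have disj: "{fst q<..<snd q} \<inter> {fst q'<..<snd q'} = {}" if "p \<in> E" "p' \<in> E" "p \<noteq> p'" "q \<in> D p" "q' \<in> D p'" for p p' q q'
    using sub(1)[OF that(1,4)] sub(1)[OF that(2,5)] E'(5)[OF that(1-3)] by blast
  show "(\<Union>p\<in>E. D p) \<in> parts a b"
  proof (rule partsI)
    show "finite (\<Union>p\<in>E. D p)" using E'(1) D'(1) by blast
    fix q assume "q \<in> (\<Union>p\<in>E. D p)"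
    then obtain p where p: "p \<in> E" "q \<in> D p" by blast
    show "a \<le> fst q" "fst q < snd q" "snd q \<le> b"
      using D'(2-4)[OF p] E'(2-4)[OF p(1)] by linarith+
  next
    fix q q' assume "q \<in> (\<Union>p\<in>E. D p)" "q' \<in> (\<Union>p\<in>E. D p)" "q \<noteq> q'"
    then obtain p p' where p: "p \<in> E" "q \<in> D p" "p' \<in> E" "q' \<in> D p'" by blast
    show "{fst q<..<snd q} \<inter> {fst q'<..<snd q'} = {}"
      using disj[OF p(1,3) _ p(2,4)] D'(5)[OF p(1)] p \<open>q \<noteq> q'\<close> by (cases "p = p'") auto
  qed
  have "D p \<inter> D p' = {}" if p: "p \<in> E" "p' \<in> E" "p \<noteq> p'" for p p'
  proof (rule ccontr)
    assume "D p \<inter> D p' \<noteq> {}"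
    then obtain q where "q \<in> D p" "q \<in> D p'" by blast
    then show False using disj[OF p] sub(2)[OF p(1)] by blast
  qed
  then show "(\<Sum>q\<in>(\<Union>p\<in>E. D p). h q) = (\<Sum>p\<in>E. \<Sum>q\<in>D p. h q)"
    using E'(1) D'(1) by (intro sum.UNION_disjoint) auto
qed

text \<open>The codomain is general because the notion is applied both to complex functions and to
  the real variation function.\<close>

definition abs_cont :: "real \<Rightarrow> real \<Rightarrow> (real \<Rightarrow> 'b::real_normed_vector) \<Rightarrow> bool" where
  "abs_cont a b f \<longleftrightarrow> (\<forall>\<epsilon>>0. \<exists>\<delta>>0. \<forall>D\<in>parts a b. (\<Sum>p\<in>D. snd p - fst p) < \<delta> \<longrightarrow>
     (\<Sum>p\<in>D. norm (f (snd p) - f (fst p))) < \<epsilon>)"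

lemma abs_contE:
  assumes "abs_cont a b f" "\<epsilon> > 0"
  obtains \<delta> where "\<delta> > 0" "\<And>D. D \<in> parts a b \<Longrightarrow> (\<Sum>p\<in>D. snd p - fst p) < \<delta> \<Longrightarrow>
     (\<Sum>p\<in>D. norm (f (snd p) - f (fst p))) < \<epsilon>"
  using assms unfolding abs_cont_def by blast

text \<open>With values in \<^typ>\<open>ennreal\<close>, so that finiteness can be deduced from subadditivity.\<close>

definition variation :: "(real \<Rightarrow> 'b::real_normed_vector) \<Rightarrow> real \<Rightarrow> real \<Rightarrow> ennreal" where
  "variation f a b = (SUP D\<in>parts a b. ennreal (\<Sum>p\<in>D. norm (f (snd p) - f (fst p))))"

text \<open>Clamped to both sides of \<open>b\<close>, each increment telescopes through
  \<open>f b\<close>, and the two clamped families compete in the two suprema.\<close>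

lemma variation_subadditive:
  assumes "a \<le> b" "b \<le> c"
  shows "variation f a c \<le> variation f a b + variation f b c"
  unfolding variation_def[of f a c]
proof (rule SUP_least)
  fix D assume D: "D \<in> parts a c"
  note D' = partsD[OF D]
  let ?\<kappa> = "\<lambda>a b x. max a (min b x)" and ?h = "\<lambda>x y. norm (f y - f x)"
  have "(\<Sum>p\<in>D. ?h (fst p) (snd p))
      \<le> (\<Sum>p\<in>D. ?h (?\<kappa> a b (fst p)) (?\<kappa> a b (snd p)) + ?h (?\<kappa> b c (fst p)) (?\<kappa> b c (snd p)))"
  proof (intro sum_mono)
    fix p assume "p \<in> D"
    then have p: "a \<le> fst p" "fst p < snd p" "snd p \<le> c" using D' by auto
    then have "f (snd p) - f (fst p) = (f (?\<kappa> a b (snd p)) - f (?\<kappa> a b (fst p))) + (f (?\<kappa> b c (snd p)) - f (?\<kappa> b c (fst p)))"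
      using assms by (auto simp: max_def min_def)
    then show "?h (fst p) (snd p) \<le> ?h (?\<kappa> a b (fst p)) (?\<kappa> a b (snd p)) + ?h (?\<kappa> b c (fst p)) (?\<kappa> b c (snd p))"
      by (metis norm_triangle_ineq)
  qed
  also have "\<dots> = (\<Sum>q\<in>clamp_parts a b D. ?h (fst q) (snd q)) + (\<Sum>q\<in>clamp_parts b c D. ?h (fst q) (snd q))"
    unfolding sum.distrib
    using clamp_parts(2)[OF D assms(1), of ?h] clamp_parts(2)[OF D assms(2), of ?h] by simp
  finally have "ennreal (\<Sum>p\<in>D. ?h (fst p) (snd p))
      \<le> ennreal (\<Sum>q\<in>clamp_parts a b D. ?h (fst q) (snd q)) + ennreal (\<Sum>q\<in>clamp_parts b c D. ?h (fst q) (snd q))"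
    by (subst ennreal_plus[symmetric]) (auto intro: sum_nonneg ennreal_leI)
  also have "\<dots> \<le> variation f a b + variation f b c"
    unfolding variation_def by (intro add_mono SUP_upper clamp_parts(1)[OF D] assms)
  finally show "ennreal (\<Sum>p\<in>D. ?h (fst p) (snd p)) \<le> variation f a b + variation f b c" .
qed

text \<open>Every family on the left of \<open>x\<close> can be enlarged by the pair
  \<open>(x, y)\<close>.\<close>

lemma variation_increment:
  assumes "a \<le> x" "x \<le> y"
  shows "variation f a x + ennreal (norm (f y - f x)) \<le> variation f a y"
proof (cases "x = y")
  case True
  then show ?thesis by simp
next
  case False
  have "variation f a x + ennreal (norm (f y - f x))
      = (SUP D\<in>parts a x. ennreal (\<Sum>p\<in>D. norm (f (snd p) - f (fst p))) + ennreal (norm (f y - f x)))"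
    unfolding variation_def using empty_parts by (intro ennreal_SUP_add_left[symmetric]) auto
  also have "\<dots> \<le> variation f a y"
  proof (rule SUP_least)
    fix D assume D: "D \<in> parts a x"
    note D' = partsD[OF D]
    have new: "(x, y) \<notin> D" using D'(4) False assms by force
    have "insert (x, y) D \<in> parts a y"
    proof (rule partsI)
      fix p q assume pq: "p \<in> insert (x, y) D" "q \<in> insert (x, y) D" "p \<noteq> q"
      have dis: "{fst r<..<snd r} \<inter> {x<..<y} = {}" if "r \<in> D" for r
        using D'(4)[OF that] by auto
      show "{fst p<..<snd p} \<inter> {fst q<..<snd q} = {}"
      proof (cases "p = (x, y)")
        case True
        then show ?thesis using dis[of q] pq by (metis Int_commute fst_conv insertE snd_conv)
      next
        case False
        then show ?thesis using dis[of p] D'(5)[of p q] pq by (metis fst_conv insertE snd_conv)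
      qed
    next
      show "finite (insert (x, y) D)" using D'(1) by simp
      fix p assume "p \<in> insert (x, y) D"
      then consider "p = (x, y)" | "p \<in> D" by blast
      then show "a \<le> fst p" "fst p < snd p" "snd p \<le> y"
        by (cases; use assms False D'(2-4)[of p] in simp)+
    qed
    then have "ennreal (\<Sum>p\<in>insert (x, y) D. norm (f (snd p) - f (fst p))) \<le> variation f a y"
      unfolding variation_def by (rule SUP_upper)
    then show "ennreal (\<Sum>p\<in>D. norm (f (snd p) - f (fst p))) + ennreal (norm (f y - f x)) \<le> variation f a y"
      using D'(1) new by (subst ennreal_plus[symmetric]) (auto intro: sum_nonneg simp: add.commute)
  qed
  finally show ?thesis .
qed

lemma parts_mono: "a \<le> c \<Longrightarrow> d \<le> b \<Longrightarrow> parts c d \<subseteq> parts a b"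
  by (auto intro!: partsI dest: partsD)

text \<open>Absolute continuity with bound 1 gives variation at most 1 on intervals shorter than
  \<open>\<delta>\<close>; finitely many steps of length \<open>\<delta> / 2\<close> reach
  \<open>x\<close>.\<close>

lemma variation_finite:
  assumes f: "abs_cont a b f" and "a \<le> b" "x \<in> {a..b}"
  shows "variation f a x < \<infinity>"
proof -
  obtain \<delta> where \<delta>: "\<delta> > 0" "\<And>D. D \<in> parts a b \<Longrightarrow> (\<Sum>p\<in>D. snd p - fst p) < \<delta> \<Longrightarrow>
      (\<Sum>p\<in>D. norm (f (snd p) - f (fst p))) < 1"
    by (rule abs_contE[OF f zero_less_one]) blast
  have short: "variation f s t \<le> 1" if "a \<le> s" "s \<le> t" "t \<le> b" "t - s < \<delta>" for s t
    unfolding variation_def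
  proof (rule SUP_least)
    fix D assume D: "D \<in> parts s t"
    have "(\<Sum>p\<in>D. norm (f (snd p) - f (fst p))) < 1"
      using sum_length_parts_le[OF D] that parts_mono[of a s t b] D by (intro \<delta>) auto
    then show "ennreal (\<Sum>p\<in>D. norm (f (snd p) - f (fst p))) \<le> 1" by (simp add: ennreal_le_1)
  qed
  have step: "variation f a (min x (a + real n * (\<delta> / 2))) \<le> of_nat n" for n
  proof (induction n)
    case 0
    have "parts a a = {{}}" using empty_parts by (auto simp: parts_def)
    then show ?case using assms by (simp add: variation_def)
  next
    case (Suc n)
    let ?y = "\<lambda>n. min x (a + real n * (\<delta> / 2))"
    have e: "a + real (Suc n) * (\<delta> / 2) = (a + real n * (\<delta> / 2)) + \<delta> / 2"
      by (simp add: field_simps)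
    have "0 \<le> real n * (\<delta> / 2)" using \<delta>(1) by simp
    then have y: "a \<le> ?y n" "?y n \<le> ?y (Suc n)" "?y (Suc n) \<le> b" "?y (Suc n) - ?y n < \<delta>"
      unfolding e using assms(3) \<delta>(1) by (auto simp: min_def simp del: of_nat_Suc)
    have "variation f a (?y (Suc n)) \<le> variation f a (?y n) + variation f (?y n) (?y (Suc n))"
      by (rule variation_subadditive[OF y(1,2)])
    also have "\<dots> \<le> of_nat n + 1" using y by (intro add_mono Suc.IH short) auto
    finally show ?case by (simp add: add.commute)
  qed
  obtain n :: nat where "(x - a) / (\<delta> / 2) \<le> real n" using real_arch_simple by blast
  then have "min x (a + real n * (\<delta> / 2)) = x" using \<delta>(1) by (simp add: field_simps)
  then have "variation f a x \<le> of_nat n" using step[of n] by simp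
  then show ?thesis by (rule le_less_trans) (simp add: ennreal_of_nat_eq_real_of_nat)
qed

text \<open>The increment of \<open>T\<close> over a member of \<open>E\<close> is nearly attained
  by a family inside that member. The union of these families is again admissible and no longer than
  \<open>E\<close>, so the \<open>\<delta>\<close> for \<open>f\<close> serves for
  \<open>T\<close>.\<close>

lemma abs_cont_variation:
  assumes f: "abs_cont a b f" and ab: "a \<le> b"
  defines "T \<equiv> \<lambda>x. enn2real (variation f a x)"
  shows "\<And>x y. a \<le> x \<Longrightarrow> x \<le> y \<Longrightarrow> y \<le> b \<Longrightarrow> norm (f y - f x) \<le> T y - T x"
    and "abs_cont a b T"
proof -
  have T: "ennreal (T x) = variation f a x" if "x \<in> {a..b}" for x
    unfolding T_def using variation_finite[OF f ab that] by simp
  have T0: "T x \<ge> 0" for x by (simp add: T_def)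
  show incr: "norm (f y - f x) \<le> T y - T x" if "a \<le> x" "x \<le> y" "y \<le> b" for x y
  proof -
    have "ennreal (T x) + ennreal (norm (f y - f x)) \<le> ennreal (T y)"
    proof -
      have "x \<in> {a..b}" "y \<in> {a..b}" using that by auto
      from T[OF this(1)] T[OF this(2)] show ?thesis
        using variation_increment[OF that(1,2), of f] by simp
    qed
    then have "ennreal (T x + norm (f y - f x)) \<le> ennreal (T y)" using T0 by (simp add: ennreal_plus)
    then show ?thesis using T0[of y] by simp
  qed
  show "abs_cont a b T"
    unfolding abs_cont_def
  proof (intro allI impI)
    fix \<epsilon> :: real assume \<epsilon>: "\<epsilon> > 0"
    then have "\<epsilon> / 2 > 0" by simp
    then obtain \<delta> where \<delta>: "\<delta> > 0" "\<And>D. D \<in> parts a b \<Longrightarrow> (\<Sum>p\<in>D. snd p - fst p) < \<delta> \<Longrightarrow>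
        (\<Sum>p\<in>D. norm (f (snd p) - f (fst p))) < \<epsilon> / 2"
      by (rule abs_contE[OF f]) blast
    have "(\<Sum>p\<in>E. norm (T (snd p) - T (fst p))) < \<epsilon>" if E: "E \<in> parts a b" "(\<Sum>p\<in>E. snd p - fst p) < \<delta>" for E
    proof -
      note E' = partsD[OF E(1)]
      \<comment> \<open>An error of \<open>\<eta>\<close> per member of \<open>E\<close> adds up to
        less than \<open>\<epsilon> / 2\<close>; the added 1 covers empty \<open>E\<close>.\<close>
      define \<eta> where "\<eta> = \<epsilon> / (2 * (real (card E) + 1))"
      have \<eta>: "\<eta> > 0" "real (card E) * \<eta> < \<epsilon> / 2"
        using \<epsilon> by (auto simp: \<eta>_def field_simps)
      have "\<exists>D. D \<in> parts (fst p) (snd p) \<and> T (snd p) - T (fst p) \<le> (\<Sum>q\<in>D. norm (f (snd q) - f (fst q))) + \<eta>"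
        if p: "p \<in> E" for p
      proof (rule ccontr)
        assume H: "\<nexists>D. D \<in> parts (fst p) (snd p) \<and> T (snd p) - T (fst p) \<le> (\<Sum>q\<in>D. norm (f (snd q) - f (fst q))) + \<eta>"
        have pE: "a \<le> fst p" "fst p < snd p" "snd p \<le> b" using E'(2-4)[OF p] by auto
        have nn: "T (snd p) - T (fst p) - \<eta> \<ge> 0"
        proof (rule ccontr)
          assume "\<not> T (snd p) - T (fst p) - \<eta> \<ge> 0"
          then have "T (snd p) - T (fst p) \<le> (\<Sum>q\<in>{}. norm (f (snd q) - f (fst q))) + \<eta>" by simp
          then show False using H empty_parts by blast
        qed
        have "variation f (fst p) (snd p) \<le> ennreal (T (snd p) - T (fst p) - \<eta>)"
          unfolding variation_def using H by (intro SUP_least ennreal_leI) force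
        moreover have "variation f a (snd p) \<le> variation f a (fst p) + variation f (fst p) (snd p)"
          using pE by (intro variation_subadditive) auto
        ultimately have "ennreal (T (snd p)) \<le> ennreal (T (fst p)) + ennreal (T (snd p) - T (fst p) - \<eta>)"
          using T[of "fst p"] T[of "snd p"] pE by (simp add: add_left_mono order_trans)
        then have "ennreal (T (snd p)) \<le> ennreal (T (snd p) - \<eta>)"
          using nn T0 by (subst (asm) ennreal_plus[symmetric]) auto
        then show False using \<eta>(1) nn T0[of "fst p"] T0[of "snd p"] by (simp add: ennreal_le_iff2)
      qed
      then have "\<forall>p\<in>E. \<exists>D. D \<in> parts (fst p) (snd p) \<and> T (snd p) - T (fst p) \<le> (\<Sum>q\<in>D. norm (f (snd q) - f (fst q))) + \<eta>"
        by blast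
      then obtain D where D: "\<And>p. p \<in> E \<Longrightarrow> D p \<in> parts (fst p) (snd p)"
          "\<And>p. p \<in> E \<Longrightarrow> T (snd p) - T (fst p) \<le> (\<Sum>q\<in>D p. norm (f (snd q) - f (fst q))) + \<eta>"
        unfolding bchoice_iff by blast
      have U: "(\<Union>p\<in>E. D p) \<in> parts a b"
        by (rule Union_parts(1)[OF E(1)]) (rule D(1))
      have U_sum: "(\<Sum>q\<in>(\<Union>p\<in>E. D p). h q) = (\<Sum>p\<in>E. \<Sum>q\<in>D p. h q)" for h :: "real \<times> real \<Rightarrow> real"
        by (rule Union_parts(2)[OF E(1)]) (rule D(1))
      have "(\<Sum>p\<in>E. \<Sum>q\<in>D p. snd q - fst q) \<le> (\<Sum>p\<in>E. snd p - fst p)"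
      proof (intro sum_mono)
        fix p assume p: "p \<in> E"
        show "(\<Sum>q\<in>D p. snd q - fst q) \<le> snd p - fst p"
          using sum_length_parts_le[OF D(1)[OF p]] E'(3)[OF p] by simp
      qed
      then have "(\<Sum>q\<in>(\<Union>p\<in>E. D p). snd q - fst q) < \<delta>"
        unfolding U_sum[of "\<lambda>q. snd q - fst q"] using E(2) by simp
      then have "(\<Sum>q\<in>(\<Union>p\<in>E. D p). norm (f (snd q) - f (fst q))) < \<epsilon> / 2"
        by (rule \<delta>(2)[OF U])
      then have sm: "(\<Sum>p\<in>E. \<Sum>q\<in>D p. norm (f (snd q) - f (fst q))) < \<epsilon> / 2"
        unfolding U_sum .
      have "(\<Sum>p\<in>E. norm (T (snd p) - T (fst p))) = (\<Sum>p\<in>E. T (snd p) - T (fst p))"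
      proof (intro sum.cong refl)
        fix p assume "p \<in> E"
        then have "0 \<le> T (snd p) - T (fst p)"
          using incr[of "fst p" "snd p"] E'(2-4)[of p] norm_ge_zero[of "f (snd p) - f (fst p)"] by linarith
        then show "norm (T (snd p) - T (fst p)) = T (snd p) - T (fst p)" by simp
      qed
      also have "\<dots> \<le> (\<Sum>p\<in>E. (\<Sum>q\<in>D p. norm (f (snd q) - f (fst q))) + \<eta>)"
        by (intro sum_mono D(2))
      also have "\<dots> = (\<Sum>p\<in>E. \<Sum>q\<in>D p. norm (f (snd q) - f (fst q))) + real (card E) * \<eta>"
        by (simp add: sum.distrib)
      also have "\<dots> < \<epsilon>" using sm \<eta>(2) by linarith
      finally show ?thesis .
    qed
    then show "\<exists>\<delta>>0. \<forall>D\<in>parts a b. (\<Sum>p\<in>D. snd p - fst p) < \<delta> \<longrightarrow> (\<Sum>p\<in>D. norm (T (snd p) - T (fst p))) < \<epsilon>"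
      using \<delta>(1) by blast
  qed
qed

lemma abs_cont_imp_continuous_on:
  assumes "abs_cont a b f"
  shows "continuous_on {a..b} f"
  unfolding continuous_on_iff
proof (intro ballI allI impI)
  fix x \<epsilon> :: real assume x: "x \<in> {a..b}" and \<epsilon>: "\<epsilon> > 0"
  obtain \<delta> where \<delta>: "\<delta> > 0" "\<And>D. D \<in> parts a b \<Longrightarrow> (\<Sum>p\<in>D. snd p - fst p) < \<delta> \<Longrightarrow>
     (\<Sum>p\<in>D. norm (f (snd p) - f (fst p))) < \<epsilon>"
    by (rule abs_contE[OF assms \<epsilon>]) blast
  have less: "norm (f t - f s) < \<epsilon>" if "a \<le> s" "s < t" "t \<le> b" "t - s < \<delta>" for s t
    using \<delta>(2)[of "{(s, t)}"] that by (simp add: parts_def)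
  have "dist (f y) (f x) < \<epsilon>" if "y \<in> {a..b}" "dist y x < \<delta>" for y
    using less[of x y] less[of y x] that x \<epsilon> by (cases x y rule: linorder_cases) (auto simp: dist_norm norm_minus_commute)
  then show "\<exists>\<delta>>0. \<forall>y\<in>{a..b}. dist y x < \<delta> \<longrightarrow> dist (f y) (f x) < \<epsilon>" using \<delta>(1) by blast
qed

section \<open>Densities of absolutely continuous functions\<close>

text \<open>Absolute continuity speaks of finite families only, so open sets are approached through
  finite unions of boxes. Such a union is subdivided into nonoverlapping intervals, which form a
  family of total length below \<open>\<delta>\<close>.\<close>

lemma mono_measure_finite_union_le:
  fixes G :: "real \<Rightarrow> real"
  assumes meas: "\<And>u v. a \<le> u \<Longrightarrow> u \<le> v \<Longrightarrow> v \<le> b \<Longrightarrow> emeasure M {u..v} = ennreal (G v - G u)"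
    and sets: "sets M = sets borel"
    and mono: "\<And>x y. a \<le> x \<Longrightarrow> x \<le> y \<Longrightarrow> y \<le> b \<Longrightarrow> G x \<le> G y"
    and \<delta>: "\<And>D. D \<in> parts a b \<Longrightarrow> (\<Sum>p\<in>D. snd p - fst p) < \<delta> \<Longrightarrow> (\<Sum>p\<in>D. norm (G (snd p) - G (fst p))) < \<epsilon>"
    and F: "finite F" "\<And>X. X \<in> F \<Longrightarrow> \<exists>u v. X = cbox u v" "\<Union>F \<subseteq> U"
    and U: "U \<subseteq> {a..b}" "emeasure lborel U < ennreal \<delta>" "U \<in> sets borel"
  shows "emeasure M (\<Union>F) \<le> ennreal \<epsilon>"
proof -
  obtain P where P: "P division_of (\<Union>F)"
    by (rule elementary_unions_intervals[OF F(1,2)]) blast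
  note P' = division_ofD[OF P]
  have "\<forall>K\<in>P. \<exists>u v. K = {u..v} \<and> u \<le> v"
    using P'(3,4) by (metis atLeastatMost_empty_iff2 interval_cbox)
  then obtain lo hi where K: "\<And>K. K \<in> P \<Longrightarrow> K = {lo K..hi K}" "\<And>K. K \<in> P \<Longrightarrow> lo K \<le> hi K"
    by metis
  have sub: "a \<le> lo K" "hi K \<le> b" "K \<subseteq> U" if "K \<in> P" for K
  proof -
    show KU: "K \<subseteq> U" using P'(2)[OF that] F(3) by blast
    then have "lo K \<in> {a..b}" "hi K \<in> {a..b}" using K[OF that] U(1) by (metis atLeastAtMost_iff order_refl subsetD)+
    then show "a \<le> lo K" "hi K \<le> b" by auto
  qed
  define Q where "Q = {K\<in>P. lo K < hi K}"
  have inj: "inj_on (\<lambda>K. (lo K, hi K)) Q"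
  proof (rule inj_onI)
    fix J K assume "J \<in> Q" "K \<in> Q" "(lo J, hi J) = (lo K, hi K)"
    then show "J = K" using K(1)[of J] K(1)[of K] by (simp add: Q_def)
  qed
  define D where "D = (\<lambda>K. (lo K, hi K)) ` Q"
  have disj: "{lo J<..<hi J} \<inter> {lo K<..<hi K} = {}" if "J \<in> P" "K \<in> P" "J \<noteq> K" for J K
    using P'(5)[OF that] K(1)[OF that(1)] K(1)[OF that(2)] by (metis interior_atLeastAtMost_real)
  have D: "D \<in> parts a b"
  proof (rule partsI)
    show "finite D" using P'(1) by (simp add: D_def Q_def)
  next
    fix p assume "p \<in> D"
    then obtain J where "J \<in> P" "lo J < hi J" "p = (lo J, hi J)" by (auto simp: D_def Q_def)
    then show "a \<le> fst p" "fst p < snd p" "snd p \<le> b" using sub[of J] by auto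
  next
    fix p q assume "p \<in> D" "q \<in> D" "p \<noteq> q"
    then obtain J K where JK: "J \<in> P" "p = (lo J, hi J)" "K \<in> P" "q = (lo K, hi K)" by (auto simp: D_def Q_def)
    then have "J \<noteq> K" using \<open>p \<noteq> q\<close> by auto
    show "{fst p<..<snd p} \<inter> {fst q<..<snd q} = {}"
      unfolding JK(2,4) fst_conv snd_conv by (rule disj[OF JK(1,3) \<open>J \<noteq> K\<close>])
  qed
  have finQ: "finite Q" using P'(1) by (simp add: Q_def)
  have "ennreal (\<Sum>p\<in>D. snd p - fst p) = (\<Sum>K\<in>Q. ennreal (hi K - lo K))"
    unfolding D_def sum.reindex[OF inj] by (subst sum_ennreal) (auto simp: Q_def)
  also have "\<dots> = (\<Sum>K\<in>Q. emeasure lborel {lo K<..<hi K})"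
    by (intro sum.cong refl) (simp add: Q_def)
  also have "\<dots> = emeasure lborel (\<Union>K\<in>Q. {lo K<..<hi K})"
    using finQ disj by (intro sum_emeasure) (auto simp: disjoint_family_on_def Q_def)
  also have "\<dots> \<le> emeasure lborel U"
  proof (intro emeasure_mono UN_least)
    fix J assume "J \<in> Q"
    then have "J \<in> P" by (simp add: Q_def)
    have "{lo J<..<hi J} \<subseteq> {lo J..hi J}" by auto
    then show "{lo J<..<hi J} \<subseteq> U" using sub(3)[OF \<open>J \<in> P\<close>] K(1)[OF \<open>J \<in> P\<close>] by simp
  qed (use U in simp)
  finally have "ennreal (\<Sum>p\<in>D. snd p - fst p) < ennreal \<delta>" using U(2) by (rule le_less_trans)
  then have "(\<Sum>p\<in>D. snd p - fst p) < \<delta>" by (simp add: ennreal_less_iff sum_nonneg partsD(3)[OF D] less_imp_le)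
  then have "(\<Sum>p\<in>D. norm (G (snd p) - G (fst p))) < \<epsilon>" by (rule \<delta>[OF D])
  then have small: "(\<Sum>K\<in>Q. norm (G (hi K) - G (lo K))) < \<epsilon>"
    unfolding D_def sum.reindex[OF inj] by (simp add: o_def)
  have "emeasure M (\<Union>F) = emeasure M (\<Union>K\<in>P. K)" using P'(6) by simp
  also have "\<dots> \<le> (\<Sum>K\<in>P. emeasure M K)"
  proof (rule emeasure_subadditive_finite[OF P'(1)])
    show "(\<lambda>K. K) ` P \<subseteq> Sigma_Algebra.sets M" unfolding sets using K(1) by auto (metis atLeastAtMost_borel)
  qed
  also have "\<dots> = (\<Sum>K\<in>P. ennreal (norm (G (hi K) - G (lo K))))"
  proof (intro sum.cong refl)
    fix K assume KP: "K \<in> P"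
    have "emeasure M {lo K..hi K} = ennreal (G (hi K) - G (lo K))"
      using sub[OF KP] K(2)[OF KP] by (intro meas)
    then show "emeasure M K = ennreal (norm (G (hi K) - G (lo K)))"
      using mono[OF sub(1)[OF KP] K(2)[OF KP] sub(2)[OF KP]] K(1)[OF KP] by simp
  qed
  also have "\<dots> = ennreal (\<Sum>K\<in>P. norm (G (hi K) - G (lo K)))" by (subst sum_ennreal) auto
  \<comment> \<open>Degenerate intervals are single points, over which \<open>G\<close> has no
    increment.\<close>
  also have "(\<Sum>K\<in>P. norm (G (hi K) - G (lo K))) = (\<Sum>K\<in>Q. norm (G (hi K) - G (lo K)))"
  proof (rule sum.mono_neutral_right[OF P'(1)])
    show "\<forall>K\<in>P - Q. norm (G (hi K) - G (lo K)) = 0"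
    proof
      fix J assume "J \<in> P - Q"
      then have "lo J = hi J" using K(2)[of J] by (simp add: Q_def)
      then show "norm (G (hi J) - G (lo J)) = 0" by simp
    qed
  qed (simp add: Q_def)
  also have "ennreal \<dots> \<le> ennreal \<epsilon>" using small by (intro ennreal_leI) simp
  finally show ?thesis .
qed

text \<open>The Stieltjes measure of \<open>G\<close> is absolutely continuous with respect to
  Lebesgue measure; its Radon-Nikodym density is the derivative sought.\<close>

theorem mono_abs_cont_eq_integral:
  fixes G :: "real \<Rightarrow> real"
  assumes ab: "a < b" and mono: "\<And>x y. a \<le> x \<Longrightarrow> x \<le> y \<Longrightarrow> y \<le> b \<Longrightarrow> G x \<le> G y" and ac: "abs_cont a b G"
  obtains \<rho> where "integrable (lebesgue_on {a..b}) \<rho>" "\<And>x. x \<in> {a..b} \<Longrightarrow> G x = G a + integral {a..x} \<rho>"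
proof -
  \<comment> \<open>Extending \<open>G\<close> by constants puts no mass outside the interval, and
    continuity of \<open>G\<close> excludes atoms.\<close>
  define H where "H x = G (max a (min b x))" for x
  have H_mono: "H x \<le> H y" if "x \<le> y" for x y
    unfolding H_def using that ab by (intro mono) (auto simp: max_def min_def)
  have H_cont: "continuous_on UNIV H"
    unfolding H_def using ab
    by (intro continuous_on_compose2[OF abs_cont_imp_continuous_on[OF ac]] continuous_intros) auto
  define M where "M = interval_measure H"
  have M_sets: "sets M = sets borel" by (simp add: M_def)
  have M_Icc: "emeasure M {u..v} = ennreal (H v - H u)" if "u \<le> v" for u v
    unfolding M_def by (rule emeasure_interval_measure_Icc[OF that H_mono H_cont])
  have HG: "H x = G x" if "a \<le> x" "x \<le> b" for x using that by (simp add: H_def)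
  have M_Icc': "emeasure M {u..v} = ennreal (G v - G u)" if "a \<le> u" "u \<le> v" "v \<le> b" for u v
    using M_Icc[OF that(2)] HG[of u] HG[of v] that by simp
  have out: "emeasure M {..a} = 0" "emeasure M {b..} = 0"
  proof -
    have "x \<in> (\<Union>n::nat. {a - real n..a})" if "x \<le> a" for x
    proof -
      obtain n :: nat where "a - x \<le> real n" using real_arch_simple by blast
      then show ?thesis using that by (intro UN_I[of n]) auto
    qed
    moreover have "x \<in> (\<Union>n::nat. {b..b + real n})" if "b \<le> x" for x
    proof -
      obtain n :: nat where "x - b \<le> real n" using real_arch_simple by blast
      then show ?thesis using that by (intro UN_I[of n]) auto
    qed
    ultimately have 1: "{..a} = (\<Union>n::nat. {a - real n..a})" "{b..} = (\<Union>n::nat. {b..b + real n})"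
      by (intro set_eqI iffI; auto)+
    have 2: "emeasure M {a - real n..a} = 0" "emeasure M {b..b + real n} = 0" for n
      using M_Icc[of "a - real n" a] M_Icc[of b "b + real n"] ab by (simp_all add: H_def max_def min_def)
    show "emeasure M {..a} = 0" "emeasure M {b..} = 0"
      unfolding 1 by (intro emeasure_UN_eq_0; simp add: 2 M_sets image_subset_iff)+
  qed
  have "absolutely_continuous lborel M"
    unfolding absolutely_continuous_def
  proof
    fix A :: "real set" assume "A \<in> null_sets lborel"
    then have A: "A \<in> sets borel" "emeasure lborel A = 0" by auto
    \<comment> \<open>Only the part inside the open interval matters, since \<open>out\<close> takes
      care of the rest. It is covered by an open set of measure below \<open>\<delta>\<close> that
      stays inside the interval, where \<open>G\<close> is controlled.\<close>
    define B where "B = A \<inter> {a<..<b}"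
    have B: "B \<in> sets borel" "emeasure lborel B = 0"
      using A emeasure_mono[of B A lborel] by (auto simp: B_def)
    have eps: "emeasure M B \<le> 0 + ennreal \<epsilon>" if \<epsilon>: "\<epsilon> > 0" for \<epsilon>
    proof -
      obtain \<delta> where \<delta>: "\<delta> > 0" "\<And>D. D \<in> parts a b \<Longrightarrow> (\<Sum>p\<in>D. snd p - fst p) < \<delta> \<Longrightarrow>
         (\<Sum>p\<in>D. norm (G (snd p) - G (fst p))) < \<epsilon>"
        by (rule abs_contE[OF ac \<epsilon>]) blast
      have "B \<in> sets lebesgue" using B(1) by auto
      then obtain T where T: "open T" "B \<subseteq> T" "T - B \<in> lmeasurable" "emeasure lebesgue (T - B) < ennreal \<delta>"
        by (rule sets_lebesgue_outer_open[OF _ \<delta>(1)])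
      define U where "U = T \<inter> {a<..<b}"
      have U: "open U" "B \<subseteq> U" "U \<subseteq> {a..b}" using T by (auto simp: U_def B_def)
      have Ub: "U \<in> sets borel" using U(1) by simp
      have "emeasure lborel U \<le> emeasure lborel ((T - B) \<union> B)"
        using T(1) B(1) by (intro emeasure_mono) (auto simp: U_def)
      also have "\<dots> \<le> emeasure lborel (T - B) + emeasure lborel B"
        using T(1) B(1) by (intro emeasure_subadditive) auto
      also have "\<dots> < ennreal \<delta>" using T(1,4) B by simp
      finally have U\<delta>: "emeasure lborel U < ennreal \<delta>" .
      obtain \<D> where \<D>: "countable \<D>" "\<D> \<subseteq> Pow U" "\<And>X. X \<in> \<D> \<Longrightarrow> \<exists>u v. X = cbox u v" "\<Union>\<D> = U"
        by (rule open_countable_Union_open_cbox[OF U(1)]) blast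
      have "emeasure M U \<le> ennreal \<epsilon>"
      proof (cases "\<D> = {}")
        case True
        then show ?thesis using \<D>(4) by auto
      next
        case False
        define W where "W n = \<Union>(from_nat_into \<D> ` {..n})" for n
        have UW: "U = (\<Union>n. W n)"
        proof -
          have "U = \<Union>(range (from_nat_into \<D>))" using False \<D>(1,4) by (simp add: range_from_nat_into)
          then show ?thesis unfolding W_def by blast
        qed
        have W_sets: "W n \<in> sets M" for n
        proof -
          have "X \<in> sets borel" if "X \<in> \<D>" for X using \<D>(3)[OF that] by auto
          then show ?thesis unfolding W_def M_sets using from_nat_into[OF False] by (intro sets.finite_Union) auto
        qed
        have "emeasure M (W n) \<le> ennreal \<epsilon>" for n
          unfolding W_def
        proof (rule mono_measure_finite_union_le[OF M_Icc' M_sets mono \<delta>(2) _ _ _ U(3) U\<delta> Ub])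
          show "\<exists>u v. X = cbox u v" if "X \<in> from_nat_into \<D> ` {..n}" for X
            using that from_nat_into[OF False] \<D>(3) by blast
          show "\<Union>(from_nat_into \<D> ` {..n}) \<subseteq> U"
            using from_nat_into[OF False] \<D>(2) by blast
        qed auto
        moreover have "emeasure M U = (SUP n. emeasure M (W n))"
        proof -
          have "incseq W"
            unfolding incseq_def W_def by (intro allI impI Union_mono image_mono) auto
          then show ?thesis
            unfolding UW using W_sets by (intro SUP_emeasure_incseq[symmetric]) auto
        qed
        ultimately show ?thesis by (simp add: SUP_le_iff)
      qed
      moreover have "emeasure M B \<le> emeasure M U"
        using U(2) Ub M_sets by (intro emeasure_mono) auto
      ultimately show ?thesis by simp
    qed
    have "emeasure M B \<le> 0" by (rule ennreal_le_epsilon) (rule eps)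
    have "emeasure M A \<le> emeasure M (B \<union> ({..a} \<union> {b..}))"
      using A B M_sets by (intro emeasure_mono) (auto simp: B_def)
    also have "\<dots> \<le> emeasure M B + emeasure M ({..a} \<union> {b..})"
      using B M_sets by (intro emeasure_subadditive) auto
    also have "emeasure M ({..a} \<union> {b..}) \<le> emeasure M {..a} + emeasure M {b..}"
      using M_sets by (intro emeasure_subadditive) auto
    finally have "emeasure M A = 0" using \<open>emeasure M B \<le> 0\<close> out by (simp add: add_left_mono)
    then show "A \<in> null_sets M" using A M_sets by auto
  qed
  then obtain r where r [measurable]: "r \<in> borel_measurable lborel" and rM: "density lborel r = M"
    using sigma_finite_measure.Radon_Nikodym[OF sigma_finite_lborel, of M] M_sets by auto
  have r_int: "(\<integral>\<^sup>+y. r y * indicator {a..x} y \<partial>lborel) = ennreal (G x - G a)" if "x \<in> {a..b}" for x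
  proof -
    have "(\<integral>\<^sup>+y. r y * indicator {a..x} y \<partial>lborel) = emeasure M {a..x}"
      unfolding rM[symmetric] by (rule emeasure_density[symmetric]) auto
    then show ?thesis using M_Icc'[of a x] that by simp
  qed
  \<comment> \<open>The density may take the value infinity, but on the interval only on a null set,
    since its integral there is finite.\<close>
  define \<rho> where "\<rho> y = enn2real (r y)" for y
  have \<rho>m [measurable]: "\<rho> \<in> borel_measurable borel" unfolding \<rho>_def[abs_def] using r by measurable
  have "AE y in lborel. r y * indicator {a..b} y \<noteq> \<infinity>"
    using r_int[of b] ab by (intro nn_integral_noteq_infinite) auto
  then have fin: "AE y in lborel. y \<in> {a..b} \<longrightarrow> r y = ennreal (\<rho> y)"
    by eventually_elim (auto simp: \<rho>_def indicator_def less_top split: if_splits)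
  have hi: "(\<rho> has_integral (G x - G a)) {a..x}" if x: "x \<in> {a..b}" for x
  proof -
    have "(\<integral>\<^sup>+y. ennreal (\<rho> y * indicator {a..x} y) \<partial>lborel) = (\<integral>\<^sup>+y. r y * indicator {a..x} y \<partial>lborel)"
    proof (rule nn_integral_cong_AE)
      show "AE y in lborel. ennreal (\<rho> y * indicator {a..x} y) = r y * indicator {a..x} y"
        using fin by eventually_elim (use x in \<open>auto simp: indicator_def\<close>)
    qed
    also have "\<dots> = ennreal (G x - G a)" by (rule r_int[OF x])
    finally have "((\<lambda>y. \<rho> y * indicator {a..x} y) has_integral (G x - G a)) UNIV"
      using mono[of a x] x by (intro nn_integral_has_integral) (auto simp: \<rho>_def)
    moreover have "(\<lambda>y. \<rho> y * indicator {a..x} y) = (\<lambda>y. if y \<in> {a..x} then \<rho> y else 0)" by auto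
    ultimately have "((\<lambda>y. if y \<in> {a..x} then \<rho> y else 0) has_integral (G x - G a)) UNIV"
      by (simp only:)
    then show ?thesis unfolding has_integral_restrict_UNIV .
  qed
  show ?thesis
  proof (rule that[of \<rho>])
    have "\<rho> integrable_on {a..b}" using hi[of b] ab by (auto simp: integrable_on_def)
    then have "\<rho> absolutely_integrable_on {a..b}"
      by (rule nonnegative_absolutely_integrable_1) (simp add: \<rho>_def)
    then show "integrable (lebesgue_on {a..b}) \<rho>"
      by (rule absolutely_integrable_imp_integrable) simp
    show "G x = G a + integral {a..x} \<rho>" if "x \<in> {a..b}" for x
      using integral_unique[OF hi[OF that]] by simp
  qed
qed

lemma abs_cont_if_Icc: "absolutely_continuous_on_Icc a b f \<Longrightarrow> abs_cont a b f"
  unfolding abs_cont_def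
proof (intro allI impI)
  fix \<epsilon> :: real assume "absolutely_continuous_on_Icc a b f" "\<epsilon> > 0"
  then obtain \<delta> where \<delta>: "\<delta> > 0" and H: "\<forall>D. finite D \<longrightarrow> (\<forall>(s, t)\<in>D. a \<le> s \<and> s \<le> t \<and> t \<le> b) \<longrightarrow>
        pairwise (\<lambda>(s, t) (u, v). {s<..<t} \<inter> {u<..<v} = {}) D \<longrightarrow>
        (\<Sum>(s, t)\<in>D. t - s) < \<delta> \<longrightarrow> (\<Sum>(s, t)\<in>D. cmod (f t - f s)) < \<epsilon>"
    unfolding absolutely_continuous_on_Icc_def by blast
  have "(\<Sum>p\<in>D. norm (f (snd p) - f (fst p))) < \<epsilon>" if D: "D \<in> parts a b" and len: "(\<Sum>p\<in>D. snd p - fst p) < \<delta>" for D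
  proof -
    note D' = partsD[OF D]
    have 1: "\<forall>(s, t)\<in>D. a \<le> s \<and> s \<le> t \<and> t \<le> b"
      using D'(2-4) less_imp_le by fastforce
    have 2: "pairwise (\<lambda>(s, t) (u, v). {s<..<t} \<inter> {u<..<v} = {}) D"
      using D unfolding parts_def by (simp add: case_prod_beta')
    have 3: "(\<Sum>(s, t)\<in>D. t - s) < \<delta>" using len by (simp add: case_prod_beta')
    have "(\<Sum>(s, t)\<in>D. cmod (f t - f s)) < \<epsilon>" using H D'(1) 1 2 3 by blast
    then show ?thesis by (simp add: case_prod_beta')
  qed
  then show "\<exists>\<delta>>0. \<forall>D\<in>parts a b. (\<Sum>p\<in>D. snd p - fst p) < \<delta> \<longrightarrow> (\<Sum>p\<in>D. norm (f (snd p) - f (fst p))) < \<epsilon>"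
    using \<delta> by blast
qed

text \<open>The Lipschitz term with \<open>K'\<close> is there for products with a smooth factor;
  the case \<open>K' = 0\<close> covers real parts, imaginary parts and differences.\<close>

lemma abs_cont_dominated:
  fixes f :: "real \<Rightarrow> 'b::real_normed_vector" and T :: "real \<Rightarrow> 'c::real_normed_vector"
  assumes T: "abs_cont a b T" and K: "K > 0" and K': "K' \<ge> 0"
    and dom: "\<And>x y. a \<le> x \<Longrightarrow> x < y \<Longrightarrow> y \<le> b \<Longrightarrow> norm (f y - f x) \<le> K * norm (T y - T x) + K' * (y - x)"
  shows "abs_cont a b f"
  unfolding abs_cont_def
proof (intro allI impI)
  fix \<epsilon> :: real assume \<epsilon>: "\<epsilon> > 0"
  have "\<epsilon> / (2 * K) > 0" using \<epsilon> K by simp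
  then obtain \<delta> where \<delta>: "\<delta> > 0" "\<And>D. D \<in> parts a b \<Longrightarrow> (\<Sum>p\<in>D. snd p - fst p) < \<delta> \<Longrightarrow>
     (\<Sum>p\<in>D. norm (T (snd p) - T (fst p))) < \<epsilon> / (2 * K)"
    by (rule abs_contE[OF T]) blast
  define \<delta>' where "\<delta>' = \<epsilon> / (2 * (K' + 1))"
  have \<delta>': "\<delta>' > 0" using \<epsilon> K' by (simp add: \<delta>'_def)
  have "(\<Sum>p\<in>D. norm (f (snd p) - f (fst p))) < \<epsilon>"
    if D: "D \<in> parts a b" and len: "(\<Sum>p\<in>D. snd p - fst p) < min \<delta> \<delta>'" for D
  proof -
    have "(\<Sum>p\<in>D. norm (f (snd p) - f (fst p))) \<le> (\<Sum>p\<in>D. K * norm (T (snd p) - T (fst p)) + K' * (snd p - fst p))"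
      using partsD(2-4)[OF D] by (intro sum_mono dom) auto
    also have "\<dots> = K * (\<Sum>p\<in>D. norm (T (snd p) - T (fst p))) + K' * (\<Sum>p\<in>D. snd p - fst p)"
      by (simp only: sum.distrib sum_distrib_left)
    also have "\<dots> < K * (\<epsilon> / (2 * K)) + \<epsilon> / 2"
    proof (rule add_less_le_mono)
      show "K * (\<Sum>p\<in>D. norm (T (snd p) - T (fst p))) < K * (\<epsilon> / (2 * K))"
        using \<delta>(2)[OF D] len K by (intro mult_strict_left_mono) auto
      have "K' * (\<Sum>p\<in>D. snd p - fst p) \<le> K' * \<delta>'" using len K' by (intro mult_left_mono) auto
      also have "\<dots> \<le> (K' + 1) * \<delta>'" using \<delta>' by (intro mult_right_mono) auto
      also have "\<dots> = \<epsilon> / 2"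
      proof -
        have "K' + 1 \<noteq> 0" using K' by simp
        then show ?thesis unfolding \<delta>'_def by (simp add: divide_simps)
      qed
      finally show "K' * (\<Sum>p\<in>D. snd p - fst p) \<le> \<epsilon> / 2" .
    qed
    also have "\<dots> = \<epsilon>" using K by simp
    finally show ?thesis .
  qed
  moreover have "min \<delta> \<delta>' > 0" using \<delta> \<delta>' by simp
  ultimately show "\<exists>\<delta>>0. \<forall>D\<in>parts a b. (\<Sum>p\<in>D. snd p - fst p) < \<delta> \<longrightarrow> (\<Sum>p\<in>D. norm (f (snd p) - f (fst p))) < \<epsilon>"
    by blast
qed

text \<open>Jordan decomposition: both \<open>T\<close> and \<open>T - h\<close> are nondecreasing
  and absolutely continuous, and \<open>h\<close> is their difference.\<close>

lemma real_abs_cont_eq_integral: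
  fixes h :: "real \<Rightarrow> real"
  assumes ab: "a < b" and h: "abs_cont a b h"
  obtains \<rho> where "integrable (lebesgue_on {a..b}) \<rho>" "\<And>x. x \<in> {a..b} \<Longrightarrow> (\<rho> has_integral (h x - h a)) {a..x}"
proof -
  define T where "T x = enn2real (variation h a x)" for x
  have T: "\<bar>h y - h x\<bar> \<le> T y - T x" if "a \<le> x" "x \<le> y" "y \<le> b" for x y
    using abs_cont_variation(1)[OF h less_imp_le[OF ab] that] by (simp add: T_def)
  have Tac: "abs_cont a b T"
    using abs_cont_variation(2)[OF h less_imp_le[OF ab]] by (simp add: T_def[abs_def])
  have "abs_cont a b (\<lambda>x. T x - h x)"
  proof (rule abs_cont_dominated[OF Tac, of 2 0])
    fix x y assume "a \<le> x" "x < y" "y \<le> b"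
    then show "norm (T y - h y - (T x - h x)) \<le> 2 * norm (T y - T x) + 0 * (y - x)"
      using T[of x y] by auto
  qed auto
  moreover have "T x - h x \<le> T y - h y" if "a \<le> x" "x \<le> y" "y \<le> b" for x y
    using T[OF that] by auto
  ultimately obtain \<sigma> where \<sigma>: "integrable (lebesgue_on {a..b}) \<sigma>"
      "\<And>x. x \<in> {a..b} \<Longrightarrow> T x - h x = T a - h a + integral {a..x} \<sigma>"
    using mono_abs_cont_eq_integral[OF ab, of "\<lambda>x. T x - h x"] by blast
  have "T x \<le> T y" if "a \<le> x" "x \<le> y" "y \<le> b" for x y
    using T[OF that] by auto
  then obtain \<tau> where \<tau>: "integrable (lebesgue_on {a..b}) \<tau>"
      "\<And>x. x \<in> {a..b} \<Longrightarrow> T x = T a + integral {a..x} \<tau>"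
    using mono_abs_cont_eq_integral[OF ab _ Tac] by blast
  show ?thesis
  proof (rule that[of "\<lambda>x. \<tau> x - \<sigma> x"])
    show "integrable (lebesgue_on {a..b}) (\<lambda>x. \<tau> x - \<sigma> x)" using \<sigma>(1) \<tau>(1) by simp
    fix x assume x: "x \<in> {a..b}"
    have "\<sigma> integrable_on {a..x}" "\<tau> integrable_on {a..x}"
      using x by (auto intro!: integrable_on_lebesgue_on integrable_subinterval[OF \<sigma>(1)] integrable_subinterval[OF \<tau>(1)])
    then have "((\<lambda>x. \<tau> x - \<sigma> x) has_integral (integral {a..x} \<tau> - integral {a..x} \<sigma>)) {a..x}"
      by (intro has_integral_diff integrable_integral)
    moreover have "integral {a..x} \<tau> - integral {a..x} \<sigma> = h x - h a"
      using \<sigma>(2)[OF x] \<tau>(2)[OF x] by linarith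
    ultimately show "((\<lambda>x. \<tau> x - \<sigma> x) has_integral (h x - h a)) {a..x}" by simp
  qed
qed

text \<open>The densities of real and imaginary part combine to \<open>\<rho>\<close>, and Lebesgue
  differentiation identifies \<open>\<rho>\<close> with the derivative almost everywhere.\<close>

theorem abs_cont_fundamental_theorem:
  fixes f :: "real \<Rightarrow> complex"
  assumes ab: "a < b" and f: "abs_cont a b f"
  obtains \<rho> where "integrable (lebesgue_on {a..b}) \<rho>"
    "AE x in lebesgue_on {a..b}. (f has_vector_derivative \<rho> x) (at x within {a..b})"
    "integral\<^sup>L (lebesgue_on {a..b}) \<rho> = f b - f a"
proof -
  have "abs_cont a b (\<lambda>x. Re (f x))" "abs_cont a b (\<lambda>x. Im (f x))"
    using abs_Re_le_cmod[of "f _ - f _"] abs_Im_le_cmod[of "f _ - f _"]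
    by (auto intro!: abs_cont_dominated[OF f, of 1 0])
  then obtain r i where r: "integrable (lebesgue_on {a..b}) r" "\<And>x. x \<in> {a..b} \<Longrightarrow> (r has_integral (Re (f x) - Re (f a))) {a..x}"
    and i: "integrable (lebesgue_on {a..b}) i" "\<And>x. x \<in> {a..b} \<Longrightarrow> (i has_integral (Im (f x) - Im (f a))) {a..x}"
    using real_abs_cont_eq_integral[OF ab] by metis
  define \<rho> where "\<rho> x = complex_of_real (r x) + \<i> * complex_of_real (i x)" for x
  have \<rho>: "integrable (lebesgue_on {a..b}) \<rho>" unfolding \<rho>_def using r(1) i(1) by simp
  have hi: "(\<rho> has_integral (f x - f a)) {a..x}" if x: "x \<in> {a..b}" for x
  proof -
    have "((\<lambda>x. complex_of_real (r x)) has_integral complex_of_real (Re (f x) - Re (f a))) {a..x}"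
      using has_integral_linear[OF r(2)[OF x] bounded_linear_of_real] by (simp add: o_def)
    moreover have "((\<lambda>x. \<i> * complex_of_real (i x)) has_integral \<i> * complex_of_real (Im (f x) - Im (f a))) {a..x}"
      using has_integral_linear[OF i(2)[OF x] bounded_linear_compose[OF bounded_linear_mult_right bounded_linear_of_real]]
      by (simp add: o_def)
    ultimately have "(\<rho> has_integral (complex_of_real (Re (f x) - Re (f a)) + \<i> * complex_of_real (Im (f x) - Im (f a)))) {a..x}"
      unfolding \<rho>_def by (rule has_integral_add)
    moreover have "complex_of_real (Re (f x) - Re (f a)) + \<i> * complex_of_real (Im (f x) - Im (f a)) = f x - f a"
      by (simp add: complex_eq_iff)
    ultimately show ?thesis by simp
  qed
  show ?thesis
  proof (rule that[OF \<rho>])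
    have "AE x in lebesgue_on {a..b}. x \<in> {a..b}" using AE_space[of "lebesgue_on {a..b}"] by simp
    then show "AE x in lebesgue_on {a..b}. (f has_vector_derivative \<rho> x) (at x within {a..b})"
      using lebesgue_differentiation[OF \<rho>]
    proof eventually_elim
      case (elim x)
      have "((\<lambda>t. integral {a..t} \<rho> + f a) has_vector_derivative \<rho> x) (at x within {a..b})"
        using elim(2) by (simp add: has_vector_derivative_add_const)
      then show ?case
        using elim(1) integral_unique[OF hi] by (elim has_vector_derivative_transform[rotated 2]) auto
    qed
    show "integral\<^sup>L (lebesgue_on {a..b}) \<rho> = f b - f a"
      using lebesgue_integral_eq_integral[OF \<rho>] integral_unique[OF hi[of b]] ab by simp
  qed
qed

section \<open>The trigonometric bases of the square integrable functions\<close>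

lemma L2_rel_refl: "square_integrable f \<Longrightarrow> L2_rel f f"
  by (simp add: L2_rel_def)

lemma abs_L2_eqI: "L2_rel f g \<Longrightarrow> abs_L2 f = abs_L2 g"
  using Quotient_rel_abs[OF Quotient_L2] by blast

lemma L2_cases:
  obtains f where "square_integrable f" "x = abs_L2 f"
  by (induction x rule: L2.abs_induct) (auto simp: L2_rel_def)

lemma cinner_abs_L2:
  assumes "square_integrable f" "square_integrable g"
  shows "cinner (abs_L2 f) (abs_L2 g) = (LINT x|I_pi. cnj (f x) * g x)"
  using assms by (simp add: cinner_L2.abs_eq L2_rel_refl)

lemma scaleC_abs_L2: "square_integrable f \<Longrightarrow> c *\<^sub>C abs_L2 f = abs_L2 (\<lambda>x. c * f x)"
  by (simp add: scaleC_L2.abs_eq L2_rel_refl)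

lemma square_integrable_diff:
  assumes "square_integrable f" "square_integrable g"
  shows "square_integrable (\<lambda>x. f x - g x)"
  using square_integrable_add[OF assms(1) square_integrable_scale[OF assms(2), of "-1"]] by simp

lemma diff_abs_L2:
  assumes "square_integrable f" "square_integrable g"
  shows "abs_L2 f - abs_L2 g = abs_L2 (\<lambda>x. f x - g x)"
proof -
  have "abs_L2 f - abs_L2 g = abs_L2 f + (-1) *\<^sub>C abs_L2 g"
    by (simp only: minus_L2_def uminus_L2_def)
  also have "\<dots> = abs_L2 (\<lambda>x. f x + (-1) * g x)"
    unfolding scaleC_abs_L2[OF assms(2)]
    by (rule plus_L2.abs_eq) (intro L2_rel_refl square_integrable_scale assms)+
  finally show ?thesis by simp
qed

lemma norm_abs_L2:
  assumes "square_integrable f"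
  shows "(norm (abs_L2 f))\<^sup>2 = (LINT x|I_pi. (cmod (f x))\<^sup>2)"
proof -
  have "complex_of_real ((norm (abs_L2 f))\<^sup>2) = (LINT x|I_pi. complex_of_real ((cmod (f x))\<^sup>2))"
    unfolding cinner_self[symmetric] cinner_abs_L2[OF assms assms] complex_norm_square
    by (simp only: mult.commute)
  then show ?thesis
    unfolding integral_complex_of_real using of_real_eq_iff by blast
qed

lemma square_integrable_const: "square_integrable (\<lambda>_. c)"
  by (simp add: square_integrable_def)

lemma square_integrable_norm: "square_integrable f \<Longrightarrow> square_integrable (\<lambda>x. complex_of_real (cmod (f x)))"
  by (auto simp: square_integrable_def)

lemma square_integrable_imp_integrable: "square_integrable f \<Longrightarrow> integrable I_pi f"
  using square_integrable_mult[OF square_integrable_const[of 1]] by simp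

text \<open>Cauchy-Schwarz against the constant function 1, which is square integrable on the
  bounded interval.\<close>

lemma nn_integral_norm_le:
  assumes "square_integrable f"
  shows "(\<integral>\<^sup>+x. ennreal (cmod (f x)) \<partial>I_pi) \<le> ennreal (norm (abs_L2 (\<lambda>_. 1)) * norm (abs_L2 f))"
proof -
  let ?g = "\<lambda>x. complex_of_real (cmod (f x))"
  have int: "integrable I_pi (\<lambda>x. cmod (f x))"
    using square_integrable_imp_integrable[OF assms] by (rule integrable_norm)
  have "(norm (abs_L2 ?g))\<^sup>2 = (norm (abs_L2 f))\<^sup>2"
    unfolding norm_abs_L2[OF assms] norm_abs_L2[OF square_integrable_norm[OF assms]] by simp
  then have eq: "norm (abs_L2 ?g) = norm (abs_L2 f)"
    by (rule power2_eq_imp_eq) simp_all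
  have "complex_of_real (LINT x|I_pi. cmod (f x)) = cinner (abs_L2 (\<lambda>_. 1)) (abs_L2 ?g)"
    using assms by (simp add: cinner_abs_L2 square_integrable_const square_integrable_norm)
  then have "(LINT x|I_pi. cmod (f x)) \<le> norm (abs_L2 (\<lambda>_. 1)) * norm (abs_L2 f)"
    using cinner_norm_bound[of "abs_L2 (\<lambda>_. 1)" "abs_L2 ?g"] unfolding eq
    by (metis abs_ge_self norm_of_real order_trans)
  then show ?thesis
    by (subst nn_integral_eq_integral[OF int]) (auto intro: ennreal_leI)
qed

lemma square_integrableI_nn_integral:
  assumes "f \<in> borel_measurable I_pi" "(\<integral>\<^sup>+x. ennreal ((cmod (f x))\<^sup>2) \<partial>I_pi) \<le> ennreal (c\<^sup>2)" "c \<ge> 0"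
  shows "square_integrable f" "norm (abs_L2 f) \<le> c"
proof -
  have int: "integrable I_pi (\<lambda>x. (cmod (f x))\<^sup>2)"
  proof (rule integrableI_nonneg)
    show "(\<lambda>x. (cmod (f x))\<^sup>2) \<in> borel_measurable I_pi" using assms(1) by measurable
    show "(\<integral>\<^sup>+x. ennreal ((cmod (f x))\<^sup>2) \<partial>I_pi) < \<infinity>"
      using assms(2) by (rule le_less_trans) simp
  qed auto
  then show sq: "square_integrable f" using assms(1) by (simp add: square_integrable_def)
  have "ennreal ((norm (abs_L2 f))\<^sup>2) \<le> ennreal (c\<^sup>2)"
    unfolding norm_abs_L2[OF sq] using assms(2) by (subst (asm) nn_integral_eq_integral[OF int]) auto
  then have "(norm (abs_L2 f))\<^sup>2 \<le> c\<^sup>2" by simp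
  then show "norm (abs_L2 f) \<le> c" using assms(3) by (rule power2_le_imp_le)
qed

text \<open>Riesz-Fischer: along a fast subsequence the norms of the differences are summable, so
  the differences are absolutely summable almost everywhere, and Fatou shows that the pointwise
  limit is also the limit in norm.\<close>

lemma L2_Cauchy_convergent:
  fixes X :: "nat \<Rightarrow> L2"
  assumes "Cauchy X"
  shows "convergent X"
proof -
  have "\<exists>N. \<forall>m\<ge>N. \<forall>n\<ge>N. dist (X m) (X n) < (1/2) ^ k" for k
    using assms unfolding Cauchy_def by simp
  then obtain N where N: "\<And>k m n. m \<ge> N k \<Longrightarrow> n \<ge> N k \<Longrightarrow> dist (X m) (X n) < (1/2) ^ k"
    by metis
  \<comment> \<open>The sum of the \<open>N j\<close> keeps \<open>s\<close> above all earlier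
    thresholds and the summand \<open>k\<close> makes it strictly increasing.\<close>
  define s where "s k = (\<Sum>j\<le>k. N j) + k" for k
  have s: "strict_mono s" by (intro strict_monoI_Suc) (simp add: s_def)
  have sN: "s m \<ge> N k" if "m \<ge> k" for m k
  proof -
    have "N k \<le> (\<Sum>j\<le>m. N j)" using that by (intro member_le_sum) auto
    then show ?thesis by (simp add: s_def)
  qed
  have "\<exists>r. square_integrable r \<and> X (s k) = abs_L2 r" for k
    by (rule L2_cases[of "X (s k)"]) blast
  then obtain r where r: "\<And>k. square_integrable (r k)" "\<And>k. X (s k) = abs_L2 (r k)" by metis
  have rm [measurable]: "r k \<in> borel_measurable I_pi" for k using r(1) by (simp add: square_integrable_def)
  have rd: "norm (abs_L2 (\<lambda>x. r m x - r n x)) \<le> (1/2) ^ k" if "m \<ge> k" "n \<ge> k" for m n k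
    using N[OF sN[OF that(1)] sN[OF that(2)]] r by (simp add: dist_norm diff_abs_L2[symmetric])
  define d where "d k x = r (Suc k) x - r k x" for k x
  have dsq: "square_integrable (d k)" for k unfolding d_def by (intro square_integrable_diff r)
  have dm [measurable]: "d k \<in> borel_measurable I_pi" for k using dsq by (simp add: square_integrable_def)
  let ?c = "norm (abs_L2 (\<lambda>_. 1))"
  have "(\<integral>\<^sup>+x. (\<Sum>k. ennreal (cmod (d k x))) \<partial>I_pi) = (\<Sum>k. \<integral>\<^sup>+x. ennreal (cmod (d k x)) \<partial>I_pi)"
    by (rule nn_integral_suminf) measurable
  also have "\<dots> \<le> (\<Sum>k. ennreal (?c * (1/2) ^ k))"
  proof (intro suminf_le summableI)
    fix k
    have "?c * norm (abs_L2 (d k)) \<le> ?c * (1/2) ^ k"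
      using rd[of k "Suc k" k] by (intro mult_left_mono) (auto simp: d_def[abs_def])
    then show "(\<integral>\<^sup>+x. ennreal (cmod (d k x)) \<partial>I_pi) \<le> ennreal (?c * (1/2) ^ k)"
      using nn_integral_norm_le[OF dsq[of k]] by (meson ennreal_leI order_trans)
  qed
  also have "\<dots> = ennreal (\<Sum>k. ?c * (1/2) ^ k)"
    by (intro suminf_ennreal2 summable_mult summable_geometric) auto
  finally have "(\<integral>\<^sup>+x. (\<Sum>k. ennreal (cmod (d k x))) \<partial>I_pi) \<noteq> \<infinity>"
    by (metis ennreal_neq_top infinity_ennreal_def neq_top_trans)
  then have "AE x in I_pi. (\<Sum>k. ennreal (cmod (d k x))) \<noteq> \<infinity>"
    by (intro nn_integral_noteq_infinite) measurable
  then have conv: "AE x in I_pi. convergent (\<lambda>k. r k x)"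
  proof eventually_elim
    case (elim x)
    then have "summable (\<lambda>k. cmod (d k x))"
      by (intro summable_suminf_not_top) auto
    then have "summable (\<lambda>k. d k x)" by (rule summable_norm_cancel)
    then have "convergent (\<lambda>n. \<Sum>k<n. d k x)" by (simp add: summable_iff_convergent)
    moreover have "(\<Sum>k<n. d k x) = r n x - r 0 x" for n
      unfolding d_def by (rule sum_lessThan_telescope)
    ultimately have "convergent (\<lambda>n. r n x - r 0 x)" by simp
    then have "convergent (\<lambda>n. (r n x - r 0 x) + r 0 x)" by (intro convergent_add convergent_const)
    then show ?case by simp
  qed
  define F where "F x = lim (\<lambda>k. r k x)" for x
  have Fm [measurable]: "F \<in> borel_measurable I_pi"
    unfolding F_def by (rule borel_measurable_lim_metric) (rule rm)
  have lim: "AE x in I_pi. (\<lambda>k. r k x) \<longlonglongrightarrow> F x"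
    using conv by eventually_elim (simp add: F_def convergent_LIMSEQ_iff)
  have bound: "square_integrable (\<lambda>x. F x - r n x)" "norm (abs_L2 (\<lambda>x. F x - r n x)) \<le> (1/2) ^ k"
    if "n \<ge> k" for n k
  proof -
    have "(\<integral>\<^sup>+x. ennreal ((cmod (F x - r n x))\<^sup>2) \<partial>I_pi)
        = (\<integral>\<^sup>+x. liminf (\<lambda>m. ennreal ((cmod (r m x - r n x))\<^sup>2)) \<partial>I_pi)"
    proof (rule nn_integral_cong_AE)
      show "AE x in I_pi. ennreal ((cmod (F x - r n x))\<^sup>2) = liminf (\<lambda>m. ennreal ((cmod (r m x - r n x))\<^sup>2))"
        using lim
      proof eventually_elim
        case (elim x)
        then have "(\<lambda>m. ennreal ((cmod (r m x - r n x))\<^sup>2)) \<longlonglongrightarrow> ennreal ((cmod (F x - r n x))\<^sup>2)"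
          by (intro tendsto_intros)
        then show ?case by (intro lim_imp_Liminf[symmetric]) auto
      qed
    qed
    \<comment> \<open>Fatou's lemma; it gives square integrability of the limit and the rate in one
      estimate.\<close>
    also have "\<dots> \<le> liminf (\<lambda>m. \<integral>\<^sup>+x. ennreal ((cmod (r m x - r n x))\<^sup>2) \<partial>I_pi)"
      by (rule nn_integral_liminf) measurable
    also have "\<dots> \<le> limsup (\<lambda>m. \<integral>\<^sup>+x. ennreal ((cmod (r m x - r n x))\<^sup>2) \<partial>I_pi)"
      by (intro Liminf_le_Limsup) simp
    also have "\<dots> \<le> ennreal (((1/2) ^ k)\<^sup>2)"
    proof (rule Limsup_bounded)
      have "(\<integral>\<^sup>+x. ennreal ((cmod (r m x - r n x))\<^sup>2) \<partial>I_pi) \<le> ennreal (((1/2) ^ k)\<^sup>2)" if "m \<ge> k" for m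
      proof -
        have sq: "square_integrable (\<lambda>x. r m x - r n x)" by (intro square_integrable_diff r)
        have "(\<integral>\<^sup>+x. ennreal ((cmod (r m x - r n x))\<^sup>2) \<partial>I_pi) = ennreal ((norm (abs_L2 (\<lambda>x. r m x - r n x)))\<^sup>2)"
          unfolding norm_abs_L2[OF sq] using sq by (intro nn_integral_eq_integral) (auto simp: square_integrable_def)
        also have "\<dots> \<le> ennreal (((1/2) ^ k)\<^sup>2)"
          by (intro ennreal_leI power_mono rd that \<open>n \<ge> k\<close>) auto
        finally show ?thesis .
      qed
      then show "\<forall>\<^sub>F m in sequentially. (\<integral>\<^sup>+x. ennreal ((cmod (r m x - r n x))\<^sup>2) \<partial>I_pi) \<le> ennreal (((1/2) ^ k)\<^sup>2)"
        unfolding eventually_sequentially by blast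
    qed
    finally have "(\<integral>\<^sup>+x. ennreal ((cmod (F x - r n x))\<^sup>2) \<partial>I_pi) \<le> ennreal (((1/2) ^ k)\<^sup>2)" .
    then show "square_integrable (\<lambda>x. F x - r n x)" "norm (abs_L2 (\<lambda>x. F x - r n x)) \<le> (1/2) ^ k"
      by (intro square_integrableI_nn_integral; measurable; simp)+
  qed
  have Fsq: "square_integrable F"
    using square_integrable_add[OF bound(1)[of 0 0] r(1)[of 0]] by simp
  have "(X \<circ> s) \<longlonglongrightarrow> abs_L2 F"
  proof (rule tendstoI)
    fix \<epsilon> :: real assume "\<epsilon> > 0"
    then obtain k where k: "(1/2) ^ k < \<epsilon>" using real_arch_pow_inv[of \<epsilon> "1/2"] by auto
    have "dist ((X \<circ> s) n) (abs_L2 F) < \<epsilon>" if "n \<ge> k" for n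
      unfolding dist_commute[of _ "abs_L2 F"]
      using bound(2)[OF that] k r Fsq by (simp add: dist_norm diff_abs_L2)
    then show "\<forall>\<^sub>F n in sequentially. dist ((X \<circ> s) n) (abs_L2 F) < \<epsilon>"
      unfolding eventually_sequentially by blast
  qed
  then have "X \<longlonglongrightarrow> abs_L2 F" using Cauchy_converges_subseq[OF assms s] by blast
  then show ?thesis by (rule convergentI)
qed

instance L2 :: banach
  by standard (rule L2_Cauchy_convergent)

section \<open>Orthonormality and totality of the exponentials\<close>

lemma integrable_continuous_mult:
  fixes f g :: "real \<Rightarrow> complex"
  assumes "continuous_on {0..pi} g" "integrable I_pi f"
  shows "integrable I_pi (\<lambda>x. g x * f x)"
proof -
  obtain K where "\<forall>y\<in>g ` {0..pi}. cmod y \<le> K"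
    using compact_imp_bounded[OF compact_continuous_image[OF assms(1) compact_Icc]] unfolding bounded_iff by blast
  then have K: "cmod (g x) \<le> K" if "x \<in> {0..pi}" for x
    using that by blast
  have [measurable]: "g \<in> borel_measurable I_pi"
    using assms(1) by (intro continuous_imp_measurable_on_sets_lebesgue) auto
  have [measurable]: "f \<in> borel_measurable I_pi" using assms(2) by auto
  show ?thesis
  proof (rule Bochner_Integration.integrable_bound)
    show "integrable I_pi (\<lambda>x. complex_of_real K * f x)" using assms(2) by simp
    show "(\<lambda>x. g x * f x) \<in> borel_measurable I_pi" by measurable
    show "AE x in I_pi. norm (g x * f x) \<le> norm (complex_of_real K * f x)"
    proof (rule AE_I2)
      fix x assume "x \<in> space I_pi"
      then have "cmod (g x) \<le> \<bar>K\<bar>" using K by fastforce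
      then show "norm (g x * f x) \<le> norm (complex_of_real K * f x)"
        by (simp add: norm_mult mult_right_mono)
    qed
  qed
qed

lemma integral_cis:
  "(LINT x|I_pi. cis (real_of_int (2 * k) * x)) = (if k = 0 then complex_of_real pi else 0)"
proof (cases "k = 0")
  case True
  then show ?thesis by (simp add: measure_restrict_space scaleR_conv_of_real)
next
  case False
  let ?w = "real_of_int (2 * k)"
  have cont: "continuous_on {0..pi} (\<lambda>x. cis (?w * x))" by (intro continuous_intros)
  have "((\<lambda>x. cis (?w * x)) has_integral (cis (?w * pi) / (\<i> * ?w) - cis (?w * 0) / (\<i> * ?w))) {0..pi}"
  proof (rule fundamental_theorem_of_calculus)
    fix x
    have "((\<lambda>x. cis (?w * x)) has_vector_derivative (?w *\<^sub>R (\<i> * cis (?w * x)))) (at x within {0..pi})"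
      unfolding has_vector_derivative_def by (auto intro!: derivative_eq_intros simp: mult_ac)
    then have "((\<lambda>x. (1 / (\<i> * ?w)) * cis (?w * x)) has_vector_derivative (1 / (\<i> * ?w)) * (?w *\<^sub>R (\<i> * cis (?w * x)))) (at x within {0..pi})"
      by (rule has_vector_derivative_mult_right)
    moreover have "(1 / (\<i> * ?w)) * (?w *\<^sub>R (\<i> * cis (?w * x))) = cis (?w * x)"
      using False by (simp add: scaleR_conv_of_real field_simps)
    ultimately show "((\<lambda>x. cis (?w * x) / (\<i> * ?w)) has_vector_derivative cis (?w * x)) (at x within {0..pi})"
      by (simp add: field_simps)
  qed simp
  moreover have "cis (?w * pi) = 1"
    using cis_multiple_2pi[of "real_of_int k"] by (simp add: mult_ac)
  ultimately have "((\<lambda>x. cis (?w * x)) has_integral 0) {0..pi}" by simp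
  then have "integral {0..pi} (\<lambda>x. cis (?w * x)) = 0" by (rule integral_unique)
  then show ?thesis
    using lebesgue_integral_eq_integral[OF continuous_imp_integrable_real[OF cont]] False by simp
qed

text \<open>Polynomials in \<open>cis (2 * x)\<close> and its inverse: on an interval of length
  \<open>pi\<close> the frequencies are even.\<close>

inductive trig_poly :: "(real \<Rightarrow> complex) \<Rightarrow> bool" where
  base: "trig_poly (\<lambda>x. c * cis (real_of_int (2 * m) * x))"
| add: "trig_poly f \<Longrightarrow> trig_poly g \<Longrightarrow> trig_poly (\<lambda>x. f x + g x)"

lemma trig_poly_mult:
  assumes "trig_poly f" "trig_poly g"
  shows "trig_poly (\<lambda>x. f x * g x)"
  using assms(1)
proof (induction rule: trig_poly.induct)
  case (base c m)
  show ?case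
    using assms(2)
  proof (induction rule: trig_poly.induct)
    case (base d n)
    have "(\<lambda>x. c * cis (real_of_int (2 * m) * x) * (d * cis (real_of_int (2 * n) * x)))
        = (\<lambda>x. (c * d) * cis (real_of_int (2 * (m + n)) * x))"
      by (simp add: mult_ac cis_mult[symmetric] ring_distribs)
    then show ?case using trig_poly.base[of "c * d" "m + n"] by simp
  next
    case (add f g)
    then show ?case using trig_poly.add by (simp add: distrib_left)
  qed
next
  case (add f h)
  then show ?case using trig_poly.add by (simp add: distrib_right)
qed

lemma continuous_on_trig_poly: "trig_poly f \<Longrightarrow> continuous_on S f"
  by (induction rule: trig_poly.induct) (auto intro!: continuous_intros)

text \<open>Connects Stone-Weierstrass on the unit circle with exponentials. A real linear form in
  \<open>z\<close> is a combination of \<open>z\<close> and its conjugate, which on the circle are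
  \<open>cis (2 * x)\<close> and \<open>cis (- 2 * x)\<close>.\<close>

lemma trig_poly_real_polynomial:
  assumes "real_polynomial_function (p :: complex \<Rightarrow> real)"
  shows "trig_poly (\<lambda>x. complex_of_real (p (cis (2 * x))))"
  using assms
proof (induction rule: real_polynomial_function.induct)
  case (linear h)
  then interpret bounded_linear h .
  have h: "h z = Re z * h 1 + Im z * h \<i>" for z
  proof -
    have "z = Re z *\<^sub>R 1 + Im z *\<^sub>R \<i>" by (simp add: complex_eq_iff)
    then have "h z = h (Re z *\<^sub>R 1 + Im z *\<^sub>R \<i>)" by simp
    then show ?thesis by (simp only: add scaleR) simp
  qed
  have eq: "(\<lambda>x. complex_of_real (h (cis (2 * x))))
      = (\<lambda>x. (h 1 / 2 - \<i> * h \<i> / 2) * cis (real_of_int (2 * 1) * x) + (h 1 / 2 + \<i> * h \<i> / 2) * cis (real_of_int (2 * (-1)) * x))"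
    by (rule ext, subst h) (simp add: complex_eq_iff)
  show ?case unfolding eq by (intro trig_poly.add trig_poly.base)
next
  case (const c)
  show ?case using trig_poly.base[of "complex_of_real c" 0] by simp
next
  case (add f g)
  then show ?case using trig_poly.add by simp
next
  case (mult f g)
  then show ?case using trig_poly_mult by simp
qed

context
  fixes f :: "real \<Rightarrow> complex"
  assumes f: "integrable I_pi f" and orth: "\<And>m::int. (LINT x|I_pi. cis (real_of_int (2 * m) * x) * f x) = 0"
begin

lemma integral_trig_poly_eq_0: "trig_poly p \<Longrightarrow> (LINT x|I_pi. p x * f x) = 0"
proof (induction rule: trig_poly.induct)
  case (base c m)
  then show ?case using orth[of m] by (simp add: mult.assoc)
next
  case (add g h)
  then show ?case
    using integrable_continuous_mult[OF continuous_on_trig_poly f] by (simp add: distrib_right)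
qed

text \<open>Uniform approximation on the circle by real polynomials, whose integrals against
  \<open>f\<close> vanish; the error is weighted by the integral of
  \<open>cmod (f x)\<close>.\<close>

lemma integral_circle_function_eq_0:
  fixes G :: "complex \<Rightarrow> real"
  assumes G: "continuous_on (sphere 0 1) G"
  shows "(LINT x|I_pi. complex_of_real (G (cis (2 * x))) * f x) = 0"
proof -
  let ?I = "LINT x|I_pi. complex_of_real (G (cis (2 * x))) * f x"
  have cG: "continuous_on {0..pi} (\<lambda>x. complex_of_real (G (cis (2 * x))))"
    by (intro continuous_intros continuous_on_compose2[OF G]) auto
  have "cmod ?I \<le> 0 + \<epsilon>" if \<epsilon>: "\<epsilon> > 0" for \<epsilon>
  proof -
    define K where "K = (LINT x|I_pi. cmod (f x)) + 1"
    have K: "K > 0" unfolding K_def by (intro add_nonneg_pos integral_nonneg_AE) auto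
    have "\<epsilon> / K > 0" using \<epsilon> K by simp
    then obtain p where p: "real_polynomial_function p" "\<And>z. z \<in> sphere 0 1 \<Longrightarrow> \<bar>G z - p z\<bar> < \<epsilon> / K"
      using Stone_Weierstrass_real_polynomial_function[OF compact_sphere G] by metis
    let ?p = "\<lambda>x. complex_of_real (p (cis (2 * x)))"
    have tp: "trig_poly ?p" by (rule trig_poly_real_polynomial[OF p(1)])
    have int: "integrable I_pi (\<lambda>x. complex_of_real (G (cis (2 * x))) * f x)" "integrable I_pi (\<lambda>x. ?p x * f x)"
      using f cG continuous_on_trig_poly[OF tp] by (auto intro: integrable_continuous_mult)
    have "?I = (LINT x|I_pi. complex_of_real (G (cis (2 * x))) * f x - ?p x * f x)"
      using int integral_trig_poly_eq_0[OF tp] by simp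
    also have "cmod \<dots> \<le> (LINT x|I_pi. cmod (complex_of_real (G (cis (2 * x))) * f x - ?p x * f x))"
      by (rule integral_norm_bound)
    also have "\<dots> \<le> (LINT x|I_pi. \<epsilon> / K * cmod (f x))"
    proof (rule integral_mono)
      fix x :: real
      have "cmod (complex_of_real (G (cis (2 * x))) * f x - ?p x * f x) = \<bar>G (cis (2 * x)) - p (cis (2 * x))\<bar> * cmod (f x)"
        by (simp add: norm_mult flip: left_diff_distrib of_real_diff)
      also have "\<dots> \<le> \<epsilon> / K * cmod (f x)"
        using p(2)[of "cis (2 * x)"] by (intro mult_right_mono) auto
      finally show "cmod (complex_of_real (G (cis (2 * x))) * f x - ?p x * f x) \<le> \<epsilon> / K * cmod (f x)" .
    qed (use int f in auto)
    also have "\<dots> = \<epsilon> / K * (LINT x|I_pi. cmod (f x))" by simp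
    also have "\<dots> \<le> \<epsilon> / K * K" using \<epsilon> K by (intro mult_left_mono) (auto simp: K_def)
    finally show ?thesis using K by simp
  qed
  then have "cmod ?I \<le> 0" by (rule field_le_epsilon)
  then show ?thesis by simp
qed

text \<open>The interval \<open>{0<..<t}\<close> is an arc of the circle under \<open>x \<mapsto> cis (2 x)\<close>; cutting it out by a half plane
  avoids the discontinuity of the argument function.\<close>

lemma cos_arc:
  assumes "x \<in> {0..pi}" "t \<in> {0..pi}"
  shows "cos t < cos (2 * x - t) \<longleftrightarrow> x \<in> {0<..<t}"
proof
  assume "x \<in> {0<..<t}"
  then have "cos t < cos \<bar>2 * x - t\<bar>" using assms by (intro cos_monotone_0_pi) auto
  then show "cos t < cos (2 * x - t)" by simp
next
  assume less: "cos t < cos (2 * x - t)"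
  have "x \<noteq> 0" using less by auto
  moreover have "x < t"
  proof (rule ccontr)
    assume "\<not> x < t"
    have "cos (2 * x - t) \<le> cos t"
    proof (cases "2 * x - t \<le> pi")
      case True
      then show ?thesis using \<open>\<not> x < t\<close> assms by (intro cos_monotone_0_pi_le) auto
    next
      case False
      have "cos (2 * x - t) = cos (2 * pi - (2 * x - t))" by simp
      also have "\<dots> \<le> cos t" using False \<open>\<not> x < t\<close> assms by (intro cos_monotone_0_pi_le) auto
      finally show ?thesis .
    qed
    then show False using less by simp
  qed
  ultimately show "x \<in> {0<..<t}" using assms by auto
qed

text \<open>Continuous functions on the circle that approximate the indicator of an arc show that
  \<open>f\<close> has integral 0 over every initial interval.\<close>

lemma AE_zero_if_orthogonal: "AE x in I_pi. f x = 0"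
proof (rule AE_zero_if_integrals_zero[OF f pi_gt_zero])
  fix t assume t: "t \<in> {0..pi}"
  \<comment> \<open>A ramp across the line bounding the half plane of \<open>cos_arc\<close>. It
    tends to the indicator of the open half plane and stays between 0 and 1, as dominated
    convergence needs.\<close>
  define G where "G n z = min 1 (real n * max 0 (Re (z * cis (- t)) - cos t))" for n z
  have Gx: "G n (cis (2 * x)) = min 1 (real n * max 0 (cos (2 * x - t) - cos t))" for n x
    by (simp add: G_def cis_mult)
  have [measurable]: "f \<in> borel_measurable I_pi" using f by auto
  have cont: "continuous_on UNIV (\<lambda>x. complex_of_real (G n (cis (2 * x))))" for n
    unfolding Gx by (intro continuous_intros)
  have [measurable]: "(\<lambda>x. complex_of_real (G n (cis (2 * x)))) \<in> borel_measurable I_pi" for n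
    by (intro continuous_imp_measurable_on_sets_lebesgue continuous_on_subset[OF cont]) auto
  have lim: "(\<lambda>n. LINT x|I_pi. complex_of_real (G n (cis (2 * x))) * f x) \<longlonglongrightarrow> (LINT x|I_pi. (if x \<in> {0<..<t} then f x else 0))"
  proof (rule integral_dominated_convergence[where w="\<lambda>x. cmod (f x)"])
    show "AE x in I_pi. (\<lambda>n. complex_of_real (G n (cis (2 * x))) * f x) \<longlonglongrightarrow> (if x \<in> {0<..<t} then f x else 0)"
    proof (rule AE_I2)
      fix x assume "x \<in> space I_pi"
      then have x: "x \<in> {0..pi}" by simp
      show "(\<lambda>n. complex_of_real (G n (cis (2 * x))) * f x) \<longlonglongrightarrow> (if x \<in> {0<..<t} then f x else 0)"
      proof (cases "x \<in> {0<..<t}")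
        case True
        define \<delta> where "\<delta> = cos (2 * x - t) - cos t"
        have \<delta>: "\<delta> > 0" using cos_arc[OF x t] True by (simp add: \<delta>_def)
        obtain N :: nat where N: "1 / \<delta> \<le> real N" using real_arch_simple by blast
        have "G n (cis (2 * x)) = 1" if "n \<ge> N" for n
        proof -
          have "1 / \<delta> \<le> real n" using N that by linarith
          then have "1 \<le> real n * \<delta>" using \<delta> by (simp add: field_simps)
          then show ?thesis using \<delta> unfolding Gx \<delta>_def[symmetric] by simp
        qed
        then have "\<forall>\<^sub>F n in sequentially. complex_of_real (G n (cis (2 * x))) * f x = f x"
          unfolding eventually_sequentially by (intro exI[of _ N]) simp
        then show ?thesis using True by (simp add: tendsto_eventually)
      next
        case False
        then have "\<not> cos t < cos (2 * x - t)" using cos_arc[OF x t] by blast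
        then have "cos (2 * x - t) - cos t \<le> 0" by simp
        then have "G n (cis (2 * x)) = 0" for n unfolding Gx by (simp add: max_def)
        then show ?thesis using False by auto
      qed
    qed
    show "AE x in I_pi. norm (complex_of_real (G n (cis (2 * x))) * f x) \<le> cmod (f x)" for n
    proof (rule AE_I2)
      fix x
      have "0 \<le> G n (cis (2 * x))" "G n (cis (2 * x)) \<le> 1" unfolding G_def by auto
      then show "norm (complex_of_real (G n (cis (2 * x))) * f x) \<le> cmod (f x)"
        by (simp add: norm_mult mult_left_le_one_le)
    qed
    show "(\<lambda>x. if x \<in> {0<..<t} then f x else 0) \<in> borel_measurable I_pi"
      by (rule measurable_If_set) (auto simp: sets_restrict_space_iff)
    show "integrable I_pi (\<lambda>x. cmod (f x))" using f by (rule integrable_norm)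
  qed measurable
  have "(LINT x|I_pi. complex_of_real (G n (cis (2 * x))) * f x) = 0" for n
    by (rule integral_circle_function_eq_0) (unfold G_def, intro continuous_intros)
  then have "(LINT x|I_pi. (if x \<in> {0<..<t} then f x else 0)) = 0"
    using lim by (simp add: LIMSEQ_const_iff)
  moreover have "(LINT x|I_pi. (if x \<in> {0<..<t} then f x else 0)) = (LINT x|lebesgue_on ({0<..<t} \<inter> {0..pi}). f x)"
    by (intro Lebesgue_Measure.integral_restrict_Int) auto
  moreover have "{0<..<t} \<inter> {0..pi} = {0<..<t}" using t by auto
  moreover have "(LINT x|lebesgue_on {0<..<t}. f x) = integral {0<..<t} f"
  proof (rule lebesgue_integral_eq_integral[OF absolutely_integrable_imp_integrable])
    have "f absolutely_integrable_on {0..pi}"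
      using f by (simp add: integrable_restrict_space set_integrable_def)
    then show "f absolutely_integrable_on {0<..<t}"
      by (rule set_integrable_subset) (use t in auto)
  qed auto
  ultimately show "integral {0..t} f = 0"
    using integral_open_interval_real[of 0 t f] by simp
qed

end

definition trig :: "int \<Rightarrow> int \<Rightarrow> real \<Rightarrow> complex" where
  "trig \<theta> m x = complex_of_real (1 / sqrt pi) * cis (real_of_int (2 * m + \<theta>) * x)"

lemma continuous_on_trig: "continuous_on S (trig \<theta> m)"
  unfolding trig_def[abs_def] by (intro continuous_intros)

lemma square_integrable_continuous:
  assumes "continuous_on {0..pi} f"
  shows "square_integrable f"
  unfolding square_integrable_def
  using assms by (auto intro!: continuous_imp_measurable_on_sets_lebesgue continuous_imp_integrable_real continuous_intros)

lemma square_integrable_trig: "square_integrable (trig \<theta> m)"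
  by (intro square_integrable_continuous continuous_on_trig)

lemma cmod_trig: "cmod (trig \<theta> m x) = 1 / sqrt pi"
  by (simp add: trig_def norm_mult norm_divide)

definition trig_L2 :: "int \<Rightarrow> int \<Rightarrow> L2" where
  "trig_L2 \<theta> m = abs_L2 (trig \<theta> m)"

lemma cinner_trig_L2: "cinner (trig_L2 \<theta> j) (trig_L2 \<theta> k) = (if j = k then 1 else 0)"
proof -
  have "cnj (trig \<theta> j x) * trig \<theta> k x = complex_of_real (1 / pi) * cis (real_of_int (2 * (k - j)) * x)" for x
  proof -
    have "cnj (trig \<theta> j x) * trig \<theta> k x = complex_of_real ((1 / sqrt pi) * (1 / sqrt pi)) *
        (cis (- (real_of_int (2 * j + \<theta>) * x)) * cis (real_of_int (2 * k + \<theta>) * x))"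
      by (simp only: trig_def complex_cnj_mult cis_cnj complex_cnj_complex_of_real of_real_mult mult_ac)
    also have "(1 / sqrt pi) * (1 / sqrt pi) = 1 / pi" by simp
    finally show ?thesis by (simp add: cis_mult algebra_simps)
  qed
  then show ?thesis
    unfolding trig_L2_def cinner_abs_L2[OF square_integrable_trig square_integrable_trig]
    using integral_cis[of "k - j"] by simp
qed

text \<open>Multiplication by \<open>cis (- \<theta> * x)\<close> reduces every
  \<open>\<theta>\<close> to even frequencies. The index is \<open>- m\<close> because the inner
  product conjugates the exponential.\<close>

lemma trig_L2_total:
  assumes "\<And>m. cinner (trig_L2 \<theta> m) h = 0"
  shows "h = 0"
proof -
  obtain f where f: "square_integrable f" "h = abs_L2 f" by (rule L2_cases)
  define g where "g x = cis (- (real_of_int \<theta> * x)) * f x" for x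
  have gi: "integrable I_pi g"
    unfolding g_def by (intro integrable_continuous_mult continuous_intros square_integrable_imp_integrable f)
  have "(LINT x|I_pi. cis (real_of_int (2 * m) * x) * g x) = 0" for m
  proof -
    have "cnj (trig \<theta> (- m) x) * f x = complex_of_real (1 / sqrt pi) * (cis (real_of_int (2 * m) * x) * g x)" for x
    proof -
      have c: "cis (- (real_of_int (2 * (- m) + \<theta>) * x)) = cis (real_of_int (2 * m) * x) * cis (- (real_of_int \<theta> * x))"
        by (simp add: cis_mult algebra_simps)
      show ?thesis
        unfolding trig_def g_def complex_cnj_mult cis_cnj complex_cnj_complex_of_real c by (simp only: mult.assoc)
    qed
    then have "complex_of_real (1 / sqrt pi) * (LINT x|I_pi. cis (real_of_int (2 * m) * x) * g x) = cinner (trig_L2 \<theta> (- m)) h"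
      unfolding trig_L2_def f(2) cinner_abs_L2[OF square_integrable_trig f(1)] by simp
    then show ?thesis using assms[of "- m"] by simp
  qed
  then have "AE x in I_pi. g x = 0" by (rule AE_zero_if_orthogonal[OF gi])
  then have "AE x in I_pi. f x = 0" by eventually_elim (simp add: g_def)
  then have "L2_rel f (\<lambda>_. 0)" using f(1) by (simp add: L2_rel_def square_integrable_zero)
  then show ?thesis unfolding f(2) zero_L2_def by (rule abs_L2_eqI)
qed

text \<open>Enumerated by \<open>nat\<close>, as needed for convergent series and for
  \<open>riesz_basis\<close>; the version indexed by the integers has the same range and hence the
  same span.\<close>

lemma onb_trig_L2_decode: "onb (\<lambda>k. trig_L2 \<theta> (int_decode k))"
proof (rule onb_if_total)
  show "cinner (trig_L2 \<theta> (int_decode j)) (trig_L2 \<theta> (int_decode k)) = (if j = k then 1 else 0)" for j k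
    by (simp add: cinner_trig_L2 int_decode_eq)
  fix h assume "\<And>k. cinner (trig_L2 \<theta> (int_decode k)) h = 0"
  then have "cinner (trig_L2 \<theta> m) h = 0" for m by (metis int_encode_inverse)
  then show "h = 0" by (rule trig_L2_total)
qed

lemma onb_trig_L2: "onb (trig_L2 \<theta>)"
proof -
  have "range (\<lambda>k. trig_L2 \<theta> (int_decode k)) = range (trig_L2 \<theta>)"
    using surj_int_decode by (metis fun.set_map image_image)
  then show ?thesis
    using onb_trig_L2_decode[of \<theta>] cinner_trig_L2 unfolding onb_def by simp
qed

section \<open>The periodic and antiperiodic realizations\<close>

text \<open>The product is absolutely continuous, so its density integrates to the boundary terms.
  Uniqueness of derivatives identifies this density with the product rule almost everywhere.\<close>

theorem integral_by_parts_abs_cont: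
  fixes F \<phi> :: "real \<Rightarrow> complex"
  assumes F: "abs_cont 0 pi F" and r: "AE x in I_pi. (F has_vector_derivative r x) (at x within {0..pi})" "integrable I_pi r"
    and \<phi>: "\<And>x. (\<phi> has_vector_derivative \<phi>' x) (at x within {0..pi})" "continuous_on {0..pi} \<phi>'"
  shows "(LINT x|I_pi. \<phi>' x * F x) + (LINT x|I_pi. \<phi> x * r x) = \<phi> pi * F pi - \<phi> 0 * F 0"
proof -
  have F_cont: "continuous_on {0..pi} F" by (rule abs_cont_imp_continuous_on[OF F])
  have \<phi>_cont: "continuous_on {0..pi} \<phi>"
    using \<phi>(1) has_vector_derivative_continuous continuous_on_eq_continuous_within by blast
  have bounded: "\<exists>K>0. \<forall>x\<in>{0..pi}. cmod (u x) \<le> K" if u: "continuous_on {0..pi} u" for u :: "real \<Rightarrow> complex"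
  proof -
    obtain K where "\<forall>y\<in>u ` {0..pi}. cmod y \<le> K"
      using compact_imp_bounded[OF compact_continuous_image[OF u compact_Icc]] unfolding bounded_iff by blast
    then show ?thesis by (intro exI[of _ "max K 1"]) (auto simp: le_max_iff_disj)
  qed
  obtain K where K: "K > 0" "\<And>x. x \<in> {0..pi} \<Longrightarrow> cmod (\<phi> x) \<le> K" using bounded[OF \<phi>_cont] by blast
  obtain K' where K': "K' > 0" "\<And>x. x \<in> {0..pi} \<Longrightarrow> cmod (\<phi>' x) \<le> K'" using bounded[OF \<phi>(2)] by blast
  obtain B where B: "B > 0" "\<And>x. x \<in> {0..pi} \<Longrightarrow> cmod (F x) \<le> B" using bounded[OF F_cont] by blast
  have lip: "cmod (\<phi> y - \<phi> x) \<le> K' * (y - x)" if "0 \<le> x" "x < y" "y \<le> pi" for x y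
  proof -
    have "cmod (\<phi> y - \<phi> x) \<le> K' * norm (y - x)"
    proof (rule differentiable_bound[where S="{0..pi}" and f'="\<lambda>x h. h *\<^sub>R \<phi>' x"])
      show "(\<phi> has_derivative (\<lambda>h. h *\<^sub>R \<phi>' x)) (at x within {0..pi})" for x
        using \<phi>(1)[of x] by (simp add: has_vector_derivative_def)
      show "onorm (\<lambda>h. h *\<^sub>R \<phi>' x) \<le> K'" if "x \<in> {0..pi}" for x
        using K'(2)[OF that] K'(1) by (intro onorm_bound) (auto simp: mult.commute[of K'] intro: mult_left_mono)
    qed (use that in auto)
    then show ?thesis using that by simp
  qed
  \<comment> \<open>An increment of the product splits into an increment of \<open>F\<close> times a
    bounded factor and an increment of \<open>\<phi>\<close>, which is Lipschitz, times a bounded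
    factor.\<close>
  have "abs_cont 0 pi (\<lambda>x. \<phi> x * F x)"
  proof (rule abs_cont_dominated[OF F K(1), of "K' * B"])
    show "K' * B \<ge> 0" using K'(1) B(1) by simp
    fix x y :: real assume xy: "0 \<le> x" "x < y" "y \<le> pi"
    have "\<phi> y * F y - \<phi> x * F x = \<phi> y * (F y - F x) + (\<phi> y - \<phi> x) * F x" by (simp add: algebra_simps)
    then have "cmod (\<phi> y * F y - \<phi> x * F x) \<le> cmod (\<phi> y) * cmod (F y - F x) + cmod (\<phi> y - \<phi> x) * cmod (F x)"
      by (metis norm_mult norm_triangle_ineq)
    also have "\<dots> \<le> K * cmod (F y - F x) + (K' * (y - x)) * B"
      using xy K B lip[OF xy] K' by (intro add_mono mult_mono) auto
    finally show "cmod (\<phi> y * F y - \<phi> x * F x) \<le> K * cmod (F y - F x) + K' * B * (y - x)"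
      by (simp add: mult_ac)
  qed
  then obtain \<rho> where \<rho>: "integrable I_pi \<rho>"
    "AE x in I_pi. ((\<lambda>x. \<phi> x * F x) has_vector_derivative \<rho> x) (at x within {0..pi})"
    "integral\<^sup>L I_pi \<rho> = \<phi> pi * F pi - \<phi> 0 * F 0"
    by (rule abs_cont_fundamental_theorem[OF pi_gt_zero])
  have ints: "integrable I_pi (\<lambda>x. \<phi>' x * F x)" "integrable I_pi (\<lambda>x. \<phi> x * r x)"
    by (intro integrable_continuous_mult \<phi>(2) continuous_imp_integrable_real F_cont \<phi>_cont r(2))+
  have sp: "AE x in I_pi. x \<in> {0..pi}" using AE_space[of I_pi] by simp
  have "integral\<^sup>L I_pi \<rho> = (LINT x|I_pi. \<phi>' x * F x + \<phi> x * r x)"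
  proof (rule integral_cong_AE)
    show "\<rho> \<in> borel_measurable I_pi" "(\<lambda>x. \<phi>' x * F x + \<phi> x * r x) \<in> borel_measurable I_pi"
      using \<rho>(1) ints by auto
    show "AE x in I_pi. \<rho> x = \<phi>' x * F x + \<phi> x * r x"
      using sp \<rho>(2) r(1)
    proof eventually_elim
      case (elim x)
      have "((\<lambda>x. \<phi> x * F x) has_vector_derivative (\<phi> x * r x + \<phi>' x * F x)) (at x within {0..pi})"
        by (rule has_vector_derivative_mult[OF \<phi>(1) elim(3)])
      then show ?case
        using vector_derivative_unique_within_closed_interval[of 0 pi x, OF pi_gt_zero] elim(1,2)
        by (metis add.commute box_real(2))
    qed
  qed
  then show ?thesis using \<rho>(3) ints by simp
qed

text \<open>Lebesgue measure is complete, so a function almost equal to a measurable one is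
  measurable. Extension by 0 reduces this to the whole line.\<close>

lemma measurable_AE_I_pi:
  fixes f g :: "real \<Rightarrow> complex"
  assumes f: "f \<in> borel_measurable I_pi" and ae: "AE x in I_pi. f x = g x"
  shows "g \<in> borel_measurable I_pi"
proof -
  have "AE x in lebesgue. x \<in> {0..pi} \<longrightarrow> f x = g x"
    using ae by (subst (asm) AE_restrict_space_iff) auto
  then have "AE x in lebesgue. (if x \<in> {0..pi} then f x else 0) = (if x \<in> {0..pi} then g x else 0)"
    by eventually_elim auto
  then have "(\<lambda>x. if x \<in> {0..pi} then g x else 0) \<in> borel_measurable lebesgue"
    using borel_measurable_AE[OF borel_measurable_if_I[OF f]] by simp
  then show ?thesis by (rule borel_measurable_if_D)
qed

lemma square_integrable_AE:
  assumes "square_integrable f" "AE x in I_pi. f x = g x"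
  shows "square_integrable g"
proof -
  have g: "g \<in> borel_measurable I_pi"
    using assms measurable_AE_I_pi unfolding square_integrable_def by blast
  have "integrable I_pi (\<lambda>x. (cmod (g x))\<^sup>2)"
  proof (rule integrable_cong_AE_imp)
    show "integrable I_pi (\<lambda>x. (cmod (f x))\<^sup>2)" using assms(1) by (simp add: square_integrable_def)
    show "AE x in I_pi. (cmod (f x))\<^sup>2 = (cmod (g x))\<^sup>2" using assms(2) by eventually_elim simp
  qed (use g in measurable)
  then show ?thesis using g by (simp add: square_integrable_def)
qed

lemma D_pi_eqI: "x \<in> {0..pi} \<Longrightarrow> (f has_vector_derivative d) (at x within {0..pi}) \<Longrightarrow> D_pi f x = d"
  unfolding D_pi_def using vector_derivative_within_closed_interval[OF pi_gt_zero] by blast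

lemma D_pi_has_vector_derivative:
  "f differentiable (at x within {0..pi}) \<Longrightarrow> (f has_vector_derivative D_pi f x) (at x within {0..pi})"
  unfolding D_pi_def by (simp add: vector_derivative_works)

text \<open>Provides an integrable \<open>\<rho>\<close> to work with instead of
  \<open>D_pi (D_pi g)\<close>, whose values carry no meaning on an exceptional null set.\<close>

lemma maximal_domain_second_derivative:
  assumes "g \<in> maximal_domain V"
  obtains \<rho> where "integrable I_pi \<rho>"
    "AE x in I_pi. (D_pi g has_vector_derivative \<rho> x) (at x within {0..pi})"
    "AE x in I_pi. D_pi (D_pi g) x = \<rho> x"
proof -
  have "abs_cont 0 pi (D_pi g)" using assms by (auto simp: maximal_domain_def intro: abs_cont_if_Icc)
  then obtain \<rho> where \<rho>: "integrable I_pi \<rho>" "AE x in I_pi. (D_pi g has_vector_derivative \<rho> x) (at x within {0..pi})"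
    by (rule abs_cont_fundamental_theorem[OF pi_gt_zero])
  have "AE x in I_pi. x \<in> {0..pi}" using AE_space[of I_pi] by simp
  then have "AE x in I_pi. D_pi (D_pi g) x = \<rho> x"
    using \<rho>(2) by eventually_elim (rule D_pi_eqI)
  then show ?thesis by (rule that[OF \<rho>])
qed

section \<open>The realizations in terms of Fourier coefficients\<close>

text \<open>One multiplier \<open>s\<close> treats both boundary conditions at once, as 1 or
  -1.\<close>

definition H_bc :: "complex \<Rightarrow> (real \<Rightarrow> complex) \<Rightarrow> (L2 \<times> L2) set" where
  "H_bc s V = {(abs_L2 g, abs_L2 (schroedinger_expr V g)) | g.
     g \<in> maximal_domain V \<and> g pi = s * g 0 \<and> D_pi g pi = s * D_pi g 0}"

lemma H_P_eq: "H_P V = H_bc 1 V" and H_AP_eq: "H_AP V = H_bc (- 1) V"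
  by (simp_all add: H_P_def H_AP_def H_bc_def)

lemma absolutely_continuous_scale:
  assumes "absolutely_continuous_on_Icc a b f"
  shows "absolutely_continuous_on_Icc a b (\<lambda>x. c * f x)"
  unfolding absolutely_continuous_on_Icc_def
proof (intro allI impI)
  fix \<epsilon> :: real assume \<epsilon>: "\<epsilon> > 0"
  then have "\<epsilon> / (cmod c + 1) > 0" by (simp add: add_nonneg_pos)
  then obtain \<delta> where \<delta>: "\<delta> > 0" and H: "\<And>D. finite D \<Longrightarrow> \<forall>(s, t)\<in>D. a \<le> s \<and> s \<le> t \<and> t \<le> b \<Longrightarrow>
        pairwise (\<lambda>(s, t) (u, v). {s<..<t} \<inter> {u<..<v} = {}) D \<Longrightarrow>
        (\<Sum>(s, t)\<in>D. t - s) < \<delta> \<Longrightarrow> (\<Sum>(s, t)\<in>D. cmod (f t - f s)) < \<epsilon> / (cmod c + 1)"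
    using assms unfolding absolutely_continuous_on_Icc_def by meson
  have "(\<Sum>(s, t)\<in>D. cmod (c * f t - c * f s)) < \<epsilon>"
    if "finite D" "\<forall>(s, t)\<in>D. a \<le> s \<and> s \<le> t \<and> t \<le> b"
      "pairwise (\<lambda>(s, t) (u, v). {s<..<t} \<inter> {u<..<v} = {}) D" "(\<Sum>(s, t)\<in>D. t - s) < \<delta>" for D
  proof -
    have "(\<Sum>(s, t)\<in>D. cmod (c * f t - c * f s)) = cmod c * (\<Sum>(s, t)\<in>D. cmod (f t - f s))"
      unfolding sum_distrib_left by (intro sum.cong) (auto simp: norm_mult simp flip: right_diff_distrib)
    also have "\<dots> \<le> (cmod c + 1) * (\<Sum>(s, t)\<in>D. cmod (f t - f s))"
      by (intro mult_right_mono sum_nonneg) auto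
    also have "\<dots> < (cmod c + 1) * (\<epsilon> / (cmod c + 1))"
      using H[OF that] by (intro mult_strict_left_mono) (auto simp: add_nonneg_pos)
    also have "\<dots> = \<epsilon>" by (simp add: add_nonneg_eq_0_iff)
    finally show ?thesis .
  qed
  then show "\<exists>\<delta>>0. \<forall>D. finite D \<longrightarrow> (\<forall>(s, t)\<in>D. a \<le> s \<and> s \<le> t \<and> t \<le> b) \<longrightarrow>
        pairwise (\<lambda>(s, t) (u, v). {s<..<t} \<inter> {u<..<v} = {}) D \<longrightarrow>
        (\<Sum>(s, t)\<in>D. t - s) < \<delta> \<longrightarrow> (\<Sum>(s, t)\<in>D. cmod (c * f t - c * f s)) < \<epsilon>"
    using \<delta> by blast
qed

lemma absolutely_continuous_cong:
  assumes "absolutely_continuous_on_Icc a b f" "\<And>x. x \<in> {a..b} \<Longrightarrow> f x = g x"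
  shows "absolutely_continuous_on_Icc a b g"
proof -
  have eq: "(\<Sum>(s, t)\<in>D. cmod (f t - f s)) = (\<Sum>(s, t)\<in>D. cmod (g t - g s))"
    if "\<forall>(s, t)\<in>D. a \<le> s \<and> s \<le> t \<and> t \<le> b" for D
    using that assms(2) by (intro sum.cong) auto
  show ?thesis
    using assms(1) unfolding absolutely_continuous_on_Icc_def by (metis (lifting) eq)
qed

text \<open>The value of \<open>D_pi (D_pi g)\<close> is arbitrary where \<open>D_pi g\<close> is not differentiable, so even homogeneity of
  the operator rests on the almost everywhere differentiability of absolutely continuous functions.\<close>

lemma H_bc_scale:
  assumes "(f, h) \<in> H_bc s V"
  shows "(c *\<^sub>C f, c *\<^sub>C h) \<in> H_bc s V"
proof -
  obtain g where g: "f = abs_L2 g" "h = abs_L2 (schroedinger_expr V g)" "g \<in> maximal_domain V"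
      "g pi = s * g 0" "D_pi g pi = s * D_pi g 0"
    using assms by (auto simp: H_bc_def)
  let ?g = "\<lambda>x. c * g x"
  have sq: "square_integrable g" "square_integrable (schroedinger_expr V g)" and
      diff: "\<And>x. x \<in> {0..pi} \<Longrightarrow> g differentiable (at x within {0..pi})"
    using g(3) by (auto simp: maximal_domain_def)
  have dg: "(?g has_vector_derivative c * D_pi g x) (at x within {0..pi})" if "x \<in> {0..pi}" for x
    by (intro has_vector_derivative_mult_right D_pi_has_vector_derivative diff that)
  have D: "D_pi ?g x = c * D_pi g x" if "x \<in> {0..pi}" for x
    using D_pi_eqI[OF that dg[OF that]] .
  obtain \<rho> where \<rho>: "AE x in I_pi. (D_pi g has_vector_derivative \<rho> x) (at x within {0..pi})"
      "AE x in I_pi. D_pi (D_pi g) x = \<rho> x"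
    by (rule maximal_domain_second_derivative[OF g(3)])
  have sp: "AE x in I_pi. x \<in> {0..pi}" using AE_space[of I_pi] by simp
  have AE: "AE x in I_pi. c * schroedinger_expr V g x = schroedinger_expr V ?g x"
    using sp \<rho>
  proof eventually_elim
    case (elim x)
    have "((\<lambda>x. c * D_pi g x) has_vector_derivative c * \<rho> x) (at x within {0..pi})"
      by (intro has_vector_derivative_mult_right elim)
    then have "(D_pi ?g has_vector_derivative c * \<rho> x) (at x within {0..pi})"
      using D elim(1) by (intro has_vector_derivative_transform[of x "{0..pi}" "D_pi ?g" "\<lambda>x. c * D_pi g x"]) auto
    then have "D_pi (D_pi ?g) x = c * \<rho> x" using D_pi_eqI elim(1) by blast
    then show ?case using elim(3) by (simp add: schroedinger_expr_def algebra_simps)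
  qed
  have sq': "square_integrable (schroedinger_expr V ?g)"
    by (rule square_integrable_AE[OF square_integrable_scale[OF sq(2)] AE])
  have "?g \<in> maximal_domain V"
    unfolding maximal_domain_def
  proof (intro CollectI conjI ballI)
    show "absolutely_continuous_on_Icc 0 pi ?g"
      using g(3) by (auto simp: maximal_domain_def intro: absolutely_continuous_scale)
    show "?g differentiable (at x within {0..pi})" if "x \<in> {0..pi}" for x
      using dg[OF that] unfolding differentiable_def has_vector_derivative_def by blast
    have "absolutely_continuous_on_Icc 0 pi (\<lambda>x. c * D_pi g x)"
      using g(3) by (auto simp: maximal_domain_def intro: absolutely_continuous_scale)
    then show "absolutely_continuous_on_Icc 0 pi (D_pi ?g)"
      by (rule absolutely_continuous_cong) (simp add: D)
  qed (use sq sq' in \<open>auto intro: square_integrable_scale\<close>)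
  then have "(abs_L2 ?g, abs_L2 (schroedinger_expr V ?g)) \<in> H_bc s V"
    using g(4,5) D[of pi] D[of 0] by (auto simp: H_bc_def mult_ac)
  moreover have "c *\<^sub>C f = abs_L2 ?g" unfolding g(1) by (rule scaleC_abs_L2[OF sq(1)])
  moreover have "c *\<^sub>C h = abs_L2 (schroedinger_expr V ?g)"
    unfolding g(2) scaleC_abs_L2[OF sq(2)]
    by (rule abs_L2_eqI) (simp add: L2_rel_def AE sq' square_integrable_scale[OF sq(2)])
  ultimately show ?thesis by simp
qed

text \<open>Ensures that normalizing a basis of root vectors keeps it one; homogeneity of the graph
  suffices, since only multiples are taken.\<close>

lemma root_vectors_scale:
  assumes scale: "\<And>f g c. (f, g) \<in> A \<Longrightarrow> (c *\<^sub>C f, c *\<^sub>C g) \<in> A"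
    and f: "f \<in> root_vectors A" and c: "c \<noteq> 0"
  shows "c *\<^sub>C f \<in> root_vectors A"
proof -
  have shift: "(c *\<^sub>C x, c *\<^sub>C y) \<in> shift_op A \<mu>" if xy: "(x, y) \<in> shift_op A \<mu>" for x y \<mu>
  proof -
    obtain g where g: "(x, g) \<in> A" "y = g - \<mu> *\<^sub>C x" using xy by (auto simp: shift_op_def)
    have "c *\<^sub>C y = c *\<^sub>C g - \<mu> *\<^sub>C (c *\<^sub>C x)"
      by (simp add: g(2) cspace.scale_right_diff_distrib mult.commute)
    then show ?thesis using scale[OF g(1), of c] by (auto simp: shift_op_def)
  qed
  have pow: "(c *\<^sub>C x, c *\<^sub>C y) \<in> shift_op A \<mu> ^^ m" if "(x, y) \<in> shift_op A \<mu> ^^ m" for x y \<mu> m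
    using that
  proof (induction m arbitrary: y)
    case (Suc m)
    then obtain z where z: "(x, z) \<in> shift_op A \<mu> ^^ m" "(z, y) \<in> shift_op A \<mu>" by auto
    show ?case using relcompI[OF Suc.IH[OF z(1)] shift[OF z(2)]] by simp
  qed simp
  obtain \<mu> m where "f \<noteq> 0" "eigenvalue A \<mu>" "(f, 0) \<in> shift_op A \<mu> ^^ m"
    using f unfolding root_vectors_def by blast
  moreover from pow[OF this(3)] have "(c *\<^sub>C f, 0) \<in> shift_op A \<mu> ^^ m" by simp
  moreover have "c *\<^sub>C f \<noteq> 0" using c \<open>f \<noteq> 0\<close> by simp
  ultimately show ?thesis
    unfolding root_vectors_def by blast
qed

definition freq :: "int \<Rightarrow> int \<Rightarrow> nat" where
  "freq \<theta> m = nat \<bar>2 * m + \<theta>\<bar>"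

text \<open>The potential is moved to the exponential: the \<open>m\<close>-th coefficient of
  \<open>V g\<close> is the inner product of this vector with \<open>g\<close>, which makes sense
  although multiplication by \<open>V\<close> may be unbounded.\<close>

definition pot_L2 :: "(real \<Rightarrow> complex) \<Rightarrow> int \<Rightarrow> int \<Rightarrow> L2" where
  "pot_L2 V \<theta> m = abs_L2 (\<lambda>x. cnj (V x) * trig \<theta> m x)"

lemma square_integrable_pot:
  assumes "square_integrable V"
  shows "square_integrable (\<lambda>x. cnj (V x) * trig \<theta> m x)"
proof -
  have V: "V \<in> borel_measurable I_pi" using assms by (simp add: square_integrable_def)
  have t: "trig \<theta> m \<in> borel_measurable I_pi" using square_integrable_trig by (simp add: square_integrable_def)
  have "(\<lambda>x. cnj (V x)) \<in> borel_measurable I_pi"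
    by (rule borel_measurable_continuous_on[of cnj, OF _ V]) (intro continuous_intros)
  then have "(\<lambda>x. cnj (V x) * trig \<theta> m x) \<in> borel_measurable I_pi" using t by (rule borel_measurable_times)
  moreover have "(cmod (cnj (V x) * trig \<theta> m x))\<^sup>2 = (1 / pi) * (cmod (V x))\<^sup>2" for x
    by (simp add: norm_mult cmod_trig power_mult_distrib power_divide)
  ultimately show ?thesis using assms by (simp add: square_integrable_def)
qed

text \<open>The exponentials have constant modulus \<open>1 / sqrt pi < 1\<close>, so multiplication
  by \<open>cnj (V x)\<close> gives vectors of norm at most that of \<open>V\<close>. A frequency
  \<open>y\<close> leaves the two equations \<open>2 m + \<theta> = y\<close> and
  \<open>2 m + \<theta> = - y\<close>.\<close>

lemma perturbed_diagonal_trig: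
  assumes V: "square_integrable V"
  shows "perturbed_diagonal (trig_L2 \<theta>) (freq \<theta>) (pot_L2 V \<theta>) (norm (abs_L2 V))"
proof
  show "onb (trig_L2 \<theta>)" by (rule onb_trig_L2)
  fix y :: nat
  have sub: "{m. freq \<theta> m = y} \<subseteq> {(int y - \<theta>) div 2, (- int y - \<theta>) div 2}"
    by (auto simp: freq_def abs_if split: if_splits)
  then show "finite {m. freq \<theta> m = y}" by (rule finite_subset) simp
  have "card {m. freq \<theta> m = y} \<le> card {(int y - \<theta>) div 2, (- int y - \<theta>) div 2}"
    by (rule card_mono[OF _ sub]) simp
  also have "\<dots> \<le> 2" by (simp add: card_insert_if)
  finally show "card {m. freq \<theta> m = y} \<le> 2" .
next
  fix m
  have eq: "(cmod (cnj (V x) * trig \<theta> m x))\<^sup>2 = (1 / pi) * (cmod (V x))\<^sup>2" for x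
    by (simp add: norm_mult cmod_trig power_mult_distrib power_divide)
  have "(norm (pot_L2 V \<theta> m))\<^sup>2 = (1 / pi) * (norm (abs_L2 V))\<^sup>2"
    unfolding pot_L2_def norm_abs_L2[OF square_integrable_pot[OF V]] norm_abs_L2[OF V] eq by simp
  also have "\<dots> \<le> 1 * (norm (abs_L2 V))\<^sup>2"
    using pi_gt3 by (intro mult_right_mono) auto
  finally have "(norm (pot_L2 V \<theta> m))\<^sup>2 \<le> (norm (abs_L2 V))\<^sup>2"
    by (simp only: mult_1)
  then show "norm (pot_L2 V \<theta> m) \<le> norm (abs_L2 V)"
    by (rule power2_le_imp_le) simp
qed

text \<open>Two integrations by parts move the derivatives to the exponential, which satisfies the
  same boundary condition, so the boundary terms cancel. An inclusion suffices: eigenvectors and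
  root vector chains of the smaller graph belong to the larger one as well.\<close>

lemma H_bc_subset_op:
  assumes V: "square_integrable V" and s: "s = cis (pi * real_of_int \<theta>)"
  shows "H_bc s V \<subseteq> perturbed_diagonal.op (trig_L2 \<theta>) (freq \<theta>) (pot_L2 V \<theta>)"
proof
  fix p assume "p \<in> H_bc s V"
  then obtain g where g: "p = (abs_L2 g, abs_L2 (schroedinger_expr V g))" "g \<in> maximal_domain V"
      "g pi = s * g 0" "D_pi g pi = s * D_pi g 0"
    by (auto simp: H_bc_def)
  have sq: "square_integrable g" "square_integrable (schroedinger_expr V g)" and
      diff: "\<And>x. x \<in> {0..pi} \<Longrightarrow> g differentiable (at x within {0..pi})" and
      ac: "abs_cont 0 pi g" "abs_cont 0 pi (D_pi g)"
    using g(2) by (auto simp: maximal_domain_def intro: abs_cont_if_Icc)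
  obtain \<rho> where \<rho>: "integrable I_pi \<rho>" "AE x in I_pi. (D_pi g has_vector_derivative \<rho> x) (at x within {0..pi})"
      "AE x in I_pi. D_pi (D_pi g) x = \<rho> x"
    by (rule maximal_domain_second_derivative[OF g(2)])
  have sp: "AE x in I_pi. x \<in> {0..pi}" using AE_space[of I_pi] by simp
  have g_cont: "continuous_on {0..pi} g" by (rule abs_cont_imp_continuous_on[OF ac(1)])
  have Dg_cont: "continuous_on {0..pi} (D_pi g)" by (rule abs_cont_imp_continuous_on[OF ac(2)])
  interpret perturbed_diagonal "trig_L2 \<theta>" "freq \<theta>" "pot_L2 V \<theta>" "norm (abs_L2 V)"
    by (rule perturbed_diagonal_trig[OF V])
  have "cinner (trig_L2 \<theta> m) (abs_L2 (schroedinger_expr V g))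
      = (of_nat (freq \<theta> m))\<^sup>2 * cinner (trig_L2 \<theta> m) (abs_L2 g) + cinner (pot_L2 V \<theta> m) (abs_L2 g)" for m
  proof -
    define w where "w = real_of_int (2 * m + \<theta>)"
    define \<phi> where "\<phi> x = cnj (trig \<theta> m x)" for x
    have \<phi>_eq: "\<phi> x = complex_of_real (1 / sqrt pi) * cis (- (w * x))" for x
      unfolding \<phi>_def trig_def w_def complex_cnj_mult complex_cnj_complex_of_real cis_cnj ..
    have \<phi>_cont: "continuous_on S \<phi>" for S unfolding \<phi>_eq[abs_def] by (intro continuous_intros)
    have d\<phi>: "(\<phi> has_vector_derivative (- \<i> * w * \<phi> x)) (at x within {0..pi})" for x
    proof -
      have "((\<lambda>x. cis (- (w * x))) has_vector_derivative (- w) *\<^sub>R (\<i> * cis (- (w * x)))) (at x within {0..pi})"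
        unfolding has_vector_derivative_def by (auto intro!: derivative_eq_intros simp: mult_ac)
      then have "((\<lambda>x. complex_of_real (1 / sqrt pi) * cis (- (w * x))) has_vector_derivative
          complex_of_real (1 / sqrt pi) * ((- w) *\<^sub>R (\<i> * cis (- (w * x))))) (at x within {0..pi})"
        by (rule has_vector_derivative_mult_right)
      moreover have "complex_of_real (1 / sqrt pi) * ((- w) *\<^sub>R (\<i> * cis (- (w * x)))) = - \<i> * w * \<phi> x"
        unfolding \<phi>_eq by (simp add: scaleR_conv_of_real)
      ultimately show ?thesis unfolding \<phi>_eq[abs_def] by simp
    qed
    have d\<phi>_cont: "continuous_on {0..pi} (\<lambda>x. - \<i> * w * \<phi> x)" by (intro continuous_intros \<phi>_cont)
    \<comment> \<open>The phase of \<open>\<phi>\<close> at \<open>pi\<close> is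
      \<open>- (2 m + \<theta>) pi\<close>; multiplying by \<open>s\<close> removes the
      \<open>\<theta>\<close> and leaves a multiple of \<open>2 pi\<close>.\<close>
    have bc: "\<phi> pi * (s * z) - \<phi> 0 * z = 0" for z
    proof -
      have "cis (- (w * pi)) * s = cis (2 * pi * real_of_int (- m))"
        unfolding s w_def cis_mult by (simp add: algebra_simps)
      also have "\<dots> = 1" by (rule cis_multiple_2pi) simp
      finally have "cis (- (w * pi)) * s = 1" .
      then have "\<phi> pi * s = \<phi> 0" unfolding \<phi>_eq by (simp add: mult.assoc)
      then show ?thesis by (simp add: mult.assoc[symmetric])
    qed
    have "(LINT x|I_pi. - \<i> * w * \<phi> x * D_pi g x) + (LINT x|I_pi. \<phi> x * \<rho> x) = 0"
      using integral_by_parts_abs_cont[OF ac(2) \<rho>(2,1) d\<phi> d\<phi>_cont] g(4) bc by simp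
    then have ibp1: "(LINT x|I_pi. \<phi> x * \<rho> x) = \<i> * w * (LINT x|I_pi. \<phi> x * D_pi g x)"
      by (simp add: mult.assoc add_eq_0_iff)
    have "AE x in I_pi. (g has_vector_derivative D_pi g x) (at x within {0..pi})"
      using sp by eventually_elim (intro D_pi_has_vector_derivative diff)
    then have "(LINT x|I_pi. - \<i> * w * \<phi> x * g x) + (LINT x|I_pi. \<phi> x * D_pi g x) = 0"
      using integral_by_parts_abs_cont[OF ac(1) _ continuous_imp_integrable_real[OF Dg_cont] d\<phi> d\<phi>_cont] g(3) bc by simp
    then have ibp2: "(LINT x|I_pi. \<phi> x * D_pi g x) = \<i> * w * (LINT x|I_pi. \<phi> x * g x)"
      by (simp add: mult.assoc add_eq_0_iff)
    have freq: "(of_nat (freq \<theta> m))\<^sup>2 = (complex_of_real w)\<^sup>2"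
    proof -
      have "real (freq \<theta> m) = \<bar>w\<bar>" by (simp add: freq_def w_def)
      then have "(real (freq \<theta> m))\<^sup>2 = w\<^sup>2" by simp
      then show ?thesis by (metis of_real_of_nat_eq of_real_power)
    qed
    have \<rho>w: "(LINT x|I_pi. \<phi> x * \<rho> x) = - ((of_nat (freq \<theta> m))\<^sup>2 * (LINT x|I_pi. \<phi> x * g x))"
      unfolding ibp1 ibp2 freq by (simp add: power2_eq_square mult.assoc[symmetric]) (simp add: mult_ac)
    have Vi: "integrable I_pi (\<lambda>x. (\<phi> x * g x) * V x)"
      by (intro integrable_continuous_mult continuous_intros \<phi>_cont g_cont square_integrable_imp_integrable V)
    have \<rho>i: "integrable I_pi (\<lambda>x. \<phi> x * \<rho> x)"
      by (intro integrable_continuous_mult \<phi>_cont \<rho>(1))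
    have "cinner (trig_L2 \<theta> m) (abs_L2 (schroedinger_expr V g)) = (LINT x|I_pi. \<phi> x * schroedinger_expr V g x)"
      unfolding trig_L2_def \<phi>_def by (rule cinner_abs_L2[OF square_integrable_trig sq(2)])
    also have "\<dots> = (LINT x|I_pi. (\<phi> x * g x) * V x - \<phi> x * \<rho> x)"
    proof (rule integral_cong_AE)
      show "(\<lambda>x. \<phi> x * schroedinger_expr V g x) \<in> borel_measurable I_pi"
        by (intro borel_measurable_integrable integrable_continuous_mult \<phi>_cont square_integrable_imp_integrable sq(2))
      show "(\<lambda>x. (\<phi> x * g x) * V x - \<phi> x * \<rho> x) \<in> borel_measurable I_pi"
        by (intro borel_measurable_integrable Bochner_Integration.integrable_diff Vi \<rho>i)
      show "AE x in I_pi. \<phi> x * schroedinger_expr V g x = (\<phi> x * g x) * V x - \<phi> x * \<rho> x"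
        using \<rho>(3) by eventually_elim (simp add: schroedinger_expr_def algebra_simps)
    qed
    also have "\<dots> = (LINT x|I_pi. (\<phi> x * g x) * V x) - (LINT x|I_pi. \<phi> x * \<rho> x)"
      by (rule Bochner_Integration.integral_diff[OF Vi \<rho>i])
    also have "(LINT x|I_pi. (\<phi> x * g x) * V x) = cinner (pot_L2 V \<theta> m) (abs_L2 g)"
      unfolding pot_L2_def cinner_abs_L2[OF square_integrable_pot[OF V] sq(1)] \<phi>_def by (simp add: mult_ac)
    also have "(LINT x|I_pi. \<phi> x * \<rho> x) = - ((of_nat (freq \<theta> m))\<^sup>2 * cinner (trig_L2 \<theta> m) (abs_L2 g))"
      using \<rho>w unfolding trig_L2_def cinner_abs_L2[OF square_integrable_trig sq(1)] \<phi>_def .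
    finally show ?thesis by simp
  qed
  then show "p \<in> op" unfolding op_def g(1) by blast
qed

theorem riesz_iff_schauder_bc:
  assumes V: "square_integrable V" and s: "s = cis (pi * real_of_int \<theta>)"
  shows "(\<exists>f. range f \<subseteq> root_vectors (H_bc s V) \<and> riesz_basis f) \<longleftrightarrow>
         (\<exists>f. range f \<subseteq> root_vectors (H_bc s V) \<and> schauder_basis f)"
proof
  assume "\<exists>f. range f \<subseteq> root_vectors (H_bc s V) \<and> riesz_basis f"
  then show "\<exists>f. range f \<subseteq> root_vectors (H_bc s V) \<and> schauder_basis f"
    using schauder_basis_if_riesz_basis by blast
next
  assume "\<exists>f. range f \<subseteq> root_vectors (H_bc s V) \<and> schauder_basis f"
  then obtain f where f: "range f \<subseteq> root_vectors (H_bc s V)" "schauder_basis f" by blast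
  \<comment> \<open>Norms in a Schauder basis may be unbounded or tend to 0, while in a Riesz basis
    they lie between two positive constants. Hence the rescaled sequence is the witness.\<close>
  let ?g = "\<lambda>k. complex_of_real (1 / norm (f k)) *\<^sub>C f k"
  have "riesz_basis ?g"
    by (rule riesz_basis_of_root_vectors[OF perturbed_diagonal_trig[OF V] onb_trig_L2_decode[of 0] f(2,1) H_bc_subset_op[OF V s]])
  moreover have "?g k \<in> root_vectors (H_bc s V)" for k
  proof (rule root_vectors_scale)
    show "f k \<in> root_vectors (H_bc s V)" using f(1) by blast
    show "complex_of_real (1 / norm (f k)) \<noteq> 0" using schauder_basis_nonzero[OF f(2), of k] by simp
  qed (rule H_bc_scale)
  ultimately show "\<exists>f. range f \<subseteq> root_vectors (H_bc s V) \<and> riesz_basis f"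
    by (intro exI[of _ ?g]) auto
qed

theorem corollary1p5:
  fixes V :: "real \<Rightarrow> complex"
  assumes "square_integrable V"
  shows "((\<exists>f. range f \<subseteq> root_vectors (H_P V) \<and> riesz_basis f) \<longleftrightarrow>
          (\<exists>f. range f \<subseteq> root_vectors (H_P V) \<and> schauder_basis f)) \<and>
         ((\<exists>f. range f \<subseteq> root_vectors (H_AP V) \<and> riesz_basis f) \<longleftrightarrow>
          (\<exists>f. range f \<subseteq> root_vectors (H_AP V) \<and> schauder_basis f))"
  unfolding H_P_eq H_AP_eq
  \<comment> \<open>\<open>cis 0 = 1\<close> is the periodic and \<open>cis pi = - 1\<close> the
    antiperiodic multiplier.\<close>
  using riesz_iff_schauder_bc[OF assms, of 1 0] riesz_iff_schauder_bc[OF assms, of "-1" 1] by simp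

end
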